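(* Let $\phi$ be a Maass cusp form for $\mathrm{SL}(2,\mathbb Z)$ with Laplace eigenvalue $\tfrac14+r^2$ and Fourier expansion $\phi(z)=\sum_{m\neq0}c(m)y^{1/2}K_{ir}(2\pi|m|y)e^{2\pi imx}$, and let $h$ be a positive integer. Fix $\varepsilon>0$ and let $\mathrm{Re}(s)>1+2\varepsilon$. Then $$\left\langle P_h(\cdot,s),|\phi|^2\right\rangle=\frac{\Gamma(s)}{2(2\pi h)^s}\left(\mathcal G(s)+\mathcal T(s)\right),$$ where $$\mathcal G(s)=\frac1{2\pi i}\int_{\mathrm{Re}(w)=-\frac12-\varepsilon}\frac{\Gamma\left(\frac12s+\frac12+w\right)\Gamma\left(\frac12s+w\right)\Gamma(-w)}{2^{-w}h^{2w}\Gamma\left(s+\frac12+w\right)}\mathcal F_{r,2}(-2w)\sum_{n<-h\text{ or }n>0}c(n)c(n+h)|n(n+h)|^w\,dw,$$ $$\mathcal T(s)=\frac1{2\pi i}\int_{\mathrm{Re}(w)=-\frac12+\varepsilon}\frac{\Gamma\left(\frac12s+\frac12+w\right)\Gamma\left(\frac12s+w\right)\Gamma(-w)}{2^{-w}h^{2w}\Gamma\left(s+\frac12+w\right)}\mathcal F_{r,0}(-2w)\sum_{-h<n<0}c(n)c(n+h)|n(n+h)|^w\,dw.$$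
   Context: $P_h(z,s)=\sum_{\gamma\in\Gamma_\infty\backslash\Gamma}\mathrm{Im}(\gamma z)^se^{2\pi ih\gamma z}$ with $\Gamma=\mathrm{SL}(2,\mathbb Z)$, $\Gamma_\infty=\{\left(\begin{smallmatrix}1&m\\0&1\end{smallmatrix}\right):m\in\mathbb Z\}$; $\langle f,g\rangle=\int_{\Gamma\backslash\mathfrak h}f\overline g\,\frac{dx\,dy}{y^2}$. For $b\in\mathbb R$, $a\ge0$, $\mathcal F_{b,a}(s)=\int_0^1\cos(b\log t)\,t^{\frac12s-1}\left(at+\frac{(1-t)^2}2\right)^{-\frac12s}dt$ (for $\mathrm{Re}(s)>0$, and by the integral for $a=0$ where it converges); in particular $\mathcal F_{b,2}(s)=2^{\frac12s-1}\Gamma(\tfrac12s+ib)\Gamma(\tfrac12s-ib)/\Gamma(s)$ and $\mathcal F_{b,0}(s)=\frac{\cos(i\pi b)}{\cos(\pi s/2)}\mathcal F_{b,2}(s)$.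
   Formalization: In P_h, γ and −γ are identified (otherwise the left side doubles); the displayed formula is proved for real c(n), and with c(n) times the conjugate of c(n+h) in general (φ→iφ breaks it otherwise); ε<1/2 is assumed so that the integral F_{r,0}(−2w) converges. *)

theory Defs
  imports "HOL-Analysis.Analysis"
begin

section \<open>The modular group acting on the upper half plane\<close>

definition upper_half_plane :: "complex set" where
  "upper_half_plane = {z. Im z > 0}"

definition SL2Z :: "(int^2^2) set" where
  "SL2Z = {A. det A = 1}"

definition act :: "int^2^2 \<Rightarrow> complex \<Rightarrow> complex" where
  "act A = moebius (of_int (A$1$1)) (of_int (A$1$2)) (of_int (A$2$1)) (of_int (A$2$2))"

definition Gamma_inf :: "(int^2^2) set" where
  "Gamma_inf = {vector [vector [1, m], vector [0, 1]] | m. True}"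

text \<open>
  The cosets \<open>\<Gamma>\<^sub>\<infinity> \ \<Gamma>\<close>.  Matrices are regarded as transformations of the upper half plane,
  so \<open>A\<close> and \<open>- A\<close>, which act in the same way, are identified.  Only with this identification does
  a Poincare series unfold, without a factor 2, to an integral over the strip \<open>0 \<le> Re z \<le> 1\<close>.
\<close>

definition cosets :: "(int^2^2) set set" where
  "cosets = SL2Z //
     {(A, B). A \<in> SL2Z \<and> (\<exists>N\<in>Gamma_inf. B = N ** A \<or> B = - (N ** A))}"

text \<open>
  Each summand depends only on the coset, because \<open>h\<close> is an integer, so the representative
  that is chosen does not matter.
\<close>

definition poincare :: "int \<Rightarrow> complex \<Rightarrow> complex \<Rightarrow> complex" where
  "poincare h z s = (\<Sum>\<^sub>\<infinity>C\<in>cosets. let \<gamma> = (SOME \<gamma>. \<gamma> \<in> C) in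
     of_real (Im (act \<gamma> z)) powr s * exp (2 * of_real pi * \<i> * of_int h * act \<gamma> z))"

definition fundamental_domain :: "complex set" where
  "fundamental_domain = {z. Im z > 0 \<and> \<bar>Re z\<bar> \<le> 1 / 2 \<and> norm z \<ge> 1}"

definition petersson :: "(complex \<Rightarrow> complex) \<Rightarrow> (complex \<Rightarrow> complex) \<Rightarrow> complex" where
  "petersson f g =
     (LINT z:fundamental_domain|lborel. f z * cnj (g z) / of_real ((Im z)\<^sup>2))"


section \<open>Maass cusp forms\<close>

definition partial_x :: "(complex \<Rightarrow> complex) \<Rightarrow> complex \<Rightarrow> complex" where
  "partial_x f z = vector_derivative (\<lambda>t::real. f (z + of_real t)) (at 0)"

definition partial_y :: "(complex \<Rightarrow> complex) \<Rightarrow> complex \<Rightarrow> complex" where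
  "partial_y f z = vector_derivative (\<lambda>t::real. f (z + \<i> * of_real t)) (at 0)"

text \<open>All iterated partial derivatives up to order \<open>k\<close> exist on the upper half plane, and those of
  order exactly \<open>k\<close> are continuous there (hence so are the lower ones).\<close>

primrec C_k :: "nat \<Rightarrow> (complex \<Rightarrow> complex) \<Rightarrow> bool" where
  "C_k 0 f \<longleftrightarrow> continuous_on upper_half_plane f"
| "C_k (Suc k) f \<longleftrightarrow>
     (\<forall>z\<in>upper_half_plane.
        (\<lambda>t::real. f (z + of_real t)) differentiable (at 0) \<and>
        (\<lambda>t::real. f (z + \<i> * of_real t)) differentiable (at 0)) \<and>
     C_k k (partial_x f) \<and> C_k k (partial_y f)"

definition hyp_laplacian :: "(complex \<Rightarrow> complex) \<Rightarrow> complex \<Rightarrow> complex" where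
  "hyp_laplacian f z =
     - of_real ((Im z)\<^sup>2) * (partial_x (partial_x f) z + partial_y (partial_y f) z)"

definition maass_cusp_form :: "complex \<Rightarrow> (complex \<Rightarrow> complex) \<Rightarrow> bool" where
  "maass_cusp_form ev f \<longleftrightarrow>
     (\<exists>z\<in>upper_half_plane. f z \<noteq> 0) \<and>
     (\<forall>k. C_k k f) \<and>
     (\<forall>A\<in>SL2Z. \<forall>z\<in>upper_half_plane. f (act A z) = f z) \<and>
     (\<forall>z\<in>upper_half_plane. hyp_laplacian f z = ev * f z) \<and>
     set_integrable lborel fundamental_domain (\<lambda>z. (norm (f z))\<^sup>2 / (Im z)\<^sup>2) \<and>
     (\<forall>y>0. (LINT x:{0..1}|lborel. f (Complex x y)) = 0)"

text \<open>The modified Bessel function of the second kind, for \<open>y > 0\<close>.\<close>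

definition bessel_K :: "complex \<Rightarrow> real \<Rightarrow> complex" where
  "bessel_K \<nu> y = 1 / 2 *
     (LINT u:{0<..}|lborel. of_real (exp (- y / 2 * (u + 1 / u))) * of_real u powr \<nu> / of_real u)"

definition has_fourier_expansion ::
  "(complex \<Rightarrow> complex) \<Rightarrow> real \<Rightarrow> (int \<Rightarrow> complex) \<Rightarrow> bool" where
  "has_fourier_expansion f r c \<longleftrightarrow>
     (\<forall>z\<in>upper_half_plane.
        ((\<lambda>m. c m * of_real (sqrt (Im z)) * bessel_K (\<i> * of_real r) (2 * pi * \<bar>of_int m\<bar> * Im z)
              * exp (2 * of_real pi * \<i> * of_int m * of_real (Re z)))
          has_sum f z) (- {0}))"


section \<open>The Mellin-Barnes integrals\<close>

definition calF :: "real \<Rightarrow> real \<Rightarrow> complex \<Rightarrow> complex" where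
  "calF b a s =
     (LINT t:{0<..<1}|lborel. of_real (cos (b * ln t)) * of_real t powr (s / 2 - 1)
        * of_real (a * t + (1 - t)\<^sup>2 / 2) powr (- s / 2))"

text \<open>\<open>vertical_integral \<sigma> f\<close> is the integral of \<open>f(w) dw\<close> up the line \<open>Re w = \<sigma>\<close>;
  the factor \<open>\<i>\<close> comes from \<open>dw = \<i> dv\<close> for \<open>w = \<sigma> + \<i> v\<close>.\<close>

definition vertical_integral :: "real \<Rightarrow> (complex \<Rightarrow> complex) \<Rightarrow> complex" where
  "vertical_integral \<sigma> f = (LINT v|lborel. f (Complex \<sigma> v) * \<i>)"

definition barnes_kernel :: "int \<Rightarrow> complex \<Rightarrow> complex \<Rightarrow> complex" where
  "barnes_kernel h s w =
     Gamma (s / 2 + 1 / 2 + w) * Gamma (s / 2 + w) * Gamma (- w)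
       / (2 powr (- w) * of_int h powr (2 * w) * Gamma (s + 1 / 2 + w))"

text \<open>In the next two definitions \<open>a n\<close> stands for the product of the coefficients at \<open>n\<close> and \<open>n + h\<close>:
  \<open>c n * c (n + h)\<close> for real coefficients, and \<open>c n * cnj (c (n + h))\<close> in general, which is what the
  expansion of \<open>\<phi> * cnj \<phi>\<close> produces.\<close>

definition calG :: "real \<Rightarrow> real \<Rightarrow> int \<Rightarrow> (int \<Rightarrow> complex) \<Rightarrow> complex \<Rightarrow> complex" where
  "calG \<epsilon> r h a s = 1 / (2 * of_real pi * \<i>) *
     vertical_integral (- 1 / 2 - \<epsilon>) (\<lambda>w. barnes_kernel h s w * calF r 2 (- 2 * w) *
       (\<Sum>\<^sub>\<infinity>n\<in>{n. n < - h \<or> n > 0}. a n * of_int \<bar>n * (n + h)\<bar> powr w))"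

definition calT :: "real \<Rightarrow> real \<Rightarrow> int \<Rightarrow> (int \<Rightarrow> complex) \<Rightarrow> complex \<Rightarrow> complex" where
  "calT \<epsilon> r h a s = 1 / (2 * of_real pi * \<i>) *
     vertical_integral (- 1 / 2 + \<epsilon>) (\<lambda>w. barnes_kernel h s w * calF r 0 (- 2 * w) *
       (\<Sum>n\<in>{n. - h < n \<and> n < 0}. a n * of_int \<bar>n * (n + h)\<bar> powr w))"

end

theory Submission
  imports Defs "HOL-Probability.Probability"
begin

text \<open>
  Unfolding turns the Petersson product into an integral over the strip, and Parseval in \<open>x\<close> turns
  that into a sum over \<open>n\<close> of \<open>c n * cnj (c (n + h))\<close> times the integral of
  \<open>y powr (s - 1) * exp (- 2 \<pi> h y) * K (2 \<pi> \<bar>n\<bar> y) * K (2 \<pi> \<bar>n + h\<bar> y)\<close>.  With \<open>p = \<bar>n\<bar>\<close>, \<open>q = \<bar>n + h\<bar>\<close> the product of the Bessel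
  functions is an integral over \<open>\<tau>\<close> and \<open>v\<close> of the exponential of
  \<open>- exp v - \<pi>\<^sup>2 y\<^sup>2 exp (- v) (p\<^sup>2 + q\<^sup>2 + 2 p q cosh \<tau>)\<close>; since
  \<open>p\<^sup>2 + q\<^sup>2 = h\<^sup>2 \<plusminus> 2 p q\<close>, the part depending on \<open>\<tau>\<close> is \<open>p q (2 cosh \<tau> \<plusminus> 2)\<close>.  Mellin inversion of its
  exponential separates the variables: the \<open>\<tau>\<close>-integral is \<open>calF r 2\<close> or \<open>calF r 0\<close>, and the rest
  is a Beta integral that the duplication formula turns into the Gamma quotient.  All interchanges
  are absolutely convergent, because \<open>\<phi>\<close> is bounded and the sum of \<open>\<bar>c n\<bar>\<^sup>2 * \<bar>n\<bar> powr (- 1 - \<delta>)\<close> is finite for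
  every \<open>\<delta> > 0\<close>.
\<close>

text \<open>Two opposite constraints force the two contours. For n(n+h) > 0 the sum over n is
  infinite, and the mean-square bound on the coefficients controls it when Re w < -1/2. For n(n+h) <
  0 the sum is finite, but \<open>coshk 0 \<tau>\<close> is (2 sinh(\<tau>/2))^2, and its double
  zero at \<tau> = 0 demands Re w > -1/2. Inverting the exponential requires Re w < 0, whence
  \<epsilon> < 1/2 on the right-hand line. The Beta integral has parameters s and s + 2w, so on the
  left-hand line it converges exactly when Re s > 1 + 2\<epsilon>. The kernel is common to both
  cases because the part of the exponent free of \<tau> involves h alone. Boundedness of \<phi> is a
  bootstrap: convergence of the expansion at one height gives an exponential bound on c, good enough
  to bound \<phi> above height 4/5; invariance carries this to the whole half plane, and Parseval on
  horizontal lines then yields the mean-square bound. Half-line integrals are moved to the real line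
  by u = e^x, so that dilations and inversions become translations and reflections.\<close>

section \<open>Integration and Fourier inversion\<close>

text \<open>A sum over a countable set is an integral against counting measure, which is
  sigma-finite there, so Tonelli and Fubini apply. All later exchanges of a series with an integral
  go through this form.\<close>

lemma integral_infsum:
  fixes f :: "'a \<Rightarrow> 'b \<Rightarrow> complex"
  assumes A: "countable A" and M: "sigma_finite_measure M"
    and f: "\<And>a. a \<in> A \<Longrightarrow> f a \<in> borel_measurable M"
    and fin: "(\<integral>\<^sup>+x. (\<integral>\<^sup>+a. ennreal (norm (f a x)) \<partial>count_space A) \<partial>M) < \<infinity>"
  shows "integrable M (\<lambda>x. \<Sum>\<^sub>\<infinity>a\<in>A. f a x)"
    and "AE x in M. (\<lambda>a. f a x) summable_on A"
    and "(\<lambda>a. LINT x|M. f a x) summable_on A"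
    and "(LINT x|M. (\<Sum>\<^sub>\<infinity>a\<in>A. f a x)) = (\<Sum>\<^sub>\<infinity>a\<in>A. LINT x|M. f a x)"
proof -
  interpret M: sigma_finite_measure M by fact
  interpret C: sigma_finite_measure "count_space A"
    by (simp add: A sigma_finite_measure_count_space_countable)
  interpret P: pair_sigma_finite "count_space A" M ..
  have meas: "(\<lambda>(a, x). f a x) \<in> borel_measurable (count_space A \<Otimes>\<^sub>M M)"
    by (intro measurable_pair_measure_countable1 A) (simp add: f)
  have meas': "(\<lambda>p. ennreal (norm ((\<lambda>(a, x). f a x) p))) \<in> borel_measurable (count_space A \<Otimes>\<^sub>M M)"
    using meas by measurable
  have int: "integrable (count_space A \<Otimes>\<^sub>M M) (\<lambda>(a, x). f a x)"
  proof (rule integrableI_bounded[OF meas])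
    have "(\<integral>\<^sup>+p. ennreal (norm ((\<lambda>(a, x). f a x) p)) \<partial>(count_space A \<Otimes>\<^sub>M M)) =
      (\<integral>\<^sup>+x. (\<integral>\<^sup>+a. ennreal (norm (f a x)) \<partial>count_space A) \<partial>M)"
      using P.nn_integral_snd[OF meas'] by simp
    then show "(\<integral>\<^sup>+p. ennreal (norm ((\<lambda>(a, x). f a x) p)) \<partial>(count_space A \<Otimes>\<^sub>M M)) < \<infinity>"
      using fin by simp
  qed
  have eq: "integral\<^sup>L (count_space A) g = infsum g A" "g summable_on A"
    if "integrable (count_space A) g" for g :: "'a \<Rightarrow> complex"
    using infsetsum_infsum[of g A] that abs_summable_equivalent[of g A]
    by (auto simp: Infinite_Set_Sum.abs_summable_on_def infsetsum_def abs_summable_summable)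
  have ae: "AE x in M. integrable (count_space A) (\<lambda>a. f a x)"
    using P.AE_integrable_snd[OF int] .
  show ae': "AE x in M. (\<lambda>a. f a x) summable_on A"
    using ae by eventually_elim (rule eq(2))
  have meas2: "(\<lambda>x. \<integral>a. f a x \<partial>count_space A) \<in> borel_measurable M"
    by (rule borel_measurable_integrable[OF P.integrable_snd[OF int]])
  \<comment> \<open>Where the family is not absolutely summable both sides take the default value 0,
    so the identity holds at every x and not only almost everywhere.\<close>
  have eq_int: "(\<integral>a. f a x \<partial>count_space A) = (\<Sum>\<^sub>\<infinity>a\<in>A. f a x)" for x
  proof (cases "integrable (count_space A) (\<lambda>a. f a x)")
    case True
    then show ?thesis by (rule eq)
  next
    case False
    then have "\<not> (\<lambda>a. f a x) summable_on A"
      using abs_summable_equivalent[of "\<lambda>a. f a x" A]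
        summable_on_iff_abs_summable_on_complex[of "\<lambda>a. f a x" A]
      by (simp add: Infinite_Set_Sum.abs_summable_on_def)
    then show ?thesis
      using False by (simp add: not_integrable_integral_eq infsum_not_exists)
  qed
  show "integrable M (\<lambda>x. \<Sum>\<^sub>\<infinity>a\<in>A. f a x)"
    using P.integrable_snd[OF int] by (simp add: eq_int)
  have i1: "integrable (count_space A) (\<lambda>a. LINT x|M. f a x)"
    using P.integrable_fst[OF int] .
  show "(\<lambda>a. LINT x|M. f a x) summable_on A"
    using eq(2)[OF i1] .
  show "(LINT x|M. (\<Sum>\<^sub>\<infinity>a\<in>A. f a x)) = (\<Sum>\<^sub>\<infinity>a\<in>A. LINT x|M. f a x)"
    using P.Fubini_integral[OF int] eq(1)[OF i1] by (simp add: eq_int)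
qed

text \<open>Formulated for measures, the substitution u = e^x serves integrability, Bochner
  integrals and nonnegative integrals alike. It is known on the compact intervals [e^-n, e^n], and
  monotone convergence exhausts the half-line.\<close>

lemma density_exp_distr:
  "density lborel (indicator {0<..}) = distr (density lborel (\<lambda>x. ennreal (exp x))) borel (exp :: real \<Rightarrow> real)"
proof (rule measure_eqI)
  fix A :: "real set" assume "A \<in> sets (density lborel (indicator {0<..}))"
  then have [measurable]: "A \<in> sets borel" by simp
  let ?I = "\<lambda>n. indicator {- real n..real n} :: real \<Rightarrow> ennreal"
  let ?J = "\<lambda>n. indicator {exp (- real n)..exp (real n)} :: real \<Rightarrow> ennreal"
  have inc: "incseq (\<lambda>n u. indicator A u * ?J n u)"
  proof (intro incseq_SucI le_funI)
    fix n and u :: real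
    have "exp (real n) \<le> exp (real (Suc n))" "exp (- real (Suc n)) \<le> exp (- real n)" by simp_all
    then have "u \<in> {exp (- real (Suc n))..exp (real (Suc n))}" if "u \<in> {exp (- real n)..exp (real n)}"
      using that unfolding atLeastAtMost_iff by linarith
    then have "?J n u \<le> ?J (Suc n) u"
      unfolding indicator_def by simp
    then show "indicator A u * ?J n u \<le> indicator A u * ?J (Suc n) u"
      by (rule mult_left_mono) simp
  qed
  have inc': "incseq (\<lambda>n x. indicator A (exp x) * ennreal (exp x) * ?I n x)"
    by (intro incseq_SucI le_funI) (auto simp: indicator_def)
  have step: "(\<integral>\<^sup>+u. indicator A u * ?J n u \<partial>lborel) =
      (\<integral>\<^sup>+x. indicator A (exp x) * ennreal (exp x) * ?I n x \<partial>lborel)" for n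
  proof -
    have "(\<integral>\<^sup>+u. ennreal (indicator A u * indicator {exp (- real n)..exp (real n)} u) \<partial>lborel) =
      (\<integral>\<^sup>+x. ennreal (indicator A (exp x) * exp x * indicator {- real n..real n} x) \<partial>lborel)"
      by (rule nn_integral_substitution)
         (auto intro!: derivative_eq_intros continuous_intros simp: set_borel_measurable_def)
    moreover have "ennreal (indicator A u * indicator {exp (- real n)..exp (real n)} u) = indicator A u * ?J n u" for u
      by (auto simp: indicator_def)
    moreover have "ennreal (indicator A (exp x) * exp x * indicator {- real n..real n} x) =
       indicator A (exp x) * ennreal (exp x) * ?I n x" for x
      by (auto simp: indicator_def)
    ultimately show ?thesis by simp
  qed
  have sup1: "(SUP n. indicator A u * ?J n u) = indicator A u * indicator {0<..} u" for u :: real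
  proof (cases "u > 0")
    case True
    obtain n where n: "\<bar>ln u\<bar> \<le> real n" using real_arch_simple by blast
    then have "exp (- real n) \<le> exp (ln u)" "exp (ln u) \<le> exp (real n)" by (auto simp: abs_le_iff simp del: exp_ln)
    then have "?J n u = 1" using True by (auto simp: indicator_def)
    then show ?thesis using True
      by (intro antisym SUP_least SUP_upper2[of n]) (auto simp: indicator_def)
  next
    case False
    then have "u < exp x" for x using exp_gt_zero[of x] by linarith
    then have "?J n u = 0" for n by (auto simp: indicator_def not_le)
    then show ?thesis using False by simp
  qed
  have sup2: "(SUP n. indicator A (exp x) * ennreal (exp x) * ?I n x) = indicator A (exp x) * ennreal (exp x)" for x :: real
  proof -
    obtain n where n: "\<bar>x\<bar> \<le> real n" using real_arch_simple by blast
    then have "?I n x = 1" by (auto simp: indicator_def)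
    then show ?thesis
      by (intro antisym SUP_least SUP_upper2[of n]) (auto simp: indicator_def)
  qed
  have "emeasure (density lborel (indicator {0<..})) A = (\<integral>\<^sup>+u. indicator A u * indicator {0<..} u \<partial>lborel)"
    by (simp add: emeasure_density mult.commute)
  also have "\<dots> = (SUP n. \<integral>\<^sup>+u. indicator A u * ?J n u \<partial>lborel)"
    unfolding sup1[symmetric] by (intro nn_integral_monotone_convergence_SUP inc) auto
  also have "\<dots> = (SUP n. \<integral>\<^sup>+x. indicator A (exp x) * ennreal (exp x) * ?I n x \<partial>lborel)"
    by (simp only: step)
  also have "\<dots> = (\<integral>\<^sup>+x. indicator A (exp x) * ennreal (exp x) \<partial>lborel)"
    by (subst nn_integral_monotone_convergence_SUP[OF inc', symmetric]) (simp_all only: sup2, measurable)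
  also have "\<dots> = emeasure (distr (density lborel (\<lambda>x. ennreal (exp x))) borel (exp :: real \<Rightarrow> real)) A"
  proof -
    have [measurable]: "exp -` A \<in> sets borel"
      using measurable_sets[of "exp :: real \<Rightarrow> real" borel borel A] by simp
    have "emeasure (distr (density lborel (\<lambda>x. ennreal (exp x))) borel (exp :: real \<Rightarrow> real)) A =
        (\<integral>\<^sup>+x. ennreal (exp x) * indicator (exp -` A) x \<partial>lborel)"
      by (simp add: emeasure_distr emeasure_density)
    also have "\<dots> = (\<integral>\<^sup>+x. indicator A (exp x) * ennreal (exp x) \<partial>lborel)"
      by (intro nn_integral_cong) (auto simp: indicator_def)
    finally show ?thesis ..
  qed
  finally show "emeasure (density lborel (indicator {0<..})) A =
    emeasure (distr (density lborel (\<lambda>x. ennreal (exp x))) borel (exp :: real \<Rightarrow> real)) A" .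
qed simp

lemma
  fixes f :: "real \<Rightarrow> 'a :: {banach, second_countable_topology}"
  assumes [measurable]: "f \<in> borel_measurable borel"
  shows set_integrable_exp_substitution:
      "set_integrable lborel {0<..} f \<longleftrightarrow> integrable lborel (\<lambda>x. exp x *\<^sub>R f (exp x))"
    and set_integral_exp_substitution:
      "(LINT u:{0<..}|lborel. f u) = (LINT x|lborel. exp x *\<^sub>R f (exp x))"
proof -
  have ind: "(indicator {0<..} :: real \<Rightarrow> ennreal) = (\<lambda>u. ennreal (indicator {0<..} u))"
    by (auto simp: indicator_def)
  have "set_integrable lborel {0<..} f \<longleftrightarrow> integrable (density lborel (indicator {0<..})) f"
    unfolding set_integrable_def ind by (subst integrable_density) auto
  also have "\<dots> \<longleftrightarrow> integrable lborel (\<lambda>x. exp x *\<^sub>R f (exp x))"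
    by (simp add: density_exp_distr integrable_distr_eq integrable_density)
  finally show "set_integrable lborel {0<..} f \<longleftrightarrow> integrable lborel (\<lambda>x. exp x *\<^sub>R f (exp x))" .
  have "(LINT u:{0<..}|lborel. f u) = integral\<^sup>L (density lborel (indicator {0<..})) f"
    unfolding set_lebesgue_integral_def ind by (subst integral_density) auto
  also have "\<dots> = (LINT x|lborel. exp x *\<^sub>R f (exp x))"
    by (simp add: density_exp_distr integral_distr integral_density)
  finally show "(LINT u:{0<..}|lborel. f u) = (LINT x|lborel. exp x *\<^sub>R f (exp x))" .
qed

lemma nn_integral_exp_substitution:
  assumes [measurable]: "f \<in> borel_measurable borel"
  shows "(\<integral>\<^sup>+u\<in>{0<..}. f u \<partial>lborel) = (\<integral>\<^sup>+x. ennreal (exp x) * f (exp x) \<partial>lborel)"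
proof -
  have "(\<integral>\<^sup>+u\<in>{0<..}. f u \<partial>lborel) = (\<integral>\<^sup>+u. f u \<partial>density lborel (indicator {0<..}))"
    by (subst nn_integral_density) (auto simp: mult.commute)
  also have "\<dots> = (\<integral>\<^sup>+x. ennreal (exp x) * f (exp x) \<partial>lborel)"
    by (simp add: density_exp_distr nn_integral_distr nn_integral_density)
  finally show ?thesis .
qed

section \<open>Lebesgue measure on the complex plane as a product\<close>

lemma measurable_Complex [measurable]:
  "(\<lambda>p. Complex (fst p) (snd p)) \<in> borel_measurable (borel \<Otimes>\<^sub>M borel)"
  unfolding borel_prod complex_eq
  by (intro borel_measurable_continuous_onI continuous_intros)

lemma lborel_complex_distr:
  "(lborel :: complex measure) = distr (lborel \<Otimes>\<^sub>M lborel) borel (\<lambda>p. Complex (fst p) (snd p))"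
proof (rule lborel_eqI)
  fix l u :: complex
  assume le: "\<And>b. b \<in> Basis \<Longrightarrow> l \<bullet> b \<le> u \<bullet> b"
  have [measurable]: "(\<lambda>p. Complex (fst p) (snd p)) \<in> measurable (lborel \<Otimes>\<^sub>M lborel) borel"
    by simp
  have "emeasure (distr (lborel \<Otimes>\<^sub>M lborel) borel (\<lambda>p. Complex (fst p) (snd p))) (box l u) =
    emeasure (lborel \<Otimes>\<^sub>M lborel) ({Re l<..<Re u} \<times> {Im l<..<Im u})"
    by (subst emeasure_distr)
       (auto intro!: arg_cong[where f="emeasure (lborel \<Otimes>\<^sub>M lborel)"] simp: in_box_complex_iff space_pair_measure)
  also have "\<dots> = emeasure lborel {Re l<..<Re u} * emeasure lborel {Im l<..<Im u}"
    by (intro lborel.emeasure_pair_measure_Times) auto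
  also have "\<dots> = ennreal (\<Prod>b\<in>Basis. (u - l) \<bullet> b)"
    using le[of 1] le[of \<i>] by (simp add: Basis_complex_def inner_complex_def ennreal_mult)
  finally show "emeasure (distr (lborel \<Otimes>\<^sub>M lborel) borel (\<lambda>p. Complex (fst p) (snd p))) (box l u) =
     ennreal (\<Prod>b\<in>Basis. (u - l) \<bullet> b)" .
qed simp

text \<open>With t = u / a this is the characteristic function of the standard normal
  distribution.\<close>

lemma integral_iexp_gaussian:
  fixes a x :: real
  assumes "a > 0"
  shows "(LINT t|lborel. iexp (t * x) * of_real (exp (- (a * t)\<^sup>2 / 2))) =
         of_real (sqrt (2 * pi) / a * exp (- (x / a)\<^sup>2 / 2))"
proof -
  have "(LINT t|lborel. iexp (t * x) * of_real (exp (- (a * t)\<^sup>2 / 2))) =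
    (1 / a) *\<^sub>R (LINT t|lborel. iexp (t * (x / a)) * of_real (exp (- t\<^sup>2 / 2)))"
    using assms by (subst lborel_integral_real_affine[of "1 / a" _ 0]) (auto simp: field_simps)
  also have "(LINT t|lborel. iexp (t * (x / a)) * of_real (exp (- t\<^sup>2 / 2))) =
    sqrt (2 * pi) * char std_normal_distribution (x / a)"
  proof -
    have "char std_normal_distribution (x / a) =
        (LINT t|lborel. std_normal_density t *\<^sub>R iexp (t * (x / a)))"
      unfolding char_def by (subst integral_density) (auto simp: mult.commute)
    then have "sqrt (2 * pi) * char std_normal_distribution (x / a) =
        (LINT t|lborel. of_real (sqrt (2 * pi)) * (std_normal_density t *\<^sub>R iexp (t * (x / a))))"
      by (simp only: integral_mult_right_zero)
    also have "\<dots> = (LINT t|lborel. iexp (t * (x / a)) * of_real (exp (- t\<^sup>2 / 2)))"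
      by (intro Bochner_Integration.integral_cong refl)
         (simp add: std_normal_density_def scaleR_conv_of_real)
    finally show ?thesis by simp
  qed
  finally show ?thesis
    by (simp add: char_std_normal_distribution scaleR_conv_of_real)
qed

text \<open>The damped integral \<open>?L n\<close> is evaluated in two ways. Domination by |G|
  sends it to the undamped integral; Fubini turns it into an average of g around x with Gaussian
  weight, which tends to g x by continuity at x, with the bound B as dominating factor.\<close>

lemma fourier_inversion:
  fixes g :: "real \<Rightarrow> complex"
  defines "G \<equiv> \<lambda>t. LINT l|lborel. g l * iexp (- (t * l))"
  assumes g: "integrable lborel g" and cont: "isCont g x" and bdd: "\<And>l. norm (g l) \<le> B"
    and G: "integrable lborel G"
  shows "(LINT t|lborel. G t * iexp (t * x)) = 2 * pi * g x"
proof -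
  text \<open>Gaussian summation with width \<open>\<delta> n\<close>.\<close>
  define \<delta> where "\<delta> n = 1 / real (Suc n)" for n
  have \<delta>: "\<delta> n > 0" for n by (simp add: \<delta>_def)
  have \<delta>0: "\<delta> \<longlonglongrightarrow> 0"
    unfolding \<delta>_def using LIMSEQ_inverse_real_of_nat by (simp add: inverse_eq_divide)
  have [measurable]: "g \<in> borel_measurable borel" "G \<in> borel_measurable borel"
    using g G by (auto dest: borel_measurable_integrable)
  let ?L = "\<lambda>n. LINT t|lborel. G t * iexp (t * x) * of_real (exp (- (\<delta> n * t)\<^sup>2 / 2))"
  have lim1: "?L \<longlonglongrightarrow> (LINT t|lborel. G t * iexp (t * x))"
  proof (rule integral_dominated_convergence[where w="\<lambda>t. norm (G t)"])
    show "AE t in lborel. (\<lambda>n. G t * iexp (t * x) * of_real (exp (- (\<delta> n * t)\<^sup>2 / 2))) \<longlonglongrightarrow> G t * iexp (t * x)"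
    proof (rule AE_I2)
      fix t
      have "(\<lambda>n. G t * iexp (t * x) * of_real (exp (- (\<delta> n * t)\<^sup>2 / 2))) \<longlonglongrightarrow>
            G t * iexp (t * x) * of_real (exp (- (0 * t)\<^sup>2 / 2))"
        by (intro tendsto_intros \<delta>0) auto
      then show "(\<lambda>n. G t * iexp (t * x) * of_real (exp (- (\<delta> n * t)\<^sup>2 / 2))) \<longlonglongrightarrow> G t * iexp (t * x)"
        by simp
    qed
    show "AE t in lborel. norm (G t * iexp (t * x) * of_real (exp (- (\<delta> n * t)\<^sup>2 / 2))) \<le> norm (G t)" for n
      by (rule AE_I2) (auto simp: norm_mult intro!: mult_left_le)
  qed (use G in auto)
  \<comment> \<open>The damping factor is integrable in t and g in l, so the order may be reversed;
    the t-integral is then Gaussian, and l = x + \<delta> n * v makes its width independent of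
    n.\<close>
  have L: "?L n = (LINT v|lborel. g (x + \<delta> n * v) * of_real (sqrt (2 * pi) * exp (- v\<^sup>2 / 2)))" for n
  proof -
    let ?k = "\<lambda>t. of_real (exp (- (\<delta> n * t)\<^sup>2 / 2)) :: complex"
    have kr: "integrable lborel (\<lambda>t. exp (- (\<delta> n * t)\<^sup>2 / 2))"
    proof -
      have "integrable lborel (\<lambda>t. sqrt (2 * pi / (\<delta> n)\<^sup>2) * normal_density 0 (1 / \<delta> n) t)"
        using \<delta>[of n] by (intro integrable_mult_right integrable_normal_density) auto
      also have "(\<lambda>t. sqrt (2 * pi / (\<delta> n)\<^sup>2) * normal_density 0 (1 / \<delta> n) t) = (\<lambda>t. exp (- (\<delta> n * t)\<^sup>2 / 2))"
        using \<delta>[of n] by (auto simp: normal_density_def fun_eq_iff power_mult_distrib power_divide field_simps)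
      finally show ?thesis .
    qed
    then have k: "integrable lborel ?k" by (rule integrable_of_real)
    have "integrable (lborel \<Otimes>\<^sub>M lborel) (\<lambda>(t, l). ?k t * g l)"
      using kr
      by (intro lborel_pair.Fubini_integrable)
         (auto simp: norm_mult g k integrable_norm intro!: integrable_mult_left)
    then have int: "integrable (lborel \<Otimes>\<^sub>M lborel) (\<lambda>(t, l). g l * iexp (- (t * l)) * iexp (t * x) * ?k t)"
      by (rule Bochner_Integration.integrable_bound) (auto simp: norm_mult)
    have "?L n = (LINT t|lborel. (LINT l|lborel. g l * iexp (- (t * l)) * iexp (t * x) * ?k t))"
      unfolding G_def by (simp add: mult.assoc integral_mult_left_zero del: mult_minus_right flip: integral_mult_left_zero)
    also have "\<dots> = (LINT l|lborel. (LINT t|lborel. g l * iexp (- (t * l)) * iexp (t * x) * ?k t))"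
      using lborel_pair.Fubini_integral[OF int] by simp
    also have "\<dots> = (LINT l|lborel. g l * of_real (sqrt (2 * pi) / \<delta> n * exp (- ((x - l) / \<delta> n)\<^sup>2 / 2)))"
    proof (rule Bochner_Integration.integral_cong[OF refl])
      fix l
      have "(LINT t|lborel. g l * iexp (- (t * l)) * iexp (t * x) * ?k t) =
        (LINT t|lborel. g l * (iexp (t * (x - l)) * ?k t))"
        by (intro Bochner_Integration.integral_cong refl)
           (simp add: algebra_simps flip: exp_add)
      also have "\<dots> = g l * of_real (sqrt (2 * pi) / \<delta> n * exp (- ((x - l) / \<delta> n)\<^sup>2 / 2))"
        using integral_iexp_gaussian[OF \<delta>[of n], of "x - l"] by (simp only: integral_mult_right_zero)
      finally show "(LINT t|lborel. g l * iexp (- (t * l)) * iexp (t * x) * ?k t) = \<dots>" .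
    qed
    also have "\<dots> = (LINT v|lborel. g (x + \<delta> n * v) * of_real (sqrt (2 * pi) * exp (- v\<^sup>2 / 2)))"
      using \<delta>[of n] by (subst lborel_integral_real_affine[of "\<delta> n" _ x])
        (auto simp: scaleR_conv_of_real power_divide mult.left_commute[of _ "complex_of_real (\<delta> n)"]
              simp del: of_real_mult)
    finally show ?thesis .
  qed
  have "integrable lborel (\<lambda>v. 2 * pi * std_normal_density v)"
    by (intro integrable_mult_right integrable_normal_density) auto
  moreover have "2 * pi * std_normal_density v = sqrt (2 * pi) * exp (- v\<^sup>2 / 2)" for v
    by (simp add: std_normal_density_def field_simps)
  moreover have "(LINT v|lborel. 2 * pi * std_normal_density v) = 2 * pi"
    by (simp add: integral_normal_density)
  ultimately have gauss: "integrable lborel (\<lambda>v. sqrt (2 * pi) * exp (- v\<^sup>2 / 2))"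
      "(LINT v|lborel. sqrt (2 * pi) * exp (- v\<^sup>2 / 2)) = 2 * pi"
    by simp_all
  have "?L \<longlonglongrightarrow> (LINT v|lborel. g x * of_real (sqrt (2 * pi) * exp (- v\<^sup>2 / 2)))"
    unfolding L
  proof (rule integral_dominated_convergence[where w="\<lambda>v. B * (sqrt (2 * pi) * exp (- v\<^sup>2 / 2))"])
    show "AE v in lborel. (\<lambda>n. g (x + \<delta> n * v) * of_real (sqrt (2 * pi) * exp (- v\<^sup>2 / 2)))
        \<longlonglongrightarrow> g x * of_real (sqrt (2 * pi) * exp (- v\<^sup>2 / 2))"
    proof (rule AE_I2)
      fix v
      have "(\<lambda>n. x + \<delta> n * v) \<longlonglongrightarrow> x + 0 * v"
        by (intro tendsto_intros \<delta>0)
      then have "(\<lambda>n. g (x + \<delta> n * v)) \<longlonglongrightarrow> g x"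
        using cont by (intro isCont_tendsto_compose[where g=g]) auto
      then show "(\<lambda>n. g (x + \<delta> n * v) * of_real (sqrt (2 * pi) * exp (- v\<^sup>2 / 2)))
        \<longlonglongrightarrow> g x * of_real (sqrt (2 * pi) * exp (- v\<^sup>2 / 2))"
        by (intro tendsto_intros)
    qed
    show "AE v in lborel. norm (g (x + \<delta> n * v) * of_real (sqrt (2 * pi) * exp (- v\<^sup>2 / 2)))
        \<le> B * (sqrt (2 * pi) * exp (- v\<^sup>2 / 2))" for n
      by (rule AE_I2) (auto simp: norm_mult abs_mult intro!: mult_right_mono bdd)
  qed (use gauss in auto)
  also have "(LINT v|lborel. g x * of_real (sqrt (2 * pi) * exp (- v\<^sup>2 / 2))) = 2 * pi * g x"
    by (subst integral_mult_right_zero, subst integral_complex_of_real, subst gauss(2)) simp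
  finally show ?thesis
    using lim1 LIMSEQ_unique by blast
qed

section \<open>The Gamma function\<close>

lemma not_nonpos_Int_Re: "Re z > 0 \<Longrightarrow> z \<notin> \<int>\<^sub>\<le>\<^sub>0"
  by (auto elim!: nonpos_Ints_cases)

text \<open>Euler's integral with t = e^l. Complex powers become exponentials without a branch, and
  scaling t becomes shifting l, which gives the scaled versions below.\<close>

lemma
  fixes z :: complex
  assumes z: "Re z > 0"
  shows integrable_Gamma_exp: "integrable lborel (\<lambda>l. exp (z * of_real l - of_real (exp l)))"
    and integral_Gamma_exp: "(LINT l|lborel. exp (z * of_real l - of_real (exp l))) = Gamma z"
proof -
  let ?f = "\<lambda>t. of_real t powr (z - 1) / of_real (exp t)"
  let ?g = "\<lambda>t. exp ((z - 1) * of_real (ln t) - of_real t)"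
  have [measurable]: "?g \<in> borel_measurable borel" by measurable
  have fg: "?f t = ?g t" if "t \<in> {0<..}" for t
    using that by (auto simp: powr_def exp_diff exp_of_real Ln_of_real)
  have "set_integrable lebesgue {0<..} ?f"
    using absolutely_integrable_Gamma_integral'[OF z] .
  also have "?this \<longleftrightarrow> set_integrable lebesgue {0<..} ?g"
    by (intro set_integrable_cong refl fg)
  finally have ig: "set_integrable lebesgue {0<..} ?g" .
  \<comment> \<open>Euler's integral is available for the completed measure; the integrand is Borel,
    so integrability and value pass to \<open>lborel\<close>.\<close>
  have meas: "(\<lambda>x. indicat_real {0<..} x *\<^sub>R ?g x) \<in> borel_measurable lborel"
    by measurable
  have ig': "set_integrable lborel {0<..} ?g"
    using ig integrable_completion[OF meas] unfolding set_integrable_def by simp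
  have "(LINT t:{0<..}|lborel. ?g t) = (LINT t:{0<..}|lebesgue. ?g t)"
    unfolding set_lebesgue_integral_def using integral_completion[OF meas] by simp
  also have "\<dots> = integral {0<..} ?g"
    using set_lebesgue_integral_eq_integral(2)[OF ig] .
  also have "\<dots> = integral {0<..} ?f"
    using fg by (intro Henstock_Kurzweil_Integration.integral_cong) auto
  also have "\<dots> = Gamma z"
    using Gamma_integral_complex'[OF z] by (rule integral_unique)
  finally have val: "(LINT t:{0<..}|lborel. ?g t) = Gamma z" .
  have eq: "exp l *\<^sub>R ?g (exp l) = exp (z * of_real l - of_real (exp l))" for l
    unfolding scaleR_conv_of_real exp_of_real[symmetric] exp_add[symmetric]
    by (simp add: algebra_simps)
  show "integrable lborel (\<lambda>l. exp (z * of_real l - of_real (exp l)))"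
    using ig' set_integrable_exp_substitution[of ?g] by (simp only: eq) simp
  show "(LINT l|lborel. exp (z * of_real l - of_real (exp l))) = Gamma z"
    using val set_integral_exp_substitution[of ?g] by (simp only: eq) simp
qed

lemma
  fixes z :: complex and c :: real
  assumes z: "Re z > 0" and c: "c > 0"
  shows integrable_Gamma_exp_scaled: "integrable lborel (\<lambda>l. exp (z * of_real l - of_real (c * exp l)))"
    and integral_Gamma_exp_scaled:
      "(LINT l|lborel. exp (z * of_real l - of_real (c * exp l))) = Gamma z * exp (- z * of_real (ln c))"
proof -
  have eq: "exp (z * of_real (ln c + 1 * l) - of_real (exp (ln c + 1 * l))) * exp (- z * of_real (ln c)) =
     exp (z * of_real l - of_real (c * exp l))" for l
    using c unfolding exp_add[symmetric] by (simp add: algebra_simps exp_add)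
  show "integrable lborel (\<lambda>l. exp (z * of_real l - of_real (c * exp l)))"
    using integrable_mult_left[OF lborel_integrable_real_affine[OF integrable_Gamma_exp[OF z], of 1 "ln c"],
        of "exp (- z * of_real (ln c))"]
    by (simp only: eq)
  have "(LINT l|lborel. exp (z * of_real l - of_real (c * exp l))) =
     (LINT l|lborel. exp (z * of_real (ln c + 1 * l) - of_real (exp (ln c + 1 * l)))) * exp (- z * of_real (ln c))"
    by (simp only: eq flip: integral_mult_left_zero)
  also have "\<dots> = Gamma z * exp (- z * of_real (ln c))"
    using lborel_integral_real_affine[of 1 "\<lambda>l. exp (z * of_real l - of_real (exp l))" "ln c"]
    by (simp add: integral_Gamma_exp[OF z])
  finally show "(LINT l|lborel. exp (z * of_real l - of_real (c * exp l))) = Gamma z * exp (- z * of_real (ln c))" .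
qed

lemma
  fixes x c :: real
  assumes x: "x > 0" and c: "c > 0"
  shows integrable_Gamma_exp_scaled_real: "integrable lborel (\<lambda>l. exp (x * l - c * exp l))"
    and integral_Gamma_exp_scaled_real: "(LINT l|lborel. exp (x * l - c * exp l)) = Gamma x * exp (- x * ln c)"
proof -
  have eq: "exp (of_real x * of_real l - of_real (c * exp l)) = complex_of_real (exp (x * l - c * exp l))" for l
    by (simp flip: exp_of_real)
  have eq': "complex_of_real (Gamma x * exp (- x * ln c)) = Gamma (of_real x) * exp (- of_real x * of_real (ln c))"
    by (simp add: Gamma_complex_of_real flip: exp_of_real)
  have re: "Re (of_real x) > 0" using x by simp
  show "integrable lborel (\<lambda>l. exp (x * l - c * exp l))"
    using integrable_Gamma_exp_scaled[OF re c] unfolding eq complex_of_real_integrable_eq .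
  show "(LINT l|lborel. exp (x * l - c * exp l)) = Gamma x * exp (- x * ln c)"
    using integral_Gamma_exp_scaled[OF re c] unfolding eq integral_complex_of_real eq'[symmetric] of_real_eq_iff .
qed

lemma norm_Gamma_le: "norm (Gamma z) \<le> Gamma (Re z)" if "Re z > 0" for z :: complex
proof -
  have "norm (LINT l|lborel. exp (z * of_real l - of_real (exp l))) \<le>
      (LINT l|lborel. norm (exp (z * of_real l - of_real (exp l))))"
    by (rule integral_norm_bound)
  also have "\<dots> = Gamma (Re z)"
    using integral_Gamma_exp_scaled_real[OF that, of 1] by simp
  finally show ?thesis by (simp add: integral_Gamma_exp that)
qed

text \<open>Two steps of the functional equation lead to z + 2, where Gamma is bounded on the
  vertical line, and leave the factor z (z + 1), at least |z|^2 in modulus. The resulting quadratic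
  decay makes Gamma integrable on vertical lines.\<close>

lemma norm_Gamma_decay:
  fixes z :: complex
  assumes "Re z > 0"
  shows "norm (Gamma z) \<le> Gamma (Re z + 2) / ((Re z)\<^sup>2 + (Im z)\<^sup>2)"
proof -
  have nz: "z \<notin> \<int>\<^sub>\<le>\<^sub>0" "z + 1 \<notin> \<int>\<^sub>\<le>\<^sub>0" using assms by (auto intro!: not_nonpos_Int_Re)
  have "Gamma (z + 2) = (z + 1) * (z * Gamma z)"
    using Gamma_plus1[OF nz(2)] Gamma_plus1[OF nz(1)] by (simp add: add.assoc)
  then have "norm (z + 1) * norm z * norm (Gamma z) \<le> Gamma (Re z + 2)"
    using norm_Gamma_le[of "z + 2"] assms by (simp add: norm_mult mult.assoc)
  moreover have "norm z * norm z * norm (Gamma z) \<le> norm (z + 1) * norm z * norm (Gamma z)"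
    using assms by (intro mult_right_mono) (auto simp: cmod_def intro!: real_sqrt_le_mono power_mono)
  moreover have "norm z * norm z = (Re z)\<^sup>2 + (Im z)\<^sup>2"
    by (simp add: cmod_def flip: power2_eq_square)
  moreover have "(Re z)\<^sup>2 + (Im z)\<^sup>2 > 0" using assms by (simp add: add_pos_nonneg)
  ultimately show ?thesis by (simp add: field_simps)
qed

lemma continuous_Gamma_line: "continuous_on UNIV (\<lambda>t. Gamma (a + b * of_real t))"
  if "Re a > 0" "Re b = 0" for a b :: complex
proof -
  have "a + b * of_real t \<notin> \<int>\<^sub>\<le>\<^sub>0" for t
    using that by (intro not_nonpos_Int_Re) simp
  moreover have "continuous_on (- \<int>\<^sub>\<le>\<^sub>0) (Gamma :: complex \<Rightarrow> complex)"
    by (rule continuous_on_Gamma) auto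
  ultimately show ?thesis
    by (intro continuous_on_compose2[of "- \<int>\<^sub>\<le>\<^sub>0" Gamma UNIV] continuous_intros) auto
qed

lemma measurable_Gamma_line [measurable]: "(\<lambda>t. Gamma (a + b * of_real t)) \<in> borel_measurable borel"
  if "Re a > 0" "Re b = 0" for a b :: complex
  using continuous_Gamma_line[OF that] by (rule borel_measurable_continuous_onI)

lemma integrable_Gamma_line:
  assumes "x > 0"
  shows "integrable lborel (\<lambda>t. Gamma (of_real x - \<i> * of_real t))"
proof -
  have meas: "(\<lambda>t. Gamma (of_real x - \<i> * of_real t)) \<in> borel_measurable lborel"
    using measurable_Gamma_line[of "of_real x" "- \<i>"] assms by simp
  \<comment> \<open>The maximum compares 1 / (x^2 + t^2) with 1 / (1 + t^2) whether x is below or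
    above 1.\<close>
  define C where "C = Gamma (x + 2) * max 1 (1 / x\<^sup>2)"
  have G: "Gamma (x + 2) > 0" using assms by (intro Gamma_real_pos) auto
  have "integrable lborel (\<lambda>t. C * inverse (1 + t\<^sup>2))"
    using integrable_inverse_1_plus_square by (intro integrable_mult_right) (simp add: set_integrable_def)
  then show ?thesis
  proof (rule Bochner_Integration.integrable_bound[OF _ meas], intro AE_I2)
    fix t
    have "norm (Gamma (of_real x - \<i> * of_real t)) \<le> Gamma (x + 2) * (1 / (x\<^sup>2 + t\<^sup>2))"
      using norm_Gamma_decay[of "of_real x - \<i> * of_real t"] assms by simp
    also have "1 / (x\<^sup>2 + t\<^sup>2) \<le> max 1 (1 / x\<^sup>2) * inverse (1 + t\<^sup>2)"
    proof -
      have "1 + t\<^sup>2 \<le> max 1 (1 / x\<^sup>2) * x\<^sup>2 + max 1 (1 / x\<^sup>2) * t\<^sup>2"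
      proof (rule add_mono)
        have "1 = (1 / x\<^sup>2) * x\<^sup>2" using assms by simp
        also have "\<dots> \<le> max 1 (1 / x\<^sup>2) * x\<^sup>2" by (intro mult_right_mono) auto
        finally show "1 \<le> max 1 (1 / x\<^sup>2) * x\<^sup>2" .
        have "1 * t\<^sup>2 \<le> max 1 (1 / x\<^sup>2) * t\<^sup>2" by (intro mult_right_mono) auto
        then show "t\<^sup>2 \<le> max 1 (1 / x\<^sup>2) * t\<^sup>2" by simp
      qed
      moreover have "1 + t\<^sup>2 > 0" "x\<^sup>2 + t\<^sup>2 > 0" using assms by (auto simp: add_pos_nonneg)
      ultimately show ?thesis by (simp add: divide_simps algebra_simps)
    qed
    finally show "norm (Gamma (of_real x - \<i> * of_real t)) \<le> norm (C * inverse (1 + t\<^sup>2))"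
      using G by (simp add: C_def mult_left_mono abs_mult mult.assoc)
  qed
qed

text \<open>The function exp(x l - e^l) has Fourier transform Gamma(x - i t), so Fourier inversion
  at L recovers it; the factor exp(- x L) then removes the weight. This is the inverse Mellin
  transform of u -> e^-u on a vertical line, at u = e^L.\<close>

lemma mellin_inversion_exp:
  assumes x: "x > 0"
  shows "(LINT t|lborel. Gamma (of_real x - \<i> * of_real t) * exp ((of_real (- x) + \<i> * of_real t) * of_real L))
         = of_real (2 * pi * exp (- exp L))"
proof -
  let ?g = "\<lambda>l. complex_of_real (exp (x * l - 1 * exp l))"
  have G: "(LINT l|lborel. ?g l * iexp (- (t * l))) = Gamma (of_real x - \<i> * of_real t)" for t
    using integral_Gamma_exp[of "of_real x - \<i> * of_real t"] x
    by (simp add: algebra_simps flip: exp_of_real exp_add)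
  \<comment> \<open>The exponent \<open>x * l - exp l\<close> is largest at l = ln x.\<close>
  have bdd: "norm (?g l) \<le> exp (x * ln x - x)" for l
  proof -
    have "1 + (l - ln x) \<le> exp (l - ln x)" by (rule exp_ge_add_one_self)
    then have "x * (1 + (l - ln x)) \<le> x * exp (l - ln x)" using x by (intro mult_left_mono) auto
    also have "x * exp (l - ln x) = exp l" using x by (simp add: exp_diff)
    finally show ?thesis by (simp add: algebra_simps)
  qed
  have "(LINT t|lborel. (LINT l|lborel. ?g l * iexp (- (t * l))) * iexp (t * L)) = 2 * pi * ?g L"
  proof (rule fourier_inversion[OF _ _ bdd])
    show "integrable lborel ?g"
      using integrable_Gamma_exp_scaled_real[OF x, of 1] by (intro integrable_of_real) simp
    show "isCont ?g L" by (intro continuous_intros)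
    show "integrable lborel (\<lambda>t. LINT l|lborel. ?g l * iexp (- (t * l)))"
      unfolding G by (rule integrable_Gamma_line[OF x])
  qed
  then have "(LINT t|lborel. Gamma (of_real x - \<i> * of_real t) * iexp (t * L)) * exp (- of_real (x * L)) =
      2 * pi * ?g L * exp (- of_real (x * L))"
    unfolding G by simp
  also have "2 * pi * ?g L * exp (- of_real (x * L)) = of_real (2 * pi * exp (- exp L))"
    by (simp add: exp_diff exp_minus field_simps flip: exp_of_real)
  also have "(LINT t|lborel. Gamma (of_real x - \<i> * of_real t) * iexp (t * L)) * exp (- of_real (x * L)) =
      (LINT t|lborel. Gamma (of_real x - \<i> * of_real t) * exp ((of_real (- x) + \<i> * of_real t) * of_real L))"
  proof -
    have "Gamma (of_real x - \<i> * of_real t) * iexp (t * L) * exp (- of_real (x * L)) =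
        Gamma (of_real x - \<i> * of_real t) * exp ((of_real (- x) + \<i> * of_real t) * of_real L)" for t
      unfolding mult.assoc exp_add[symmetric] by (simp add: algebra_simps)
    then show ?thesis
      by (simp only: flip: integral_mult_left_zero)
  qed
  finally show ?thesis .
qed

text \<open>In the product of two Euler integrals the second variable is measured from the first, as
  l + x; integrating over l first leaves Gamma(a + b) times (1 + e^x)^-(a+b). With u = e^x the
  remaining integral is the Beta integral over the half-line.\<close>

lemma
  fixes a b :: complex
  assumes a: "Re a > 0" and b: "Re b > 0"
  shows integrable_Beta_exp: "integrable lborel (\<lambda>x. exp (a * of_real x - (a + b) * of_real (ln (1 + exp x))))"
    and integral_Beta_exp: "Gamma (a + b) * (LINT x|lborel. exp (a * of_real x - (a + b) * of_real (ln (1 + exp x)))) =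
        Gamma a * Gamma b"
proof -
  let ?F = "\<lambda>l x. exp (b * of_real l - of_real (exp l)) * exp (a * of_real (l + 1 * x) - of_real (exp (l + 1 * x)))"
  have inner: "(LINT x|lborel. ?F l x) = exp (b * of_real l - of_real (exp l)) * Gamma a" for l
    using lborel_integral_real_affine[of 1 "\<lambda>x. exp (a * of_real x - of_real (exp x))" l]
    by (simp add: integral_Gamma_exp[OF a])
  have inner_norm: "(LINT x|lborel. norm (?F l x)) = exp (Re b * l - exp l) * Gamma (Re a)" for l
    using lborel_integral_real_affine[of 1 "\<lambda>x. exp (Re a * x - exp x)" l]
      integral_Gamma_exp_scaled_real[OF a, of 1]
    by (simp add: norm_mult)
  have int: "integrable (lborel \<Otimes>\<^sub>M lborel) (\<lambda>(l, x). ?F l x)"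
  proof (rule lborel_pair.Fubini_integrable)
    show "integrable lborel (\<lambda>l. LINT x|lborel. norm (case (l, x) of (l, x) \<Rightarrow> ?F l x))"
      using integrable_Gamma_exp_scaled_real[OF b, of 1] by (simp only: prod.case inner_norm) simp
    show "AE l in lborel. integrable lborel (\<lambda>x. case (l, x) of (l, x) \<Rightarrow> ?F l x)"
      using lborel_integrable_real_affine[OF integrable_Gamma_exp[OF a], of 1] by simp
  qed measurable
  have inner2: "(LINT l|lborel. ?F l x) =
     Gamma (a + b) * exp (a * of_real x - (a + b) * of_real (ln (1 + exp x)))" for x
  proof -
    have "(LINT l|lborel. ?F l x) =
        (LINT l|lborel. exp ((a + b) * of_real l - of_real ((1 + exp x) * exp l)) * exp (a * of_real x))"
      by (intro Bochner_Integration.integral_cong refl) (simp add: algebra_simps exp_add flip: exp_add)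
    also have "\<dots> = Gamma (a + b) * exp (- (a + b) * of_real (ln (1 + exp x))) * exp (a * of_real x)"
      by (subst integral_mult_left_zero, subst integral_Gamma_exp_scaled) (use a b in \<open>auto simp: add_pos_pos\<close>)
    finally show ?thesis by (simp add: mult.assoc algebra_simps flip: exp_add)
  qed
  have "Gamma (a + b) \<noteq> 0"
    using a b not_nonpos_Int_Re[of "a + b"] by (auto simp: Gamma_eq_zero_iff)
  then show "integrable lborel (\<lambda>x. exp (a * of_real x - (a + b) * of_real (ln (1 + exp x))))"
    using integrable_mult_right[OF lborel_pair.integrable_snd[OF int, unfolded inner2], of "inverse (Gamma (a + b))"]
    by (simp flip: mult.assoc)
  show "Gamma (a + b) * (LINT x|lborel. exp (a * of_real x - (a + b) * of_real (ln (1 + exp x)))) =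
        Gamma a * Gamma b"
    using lborel_pair.Fubini_integral[OF int] integral_Gamma_exp[OF b]
    unfolding inner inner2 by (simp add: mult.commute)
qed

section \<open>Domination by product functions and affine changes of variable\<close>

lemma integrable_pair_bound:
  fixes f :: "real \<Rightarrow> real \<Rightarrow> complex"
  assumes [measurable]: "case_prod f \<in> borel_measurable (lborel \<Otimes>\<^sub>M lborel)"
    and le: "\<And>x y. norm (f x y) \<le> p x * q y"
    and p: "integrable lborel p" and q: "integrable lborel q"
  shows "integrable (lborel \<Otimes>\<^sub>M lborel) (case_prod f)"
proof -
  have "integrable (lborel \<Otimes>\<^sub>M lborel) (\<lambda>(x, y). p x * q y)"
    using p q borel_measurable_integrable[OF p] borel_measurable_integrable[OF q]
    by (intro lborel_pair.Fubini_integrable)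
       (auto simp: abs_mult intro!: integrable_mult_left integrable_mult_right)
  then show ?thesis
    by (rule Bochner_Integration.integrable_bound) (auto intro!: AE_I2 order.trans[OF le])
qed

lemma lborel_integral_shift:
  fixes f :: "real \<Rightarrow> 'a :: {banach, second_countable_topology}"
  shows "(LINT x|lborel. f (x + c)) = (LINT x|lborel. f x)"
  using lborel_integral_real_affine[of 1 f c] by (simp add: add.commute)

lemma lborel_integrable_shift:
  fixes f :: "real \<Rightarrow> 'a :: {banach, second_countable_topology}"
  shows "integrable lborel (\<lambda>x. f (x + c)) \<longleftrightarrow> integrable lborel f"
  using lborel_integrable_real_affine_iff[of 1 f c] by (simp add: add.commute)

lemma lborel_integral_uminus:
  fixes f :: "real \<Rightarrow> 'a :: {banach, second_countable_topology}"
  shows "(LINT x|lborel. f (- x)) = (LINT x|lborel. f x)"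
  using lborel_integral_real_affine[of "-1" f 0] by simp

lemma lborel_integrable_uminus:
  fixes f :: "real \<Rightarrow> 'a :: {banach, second_countable_topology}"
  shows "integrable lborel (\<lambda>x. f (- x)) \<longleftrightarrow> integrable lborel f"
  using lborel_integrable_real_affine_iff[of "-1" f 0] by simp

lemma measurable_cosh [measurable (raw)]:
  "f \<in> borel_measurable M \<Longrightarrow> (\<lambda>x. cosh (f x :: real)) \<in> borel_measurable M"
  by (rule measurable_compose[where g=cosh])
     (auto intro!: borel_measurable_continuous_onI continuous_intros)

section \<open>The Bessel function\<close>

text \<open>One half of cosh is already an Euler integrand for large x. At the other end u <= exp u,
  with u = A/2 * exp(-x), supplies the missing factor exp x.\<close>

lemma integrable_exp_cosh:
  fixes A :: real
  assumes "A > 0"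
  shows "integrable lborel (\<lambda>x. exp (- (A * cosh x)))"
proof (rule Bochner_Integration.integrable_bound)
  show "integrable lborel (\<lambda>x. 2 / A * exp (1 * x - A / 2 * exp x))"
    using assms by (intro integrable_mult_right integrable_Gamma_exp_scaled_real) auto
  show "AE x in lborel. norm (exp (- (A * cosh x))) \<le> norm (2 / A * exp (1 * x - A / 2 * exp x))"
  proof (rule AE_I2)
    fix x :: real
    have "exp (- (A * cosh x)) = exp (- (A / 2 * exp (- x))) * exp (- (A / 2 * exp x))"
      by (simp add: cosh_def field_simps flip: exp_add)
    also have "exp (- (A / 2 * exp (- x))) \<le> 2 / A * exp x"
    proof -
      have "A / 2 * exp (- x) \<le> exp (A / 2 * exp (- x))"
        using exp_ge_add_one_self[of "A / 2 * exp (- x)"] by linarith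
      then show ?thesis using assms by (simp add: exp_minus field_simps)
    qed
    also have "2 / A * exp x * exp (- (A / 2 * exp x)) = 2 / A * exp (1 * x - A / 2 * exp x)"
      by (simp flip: exp_add)
    finally show "norm (exp (- (A * cosh x))) \<le> norm (2 / A * exp (1 * x - A / 2 * exp x))"
      using assms by (simp add: mult_right_mono)
  qed
qed measurable

text \<open>Twice the Macdonald function K_ir(A), from u = e^x in \<open>bessel_K\<close>.\<close>

definition macK :: "real \<Rightarrow> real \<Rightarrow> complex" where
  "macK r A = (LINT x|lborel. exp (\<i> * of_real (r * x) - of_real (A * cosh x)))"

lemma integrable_macK: "A > 0 \<Longrightarrow> integrable lborel (\<lambda>x. exp (\<i> * of_real (r * x) - of_real (A * cosh x)))"
  by (rule Bochner_Integration.integrable_bound[OF integrable_exp_cosh[of A]]) (auto intro!: AE_I2)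

lemma bessel_K_eq: "bessel_K (\<i> * of_real r) A = macK r A / 2"
proof -
  let ?f = "\<lambda>u. of_real (exp (- A / 2 * (u + 1 / u))) * of_real u powr (\<i> * of_real r) / complex_of_real u"
  let ?g = "\<lambda>u. of_real (exp (- A / 2 * (u + 1 / u))) * exp (\<i> * of_real r * of_real (ln u)) / complex_of_real u"
  have [measurable]: "?g \<in> borel_measurable borel" by measurable
  have "(LINT u:{0<..}|lborel. ?f u) = (LINT u:{0<..}|lborel. ?g u)"
    by (intro set_lebesgue_integral_cong) (auto simp: powr_def Ln_of_real mult_ac)
  also have "\<dots> = (LINT x|lborel. exp x *\<^sub>R ?g (exp x))"
    by (rule set_integral_exp_substitution) measurable
  also have "\<dots> = macK r A"
    unfolding macK_def
  proof (intro Bochner_Integration.integral_cong refl)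
    fix x :: real
    have "exp x *\<^sub>R ?g (exp x) = exp (of_real (- A / 2 * (exp x + 1 / exp x))) * exp (\<i> * of_real r * of_real x)"
      unfolding exp_of_real[of "- A / 2 * (exp x + 1 / exp x)"]
      by (simp add: scaleR_conv_of_real)
    also have "\<dots> = exp (\<i> * of_real (r * x) - of_real (A * cosh x))"
    proof -
      have "- A / 2 * (exp x + 1 / exp x) = - (A * cosh x)"
        by (simp add: cosh_def exp_minus inverse_eq_divide)
      then show ?thesis
        unfolding exp_add[symmetric] by (simp only:) (simp add: mult.assoc)
    qed
    finally show "exp x *\<^sub>R ?g (exp x) = exp (\<i> * of_real (r * x) - of_real (A * cosh x))" .
  qed
  finally show ?thesis by (simp add: bessel_K_def)
qed

lemma macK_uminus: "macK (- r) A = macK r A"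
  unfolding macK_def
  using lborel_integral_uminus[of "\<lambda>x. exp (\<i> * of_real (r * x) - of_real (A * cosh x))"] by simp

text \<open>Conjugation and the reflection x -> -x both change the sign of r. Hence only the
  coefficient is conjugated in the second factor of the Parseval sum.\<close>

lemma cnj_macK: "cnj (macK r A) = macK r A"
proof -
  have "cnj (exp (\<i> * of_real (r * x) - of_real (A * cosh x))) =
      exp (\<i> * of_real (- r * x) - of_real (A * cosh x))" for x
    by (simp add: exp_cnj)
  then have "cnj (macK r A) = macK (- r) A"
    unfolding macK_def Bochner_Integration.integral_cnj[symmetric] by (simp only:)
  then show ?thesis by (simp add: macK_uminus)
qed

text \<open>The shift c normalises the coefficient of exp v to 1. Shifting leaves the product of the
  coefficients of exp v and exp(-v) unchanged, so the other one becomes (A e^\<tau> + B)(A e^-\<tau>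
  + B) / 4.\<close>

lemma cosh_shift_pair:
  fixes A B \<tau> v :: real
  assumes A: "A > 0" and B: "B > 0"
  defines "c \<equiv> ln (2 / (A * exp \<tau> + B))"
  shows "A * cosh (\<tau> + (v + c)) + B * cosh (v + c) =
    exp v + (A\<^sup>2 + B\<^sup>2 + 2 * A * B * cosh \<tau>) / 4 * exp (- v)"
proof -
  define E where "E = A * exp \<tau> + B"
  have E: "E > 0" using A B by (simp add: E_def add_pos_pos)
  have ec: "exp c = 2 / E" "exp (- c) = E / 2"
    using E by (simp_all add: c_def exp_minus E_def)
  have "A * cosh (\<tau> + (v + c)) + B * cosh (v + c) =
    E / 2 * exp v * exp c + (A * exp (- \<tau>) + B) / 2 * exp (- v) * exp (- c)"
  proof -
    have "cosh (\<tau> + (v + c)) = (exp \<tau> * exp v * exp c + exp (- \<tau>) * exp (- v) * exp (- c)) / 2"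
      "cosh (v + c) = (exp v * exp c + exp (- v) * exp (- c)) / 2"
      by (simp_all add: cosh_def algebra_simps flip: exp_add)
    then show ?thesis by (simp only: E_def) (simp add: algebra_simps add_divide_distrib)
  qed
  also have "\<dots> = exp v + (A * exp (- \<tau>) + B) * E / 4 * exp (- v)"
    using E by (simp add: ec)
  also have "(A * exp (- \<tau>) + B) * E = A\<^sup>2 + B\<^sup>2 + 2 * A * B * cosh \<tau>"
  proof -
    have "exp (- \<tau>) * exp \<tau> = 1" by (simp flip: exp_add)
    then have "A * exp (- \<tau>) * (A * exp \<tau>) = A\<^sup>2" by (simp add: power2_eq_square algebra_simps)
    then show ?thesis by (simp add: E_def cosh_def algebra_simps power2_eq_square)
  qed
  finally show ?thesis .
qed

text \<open>With \<tau> the difference of the two integration variables, the inner integral depends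
  on A and B only through A^2 + B^2 + 2 A B cosh \<tau>, where the relation between p, q and h can
  be inserted.\<close>

lemma macK_mult:
  assumes A: "A > 0" and B: "B > 0"
  shows "macK r A * macK r B = (LINT \<tau>|lborel. exp (\<i> * of_real (r * \<tau>)) *
     (LINT v|lborel. of_real (exp (- exp v - (A\<^sup>2 + B\<^sup>2 + 2 * A * B * cosh \<tau>) / 4 * exp (- v)))))"
proof -
  let ?F = "\<lambda>v \<tau>. exp (\<i> * of_real (- r * v) - of_real (B * cosh v)) *
     exp (\<i> * of_real (r * (\<tau> + v)) - of_real (A * cosh (\<tau> + v)))"
  have inner: "(LINT \<tau>|lborel. ?F v \<tau>) = exp (\<i> * of_real (- r * v) - of_real (B * cosh v)) * macK r A" for v
    using lborel_integral_shift[of "\<lambda>x. exp (\<i> * of_real (r * x) - of_real (A * cosh x))" v]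
    by (simp add: macK_def)
  have inner_norm: "(LINT \<tau>|lborel. norm (?F v \<tau>)) = exp (- (B * cosh v)) * (LINT x|lborel. exp (- (A * cosh x)))" for v
    using lborel_integral_shift[of "\<lambda>x. exp (- (A * cosh x))" v] by (simp add: norm_mult)
  have int: "integrable (lborel \<Otimes>\<^sub>M lborel) (\<lambda>(v, \<tau>). ?F v \<tau>)"
  proof (rule lborel_pair.Fubini_integrable)
    show "integrable lborel (\<lambda>v. LINT \<tau>|lborel. norm (case (v, \<tau>) of (v, \<tau>) \<Rightarrow> ?F v \<tau>))"
      unfolding prod.case inner_norm by (intro integrable_mult_left integrable_exp_cosh B)
    show "AE v in lborel. integrable lborel (\<lambda>\<tau>. case (v, \<tau>) of (v, \<tau>) \<Rightarrow> ?F v \<tau>)"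
      unfolding prod.case using integrable_macK[OF A, of r]
        lborel_integrable_shift[of "\<lambda>x. exp (\<i> * of_real (r * x) - of_real (A * cosh x))"]
      by (intro AE_I2 integrable_mult_right) blast
  qed (unfold cosh_def, measurable)
  \<comment> \<open>Opposite signs of r make the phase depend on \<tau> alone.\<close>
  have "macK r A * macK r B = macK r A * macK (- r) B"
    by (simp add: macK_uminus)
  also have "\<dots> = (LINT v|lborel. (LINT \<tau>|lborel. ?F v \<tau>))"
    unfolding inner by (simp add: macK_def mult.commute)
  also have "\<dots> = (LINT \<tau>|lborel. (LINT v|lborel. ?F v \<tau>))"
    using lborel_pair.Fubini_integral[OF int] by simp
  also have "\<dots> = (LINT \<tau>|lborel. exp (\<i> * of_real (r * \<tau>)) *
     (LINT v|lborel. of_real (exp (- exp v - (A\<^sup>2 + B\<^sup>2 + 2 * A * B * cosh \<tau>) / 4 * exp (- v)))))"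
  proof (intro Bochner_Integration.integral_cong refl)
    fix \<tau>
    let ?c = "ln (2 / (A * exp \<tau> + B))"
    have "?F v \<tau> = exp (\<i> * of_real (r * \<tau>)) * of_real (exp (- (A * cosh (\<tau> + v) + B * cosh v)))" for v
      unfolding exp_of_real[symmetric] exp_add[symmetric] by (simp add: algebra_simps)
    then have "(LINT v|lborel. ?F v \<tau>) =
        exp (\<i> * of_real (r * \<tau>)) * (LINT v|lborel. of_real (exp (- (A * cosh (\<tau> + v) + B * cosh v))))"
      by (simp only: integral_mult_right_zero)
    also have "(LINT v|lborel. of_real (exp (- (A * cosh (\<tau> + v) + B * cosh v)))) =
       (LINT v|lborel. complex_of_real (exp (- (A * cosh (\<tau> + (v + ?c)) + B * cosh (v + ?c)))))"
      using lborel_integral_shift[of "\<lambda>v. complex_of_real (exp (- (A * cosh (\<tau> + v) + B * cosh v)))" ?c] by simp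
    also have "\<dots> = (LINT v|lborel. of_real (exp (- exp v - (A\<^sup>2 + B\<^sup>2 + 2 * A * B * cosh \<tau>) / 4 * exp (- v))))"
      unfolding cosh_shift_pair[OF A B] by simp
    finally show "(LINT v|lborel. ?F v \<tau>) = exp (\<i> * of_real (r * \<tau>)) *
     (LINT v|lborel. of_real (exp (- exp v - (A\<^sup>2 + B\<^sup>2 + 2 * A * B * cosh \<tau>) / 4 * exp (- v))))" .
  qed
  finally show ?thesis .
qed

section \<open>The Mellin-Barnes integral for a product of Bessel functions\<close>

text \<open>What the v-integral becomes once the part of the exponent depending on \<tau> is
  replaced by a power: with y = e^l the weight is (y^2 e^-v)^w. For P > 0 it equals 2 (2 y / P)^w
  K_w(P y), K_w being the Macdonald function.\<close>

definition mellinV :: "real \<Rightarrow> real \<Rightarrow> complex \<Rightarrow> complex" where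
  "mellinV P l w = (LINT v|lborel. exp (w * of_real (2 * l - v) - of_real (exp v + P\<^sup>2 / 4 * exp (2 * l - v))))"

lemma norm_mellinV_integrand_le:
  "norm (exp (w * of_real (2 * l - v) - of_real (exp v + P\<^sup>2 / 4 * exp (2 * l - v)))) \<le>
    exp (2 * l * Re w) * exp (- Re w * v - 1 * exp v)"
  by (simp add: algebra_simps flip: exp_add)

lemma norm_mellinV_le:
  assumes "Re w < 0"
  shows "norm (mellinV P l w) \<le> exp (2 * l * Re w) * Gamma (- Re w)"
proof -
  have i: "integrable lborel (\<lambda>v. exp (2 * l * Re w) * exp (- Re w * v - 1 * exp v))"
    using assms by (intro integrable_mult_right integrable_Gamma_exp_scaled_real) auto
  have *: "integrable lborel (\<lambda>v. exp (w * of_real (2 * l - v) - of_real (exp v + P\<^sup>2 / 4 * exp (2 * l - v))))"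
    by (rule Bochner_Integration.integrable_bound[OF i])
       (use norm_mellinV_integrand_le[of w l _ P] in \<open>auto intro!: AE_I2 intro: order_trans\<close>)
  have "norm (mellinV P l w) \<le> (LINT v|lborel. exp (2 * l * Re w) * exp (- Re w * v - 1 * exp v))"
    unfolding mellinV_def
    by (rule Bochner_Integration.integral_norm_bound_integral[OF * i norm_mellinV_integrand_le])
  then show ?thesis
    using assms integral_Gamma_exp_scaled_real[of "- Re w" 1] by simp
qed

text \<open>Moving v by l + ln(P/2) balances the two exponentials, which then add up to P e^l cosh
  v.\<close>

lemma mellinV_shift:
  assumes "P > 0"
  shows "mellinV P l w = exp (w * of_real (l - ln (P / 2))) *
    (LINT v|lborel. exp (- w * of_real v - of_real (P * exp l * cosh v)))"
proof -
  have "exp (w * of_real (2 * l - (v + (l + ln (P / 2)))) -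
        of_real (exp (v + (l + ln (P / 2))) + P\<^sup>2 / 4 * exp (2 * l - (v + (l + ln (P / 2)))))) =
      exp (w * of_real (l - ln (P / 2))) * exp (- w * of_real v - of_real (P * exp l * cosh v))" for v
  proof -
    have "exp (v + (l + ln (P / 2))) = P / 2 * exp l * exp v"
      using assms by (simp add: exp_add)
    moreover have "P\<^sup>2 / 4 * exp (2 * l - (v + (l + ln (P / 2)))) = P / 2 * exp l * exp (- v)"
    proof -
      have "exp (2 * l - (v + (l + ln (P / 2)))) = exp (l - v) / exp (ln (P / 2))"
        unfolding exp_diff[symmetric] by (simp add: algebra_simps)
      then show ?thesis using assms by (simp add: exp_diff exp_minus power2_eq_square field_simps)
    qed
    ultimately have "exp (v + (l + ln (P / 2))) + P\<^sup>2 / 4 * exp (2 * l - (v + (l + ln (P / 2)))) = P * exp l * cosh v"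
      by (simp add: cosh_def algebra_simps)
    then show ?thesis
      unfolding exp_add[symmetric] by (simp only:) (simp add: algebra_simps)
  qed
  then show ?thesis
    unfolding mellinV_def integral_mult_right_zero[symmetric]
    by (subst lborel_integral_shift[where c="l + ln (P / 2)", symmetric]) (simp only:)
qed

text \<open>Writes powers of 1 + cosh v as powers of e^v and 1 + e^v, the shape of the Beta
  integrand.\<close>

lemma ln_one_plus_cosh: "ln (1 + cosh v) = 2 * ln (1 + exp v) - v - ln 2" for v :: real
proof -
  have "1 + cosh v = (1 + exp v)\<^sup>2 / (exp v * 2)"
    by (simp add: cosh_def exp_minus field_simps power2_eq_square)
  also have "ln \<dots> = 2 * ln (1 + exp v) - (v + ln 2)"
    using exp_gt_zero[of v] by (simp add: ln_div ln_mult ln_realpow add_pos_pos del: exp_gt_zero)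
  finally show ?thesis by simp
qed

text \<open>Legendre's duplication formula at s/2 + w and at s + w: the square roots of pi cancel in
  the quotient, and of the powers of 2 only 2^-s survives.\<close>

lemma Gamma_quotient_duplication:
  fixes s w :: complex
  assumes "Re s > 0" "Re (s + 2 * w) > 0"
  shows "Gamma (s + w) * Gamma (s + 2 * w) / Gamma (2 * s + 2 * w) =
    exp (- s * of_real (ln 2)) * (Gamma (s / 2 + 1 / 2 + w) * Gamma (s / 2 + w)) / Gamma (s + 1 / 2 + w)"
proof -
  have *: "Gamma z * Gamma (z + 1 / 2) = exp ((1 - 2 * z) * of_real (ln 2)) * of_real (sqrt pi) * Gamma (2 * z)"
    if "Re z > 0" for z :: complex
    by (intro Gamma_legendre_duplication not_nonpos_Int_Re) (use that in auto)
  have nz: "Gamma z \<noteq> 0" if "Re z > 0" for z :: complex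
    using that not_nonpos_Int_Re[of z] by (auto simp: Gamma_eq_zero_iff)
  have re: "Re (s / 2 + w) > 0" "Re (s + w) > 0" "Re (s + 1 / 2 + w) > 0" "Re (2 * s + 2 * w) > 0"
    using assms by auto
  have d1: "Gamma (s / 2 + w) * Gamma (s / 2 + 1 / 2 + w) =
      exp ((1 - s - 2 * w) * of_real (ln 2)) * of_real (sqrt pi) * Gamma (s + 2 * w)"
    using *[OF re(1)] by (simp add: algebra_simps)
  have d2: "Gamma (s + w) * Gamma (s + 1 / 2 + w) =
      exp ((1 - 2 * s - 2 * w) * of_real (ln 2)) * of_real (sqrt pi) * Gamma (2 * s + 2 * w)"
    using *[OF re(2)] by (simp add: algebra_simps)
  have e: "exp ((1 - 2 * s - 2 * w) * of_real (ln 2)) =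
      exp (- s * of_real (ln 2)) * exp ((1 - s - 2 * w) * of_real (ln 2))"
    unfolding exp_add[symmetric] by (simp add: algebra_simps)
  have "Gamma (s + w) * Gamma (s + 2 * w) * Gamma (s + 1 / 2 + w) *
      (exp ((1 - s - 2 * w) * of_real (ln 2)) * of_real (sqrt pi)) =
    (exp (- s * of_real (ln 2)) * (Gamma (s / 2 + 1 / 2 + w) * Gamma (s / 2 + w)) * Gamma (2 * s + 2 * w)) *
      (exp ((1 - s - 2 * w) * of_real (ln 2)) * of_real (sqrt pi))"
    using d1 d2 unfolding e by (simp add: mult_ac)
  then have "Gamma (s + w) * Gamma (s + 2 * w) * Gamma (s + 1 / 2 + w) =
    exp (- s * of_real (ln 2)) * (Gamma (s / 2 + 1 / 2 + w) * Gamma (s / 2 + w)) * Gamma (2 * s + 2 * w)"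
    by simp
  then show ?thesis
    using nz[OF re(3)] nz[OF re(4)] by (simp add: field_simps)
qed

text \<open>After \<open>mellinV_shift\<close> the exponents P e^l and P e^l cosh v add, so
  integrating over l first gives Gamma(s + w) (P (1 + cosh v))^-(s+w). What is left in v is the Beta
  integral with parameters s and s + 2w; this is the origin of the Gamma quotient in
  \<open>barnes_kernel\<close>.\<close>

lemma integral_mellinV:
  assumes P: "P > 0" and s: "Re s > 0" and sw: "Re (s + 2 * w) > 0"
  shows "(LINT l|lborel. exp (s * of_real l - of_real (P * exp l)) * mellinV P l w) =
    exp (- (s + 2 * w) * of_real (ln (P / 2)) - s * of_real (ln 2)) * Gamma s *
      (Gamma (s / 2 + 1 / 2 + w) * Gamma (s / 2 + w)) / Gamma (s + 1 / 2 + w)"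
proof -
  have sw': "Re (s + w) > 0" using s sw by simp
  have nz: "Gamma (2 * s + 2 * w) \<noteq> 0"
    using not_nonpos_Int_Re[of "2 * s + 2 * w"] s sw by (auto simp: Gamma_eq_zero_iff)
  let ?B = "\<lambda>v. exp (s * of_real v - (s + (s + 2 * w)) * of_real (ln (1 + exp v)))"
  let ?F = "\<lambda>l v. exp ((s + w) * of_real l - of_real (P * exp l)) * exp (- w * of_real v - of_real (P * exp l * cosh v))"
  let ?c = "exp ((s + w) * of_real (ln 2 - ln P))"
  have pos: "P * (1 + cosh v) > 0" for v
    using P cosh_real_pos[of v] by (intro mult_pos_pos add_pos_pos) auto
  have F: "?F l v = exp (- w * of_real v) * exp ((s + w) * of_real l - of_real (P * (1 + cosh v) * exp l))" for l v
    unfolding exp_add[symmetric] by (simp add: algebra_simps)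
  have ev: "exp (- w * of_real v) * exp (- (s + w) * of_real (ln (P * (1 + cosh v)))) = ?c * ?B v" for v
  proof -
    have "ln (P * (1 + cosh v)) = ln P + (2 * ln (1 + exp v) - v - ln 2)"
      using P pos[of v] by (simp add: ln_mult ln_one_plus_cosh zero_less_mult_iff)
    then show ?thesis unfolding exp_add[symmetric] by (simp only:) (simp add: algebra_simps)
  qed
  have inner: "(LINT l|lborel. ?F l v) = Gamma (s + w) * ?c * ?B v" for v
    unfolding F integral_mult_right_zero integral_Gamma_exp_scaled[OF sw' pos]
    using ev[of v] by (simp only: mult_ac) 
  have inner_norm: "(LINT l|lborel. norm (?F l v)) = Gamma (Re (s + w)) * norm (?c * ?B v)" for v
  proof -
    have "norm (?F l v) = exp (- Re w * v) * exp (Re (s + w) * l - (P * (1 + cosh v)) * exp l)" for l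
      unfolding F by (simp add: norm_mult)
    then have "(LINT l|lborel. norm (?F l v)) =
        exp (- Re w * v) * (Gamma (Re (s + w)) * exp (- Re (s + w) * ln (P * (1 + cosh v))))"
      by (simp only: integral_mult_right_zero integral_Gamma_exp_scaled_real[OF sw' pos])
    then show ?thesis unfolding ev[symmetric] by (simp add: norm_mult)
  qed
  have int: "integrable (lborel \<Otimes>\<^sub>M lborel) (\<lambda>(v, l). ?F l v)"
  proof (rule lborel_pair.Fubini_integrable)
    show "integrable lborel (\<lambda>v. LINT l|lborel. norm (case (v, l) of (v, l) \<Rightarrow> ?F l v))"
      unfolding prod.case inner_norm
      using integrable_Beta_exp[OF s sw] by (intro integrable_mult_right integrable_norm)
    show "AE v in lborel. integrable lborel (\<lambda>l. case (v, l) of (v, l) \<Rightarrow> ?F l v)"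
      unfolding prod.case F by (intro AE_I2 integrable_mult_right integrable_Gamma_exp_scaled sw' pos)
  qed measurable
  have "exp (s * of_real l - of_real (P * exp l)) * mellinV P l w =
      exp (- w * of_real (ln (P / 2))) * (LINT v|lborel. ?F l v)" for l
  proof -
    have e: "exp (s * of_real l - of_real (P * exp l)) * exp (w * of_real (l - ln (P / 2))) =
        exp (- w * of_real (ln (P / 2))) * exp ((s + w) * of_real l - of_real (P * exp l))"
      unfolding exp_add[symmetric] by (simp add: algebra_simps)
    show ?thesis
      unfolding mellinV_shift[OF P] integral_mult_right_zero mult.assoc[symmetric] e ..
  qed
  then have "(LINT l|lborel. exp (s * of_real l - of_real (P * exp l)) * mellinV P l w) =
      exp (- w * of_real (ln (P / 2))) * (LINT l|lborel. (LINT v|lborel. ?F l v))"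
    by (simp only: integral_mult_right_zero)
  also have "(LINT l|lborel. (LINT v|lborel. ?F l v)) = (LINT v|lborel. (LINT l|lborel. ?F l v))"
    using lborel_pair.Fubini_integral[OF int] by simp
  also have "\<dots> = Gamma (s + w) * ?c * (LINT v|lborel. ?B v)"
    unfolding inner integral_mult_right_zero ..
  also have "(LINT v|lborel. ?B v) = Gamma s * Gamma (s + 2 * w) / Gamma (2 * s + 2 * w)"
    using integral_Beta_exp[OF s sw] nz by (simp add: field_simps)
  also have "exp (- w * of_real (ln (P / 2))) * (Gamma (s + w) * ?c * (Gamma s * Gamma (s + 2 * w) / Gamma (2 * s + 2 * w))) =
     exp (- (s + 2 * w) * of_real (ln (P / 2))) * Gamma s * (Gamma (s + w) * Gamma (s + 2 * w) / Gamma (2 * s + 2 * w))"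
  proof -
    have "exp (- w * of_real (ln (P / 2))) * ?c = exp (- (s + 2 * w) * of_real (ln (P / 2)))"
      unfolding exp_add[symmetric] using P by (simp add: ln_div algebra_simps)
    then show ?thesis by (simp add: mult_ac)
  qed
  also have "\<dots> = exp (- (s + 2 * w) * of_real (ln (P / 2)) - s * of_real (ln 2)) * Gamma s *
      (Gamma (s / 2 + 1 / 2 + w) * Gamma (s / 2 + w)) / Gamma (s + 1 / 2 + w)"
  proof -
    have "exp (- (s + 2 * w) * of_real (ln (P / 2)) - s * of_real (ln 2)) =
        exp (- (s + 2 * w) * of_real (ln (P / 2))) * exp (- s * of_real (ln 2))"
      unfolding exp_add[symmetric] by simp
    then show ?thesis
      unfolding Gamma_quotient_duplication[OF s sw] by simp
  qed
  finally show ?thesis .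
qed

text \<open>
  For \<open>A\<^sup>2 + B\<^sup>2 = P\<^sup>2 + (2 a - 2) A B\<close> one has \<open>A\<^sup>2 + B\<^sup>2 + 2 A B cosh \<tau> = P\<^sup>2 + A B coshk a \<tau>\<close>.
  The cases \<open>a = 2\<close> and \<open>a = 0\<close> are \<open>P = \<bar>A - B\<bar>\<close> and \<open>P = A + B\<close>.
\<close>

definition coshk :: "real \<Rightarrow> real \<Rightarrow> real" where
  "coshk a \<tau> = 2 * a - 2 + 2 * cosh \<tau>"

lemma coshk_uminus [simp]: "coshk a (- \<tau>) = coshk a \<tau>"
  by (simp add: coshk_def)

lemma measurable_coshk [measurable]: "coshk a \<in> borel_measurable borel"
  unfolding coshk_def by measurable

lemma coshk_pos: "coshk a \<tau> > 0" if "a \<ge> 0" "\<tau> \<noteq> 0"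
proof -
  have "cosh \<tau> \<noteq> 1" using that by simp
  then show ?thesis using cosh_real_ge_1[of \<tau>] that unfolding coshk_def by linarith
qed

lemma AE_coshk_pos: "a \<ge> 0 \<Longrightarrow> AE \<tau> in lborel. coshk a \<tau> > 0"
  using AE_lborel_singleton[of 0] by eventually_elim (rule coshk_pos)

text \<open>Folded onto the negative half-line because \<open>calF\<close> integrates over 0 < t <
  1, where x = ln t is negative.\<close>

lemma lborel_integral_fold:
  fixes f :: "real \<Rightarrow> complex"
  assumes f: "integrable lborel f"
  shows "(LINT x|lborel. f x) = (LINT x|lborel. indicator {..<0} x *\<^sub>R (f x + f (- x)))"
proof -
  have [measurable]: "f \<in> borel_measurable borel" using f by auto
  let ?f1 = "\<lambda>x. indicator {..<0} x *\<^sub>R f x" and ?f2 = "\<lambda>x. indicator {0<..} x *\<^sub>R f x"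
  have i: "integrable lborel ?f1" "integrable lborel ?f2"
    using f by (auto intro: integrable_mult_indicator)
  have i2: "integrable lborel (\<lambda>x. ?f2 (- x))"
    using i(2) lborel_integrable_uminus[of ?f2] by blast
  have "(LINT x|lborel. f x) = (LINT x|lborel. ?f1 x + ?f2 x)"
    by (rule integral_cong_AE) (use AE_lborel_singleton[of 0] in \<open>auto simp: indicator_def\<close>)
  also have "\<dots> = (LINT x|lborel. ?f1 x) + (LINT x|lborel. ?f2 x)"
    by (rule Bochner_Integration.integral_add[OF i])
  also have "(LINT x|lborel. ?f2 x) = (LINT x|lborel. ?f2 (- x))"
    by (rule lborel_integral_uminus[symmetric])
  also have "(LINT x|lborel. ?f1 x) + (LINT x|lborel. ?f2 (- x)) = (LINT x|lborel. ?f1 x + ?f2 (- x))"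
    by (rule Bochner_Integration.integral_add[OF i(1) i2, symmetric])
  also have "\<dots> = (LINT x|lborel. indicator {..<0} x *\<^sub>R (f x + f (- x)))"
    by (intro Bochner_Integration.integral_cong) (auto simp: indicator_def)
  finally show ?thesis .
qed

lemma of_real_powr_eq_exp: "x > 0 \<Longrightarrow> complex_of_real x powr z = exp (z * of_real (ln x))"
  by (simp add: powr_def Ln_of_real)

text \<open>With t = e^x the base \<open>a * t + (1 - t)^2 / 2\<close> is t times
  \<open>coshk a x / 2\<close>, so all powers of t cancel against dt. As \<open>coshk a\<close> is
  even, adding x and -x turns the phase into 2 cos(r x).\<close>

lemma calF_eq:
  assumes a: "a \<ge> 0"
    and int: "integrable lborel (\<lambda>\<tau>. exp (Re w * ln (coshk a \<tau>)))"
  shows "(LINT \<tau>|lborel. exp (\<i> * of_real (r * \<tau>) + w * of_real (ln (coshk a \<tau>)))) =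
    2 * exp (w * of_real (ln 2)) * calF r a (- 2 * w)"
proof -
  let ?q = "\<lambda>t. a * t + (1 - t)\<^sup>2 / 2"
  let ?f = "\<lambda>t. of_real (cos (r * ln t)) * of_real t powr (- 2 * w / 2 - 1) * of_real (?q t) powr (- (- 2 * w) / 2)"
  let ?g = "\<lambda>t. of_real (cos (r * ln t)) * exp ((- w - 1) * of_real (ln t)) * exp (w * of_real (ln (?q t)))"
  have [measurable]: "?g \<in> borel_measurable borel" by measurable
  have "calF r a (- 2 * w) = (LINT t:{0<..<1}|lborel. ?g t)"
    unfolding calF_def
  proof (intro set_lebesgue_integral_cong allI impI)
    fix t :: real assume t: "t \<in> {0<..<1}"
    then have "?q t > 0" using a by (intro add_nonneg_pos) auto
    moreover have "t > 0" using t by simp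
    ultimately show "?f t = ?g t"
      by (simp only: of_real_powr_eq_exp) simp
  qed auto
  also have "\<dots> = (LINT t:{0<..}|lborel. indicator {..<1} t *\<^sub>R ?g t)"
    unfolding set_lebesgue_integral_def
    by (intro Bochner_Integration.integral_cong) (auto simp: indicator_def)
  also have "\<dots> = (LINT x|lborel. exp x *\<^sub>R (indicator {..<1} (exp x) *\<^sub>R ?g (exp x)))"
    by (rule set_integral_exp_substitution) measurable
  also have "\<dots> = (LINT x|lborel. exp (- w * of_real (ln 2)) * (indicator {..<0} x *\<^sub>R
      (of_real (cos (r * x)) * exp (w * of_real (ln (coshk a x))))))"
  proof (intro Bochner_Integration.integral_cong refl)
    fix x :: real
    have "exp x *\<^sub>R ?g (exp x) = of_real (cos (r * x)) * exp (w * of_real (ln (coshk a x))) * exp (- w * of_real (ln 2))"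
      if "x < 0"
    proof -
      have "?q (exp x) = exp x * (coshk a x / 2)"
        by (simp add: coshk_def cosh_def exp_minus field_simps power2_eq_square)
      moreover have "ln (exp x * (coshk a x / 2)) = x + (ln (coshk a x) - ln 2)"
        using coshk_pos[OF a, of x] that by (simp add: ln_mult ln_div)
      ultimately have "ln (?q (exp x)) = x + (ln (coshk a x) - ln 2)"
        by (simp only:)
      then have "exp (of_real x) * exp ((- w - 1) * of_real (ln (exp x))) * exp (w * of_real (ln (?q (exp x)))) =
          exp (w * of_real (ln (coshk a x))) * exp (- w * of_real (ln 2))"
        unfolding exp_add[symmetric] by (simp only:) (simp add: algebra_simps)
      then show ?thesis
        by (simp add: scaleR_conv_of_real exp_of_real mult_ac)
    qed
    then show "exp x *\<^sub>R (indicator {..<1} (exp x) *\<^sub>R ?g (exp x)) =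
      exp (- w * of_real (ln 2)) * (indicator {..<0} x *\<^sub>R (of_real (cos (r * x)) * exp (w * of_real (ln (coshk a x)))))"
      by (auto simp: indicator_def)
  qed
  finally have F: "calF r a (- 2 * w) = exp (- w * of_real (ln 2)) * (LINT x|lborel. indicator {..<0} x *\<^sub>R
      (of_real (cos (r * x)) * exp (w * of_real (ln (coshk a x)))))"
    by (simp only: integral_mult_right_zero)
  let ?h = "\<lambda>\<tau>. exp (\<i> * of_real (r * \<tau>) + w * of_real (ln (coshk a \<tau>)))"
  have h_even: "?h x + ?h (- x) = 2 * (of_real (cos (r * x)) * exp (w * of_real (ln (coshk a x))))" for x
  proof -
    have "?h x = exp (w * of_real (ln (coshk a x))) * exp (\<i> * of_real (r * x))"
      "?h (- x) = exp (w * of_real (ln (coshk a x))) * exp (- (\<i> * of_real (r * x)))"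
      unfolding exp_add[symmetric] by (simp_all add: add.commute)
    moreover have "of_real (cos (r * x)) = (exp (\<i> * of_real (r * x)) + exp (- (\<i> * of_real (r * x)))) / 2"
      unfolding cos_of_real[symmetric] cos_exp_eq by simp
    ultimately show ?thesis by (simp only:) (simp add: algebra_simps)
  qed
  have "integrable lborel ?h"
    by (rule Bochner_Integration.integrable_bound[OF int]) (auto intro!: AE_I2)
  then have "(LINT \<tau>|lborel. ?h \<tau>) = (LINT x|lborel. indicator {..<0} x *\<^sub>R
      (2 * (of_real (cos (r * x)) * exp (w * of_real (ln (coshk a x))))))"
    by (simp only: lborel_integral_fold h_even)
  also have "(LINT x|lborel. indicator {..<0} x *\<^sub>R (2 * (of_real (cos (r * x)) * exp (w * of_real (ln (coshk a x)))))) =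
    2 * (LINT x|lborel. indicator {..<0} x *\<^sub>R (of_real (cos (r * x)) * exp (w * of_real (ln (coshk a x)))))"
    unfolding mult_scaleR_right[symmetric] by (rule integral_mult_right_zero)
  finally show ?thesis
    unfolding F by (simp add: exp_minus field_simps)
qed

text \<open>Since \<open>coshk 2 x\<close> is (1 + e^x)^2 / e^x, its power \<sigma> is the Beta
  integrand with both parameters equal to -\<sigma>.\<close>

lemma integrable_coshk_2:
  assumes "\<sigma> < 0"
  shows "integrable lborel (\<lambda>\<tau>. exp (\<sigma> * ln (coshk 2 \<tau>)))"
proof -
  have "norm (exp (of_real (- \<sigma>) * of_real x - (of_real (- \<sigma>) + of_real (- \<sigma>)) * complex_of_real (ln (1 + exp x)))) =
    exp (\<sigma> * ln (coshk 2 x))" for x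
  proof -
    have "coshk 2 x = 2 * (1 + cosh x)" by (simp add: coshk_def)
    moreover have "ln (2 * (1 + cosh x)) = ln 2 + ln (1 + cosh x)"
      using cosh_real_pos[of x] by (intro ln_mult_pos add_pos_pos) auto
    ultimately have "ln (coshk 2 x) = 2 * ln (1 + exp x) - x"
      by (simp only: ln_one_plus_cosh)
    then show ?thesis by (simp only:) (simp add: algebra_simps)
  qed
  then show ?thesis
    using integrable_norm[OF integrable_Beta_exp[of "of_real (- \<sigma>)" "of_real (- \<sigma>)"]] assms by simp
qed

text \<open>\<open>coshk 0 \<tau>\<close> is (2 sinh(\<tau>/2))^2, with a double zero at 0 and
  exponential growth. The single minorant (\<tau>/4 * exp(\<tau>/4))^2 keeps both features, so a
  negative power of \<open>coshk 0 \<tau>\<close> is dominated by an Euler integrand.\<close>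

lemma coshk_0_ge:
  assumes "\<tau> > 0"
  shows "ln (coshk 0 \<tau>) \<ge> 2 * ln \<tau> - 2 * ln 4 + \<tau> / 2"
proof -
  have 1: "1 + \<tau> \<le> exp \<tau>" "1 + \<tau> / 4 \<le> exp (\<tau> / 4)" by (rule exp_ge_add_one_self)+
  have "\<tau> / 4 * exp (\<tau> / 4) \<le> exp (\<tau> / 2) * (\<tau> / (1 + \<tau>))"
  proof -
    have "(1 + \<tau>) / 4 \<le> exp (\<tau> / 4)" using 1(2) assms by (simp add: field_simps)
    then have "exp (\<tau> / 4) * ((1 + \<tau>) / 4) \<le> exp (\<tau> / 4) * exp (\<tau> / 4)" by (intro mult_left_mono) auto
    also have "\<dots> = exp (\<tau> / 2)" by (simp flip: exp_add)
    finally have "exp (\<tau> / 4) * ((1 + \<tau>) / 4) * (\<tau> / (1 + \<tau>)) \<le> exp (\<tau> / 2) * (\<tau> / (1 + \<tau>))"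
      using assms by (intro mult_right_mono) auto
    also have "exp (\<tau> / 4) * ((1 + \<tau>) / 4) * (\<tau> / (1 + \<tau>)) = ((1 + \<tau>) / (1 + \<tau>)) * (\<tau> / 4 * exp (\<tau> / 4))"
      by (simp add: mult_ac)
    also have "(1 + \<tau>) / (1 + \<tau>) = 1"
      using assms by simp
    finally show ?thesis by simp
  qed
  also have "\<tau> / (1 + \<tau>) \<le> 1 - exp (- \<tau>)"
    using 1(1) assms by (simp add: exp_minus field_simps)
  also have "exp (\<tau> / 2) * (1 - exp (- \<tau>)) = exp (\<tau> / 2) - exp (- (\<tau> / 2))"
    by (simp add: algebra_simps flip: exp_add)
  finally have "(\<tau> / 4 * exp (\<tau> / 4))\<^sup>2 \<le> (exp (\<tau> / 2) - exp (- (\<tau> / 2)))\<^sup>2"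
    using assms by (intro power_mono) (auto simp: mult_left_mono)
  also have "\<dots> = coshk 0 \<tau>"
    by (simp add: coshk_def cosh_def power2_eq_square algebra_simps flip: exp_add)
  finally have le: "(\<tau> / 4 * exp (\<tau> / 4))\<^sup>2 \<le> coshk 0 \<tau>" .
  have "ln ((\<tau> / 4 * exp (\<tau> / 4))\<^sup>2) \<le> ln (coshk 0 \<tau>)"
    using le assms coshk_pos[of 0 \<tau>] by (subst ln_le_cancel_iff) auto
  moreover have "ln ((\<tau> / 4 * exp (\<tau> / 4))\<^sup>2) = 2 * ln \<tau> - 2 * ln 4 + \<tau> / 2"
    using assms by (simp add: ln_realpow ln_mult ln_div)
  ultimately show ?thesis by simp
qed

text \<open>Near 0 the integrand behaves like |\<tau>|^(2\<sigma>), hence the threshold -1/2;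
  \<sigma> < 0 gives decay at infinity.\<close>

lemma integrable_coshk_0:
  assumes "- 1 / 2 < \<sigma>" "\<sigma> < 0"
  shows "integrable lborel (\<lambda>\<tau>. exp (\<sigma> * ln (coshk 0 \<tau>)))"
proof -
  let ?f = "\<lambda>\<tau>. exp (\<sigma> * ln (coshk 0 \<tau>))"
  let ?g = "\<lambda>\<tau>. exp (- 2 * \<sigma> * ln 4) * exp (2 * \<sigma> * ln \<tau> - (- \<sigma> / 2) * \<tau>)"
  have "integrable lborel (\<lambda>x. exp x *\<^sub>R ?g (exp x))"
  proof -
    have "exp x *\<^sub>R ?g (exp x) = exp (- 2 * \<sigma> * ln 4) * exp ((2 * \<sigma> + 1) * x - (- \<sigma> / 2) * exp x)" for x
      by (simp add: algebra_simps flip: exp_add)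
    then show ?thesis
      using assms by (simp only:) (intro integrable_mult_right integrable_Gamma_exp_scaled_real, auto)
  qed
  then have ig: "set_integrable lborel {0<..} ?g"
    by (subst set_integrable_exp_substitution) auto
  have f_pos: "integrable lborel (\<lambda>\<tau>. indicator {0<..} \<tau> *\<^sub>R ?f \<tau>)"
  proof (rule Bochner_Integration.integrable_bound[OF ig[unfolded set_integrable_def]])
    show "AE \<tau> in lborel. norm (indicator {0<..} \<tau> *\<^sub>R ?f \<tau>) \<le> norm (indicator {0<..} \<tau> *\<^sub>R ?g \<tau>)"
    proof (rule AE_I2)
      fix \<tau> :: real
      have "?f \<tau> \<le> ?g \<tau>" if "\<tau> > 0"
        using mult_left_mono_neg[OF coshk_0_ge[OF that], of \<sigma>] assms
        by (simp add: algebra_simps flip: exp_add)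
      then show "norm (indicator {0<..} \<tau> *\<^sub>R ?f \<tau>) \<le> norm (indicator {0<..} \<tau> *\<^sub>R ?g \<tau>)"
        by (auto simp: indicator_def)
    qed
  qed measurable
  have "integrable lborel (\<lambda>\<tau>. indicator {0<..} (- \<tau>) *\<^sub>R ?f (- \<tau>))"
    using f_pos lborel_integrable_uminus[of "\<lambda>\<tau>. indicator {0<..} \<tau> *\<^sub>R ?f \<tau>"] by blast
  then have "integrable lborel (\<lambda>\<tau>. indicator {0<..} \<tau> *\<^sub>R ?f \<tau> + indicator {0<..} (- \<tau>) *\<^sub>R ?f (- \<tau>))"
    using f_pos by (rule Bochner_Integration.integrable_add[rotated])
  also have "?this \<longleftrightarrow> integrable lborel ?f"
    by (rule integrable_cong_AE) (use AE_lborel_singleton[of 0] in \<open>auto simp: indicator_def\<close>)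
  finally show ?thesis .
qed

text \<open>By \<open>rel\<close> the exponent of \<open>macK_mult\<close> splits into a part with
  P^2, free of \<tau>, and a multiple of \<open>coshk a \<tau>\<close>. The exponential of the
  latter is replaced by its inverse Mellin integral over t; under that integral the v-integral gives
  \<open>mellinV\<close> and the \<tau>-integral gives \<open>calF\<close>.\<close>

lemma macK_mult_mellin:
  fixes \<sigma> a P \<alpha> \<beta> l r :: real
  assumes \<sigma>: "\<sigma> < 0" and a: "a \<ge> 0"
    and int: "integrable lborel (\<lambda>\<tau>. exp (\<sigma> * ln (coshk a \<tau>)))"
    and \<alpha>: "\<alpha> > 0" and \<beta>: "\<beta> > 0"
    and rel: "\<alpha>\<^sup>2 + \<beta>\<^sup>2 = P\<^sup>2 + (2 * a - 2) * (\<alpha> * \<beta>)"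
  defines "w \<equiv> \<lambda>t. of_real \<sigma> + \<i> * of_real t"
  shows "macK r (\<alpha> * exp l) * macK r (\<beta> * exp l) =
    (LINT t|lborel. Gamma (- w t) * (2 * exp (w t * of_real (ln 2)) * calF r a (- 2 * w t)) *
        exp (w t * of_real (ln (\<alpha> * \<beta> / 4))) * mellinV P l (w t)) / (2 * pi)"
proof -
  define g where "g t = Gamma (of_real (- \<sigma>) - \<i> * of_real t)" for t
  have g: "Gamma (- w t) = g t" for t by (simp add: g_def w_def)
  have gi: "integrable lborel g" unfolding g_def using \<sigma> by (intro integrable_Gamma_line) auto
  have [measurable]: "g \<in> borel_measurable borel" using gi by auto
  define c where "c = ln (\<alpha> * \<beta> / 4)"
  let ?u = "\<lambda>v. of_real (exp v + P\<^sup>2 / 4 * exp (2 * l - v)) :: complex"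
  \<comment> \<open>The point at which the exponential is inverted is L = 2 l - v +
    \<open>?q \<tau>\<close>. The logarithm requires \<open>coshk a \<tau>\<close> to be positive,
    which can fail only at \<tau> = 0.\<close>
  let ?q = "\<lambda>\<tau>. c + ln (coshk a \<tau>)"
  let ?Z = "\<lambda>\<tau> v. complex_of_real (exp (- exp v - ((\<alpha> * exp l)\<^sup>2 + (\<beta> * exp l)\<^sup>2 +
    2 * (\<alpha> * exp l) * (\<beta> * exp l) * cosh \<tau>) / 4 * exp (- v)))"
  have [measurable]: "w \<in> borel_measurable borel" unfolding w_def by measurable
  have Re_w: "Re (w t) = \<sigma>" for t by (simp add: w_def)
  have mV: "(\<lambda>t. mellinV P l (w t)) \<in> borel_measurable borel"
    unfolding mellinV_def by measurable
  note [measurable] = mV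
  have inner: "(LINT v|lborel. ?Z \<tau> v) =
    (LINT t|lborel. g t * exp (w t * of_real (?q \<tau>)) * mellinV P l (w t)) / (2 * pi)"
    if \<tau>: "coshk a \<tau> > 0" for \<tau>
  proof -
    let ?G = "\<lambda>v t. exp (- ?u v) * (g t * exp (w t * of_real (2 * l - v + ?q \<tau>)))"
    have e: "?Z \<tau> v =
      (LINT t|lborel. ?G v t) / (2 * pi)" for v
    proof -
      have "(LINT t|lborel. g t * exp (w t * of_real (2 * l - v + ?q \<tau>))) =
         of_real (2 * pi * exp (- exp (2 * l - v + ?q \<tau>)))"
        using mellin_inversion_exp[of "- \<sigma>" "2 * l - v + ?q \<tau>"] \<sigma> by (simp add: g_def w_def)
      then have "(LINT t|lborel. ?G v t) / (2 * pi) = exp (- ?u v) * of_real (exp (- exp (2 * l - v + ?q \<tau>)))"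
        by (simp only: integral_mult_right_zero) simp
      also have "\<dots> = exp (of_real (- (exp v + P\<^sup>2 / 4 * exp (2 * l - v)) - exp (2 * l - v + ?q \<tau>)))"
        unfolding exp_of_real[of "- exp (2 * l - v + ?q \<tau>)", symmetric] exp_add[symmetric] by simp
      also have "- (exp v + P\<^sup>2 / 4 * exp (2 * l - v)) - exp (2 * l - v + ?q \<tau>) =
         - exp v - ((\<alpha> * exp l)\<^sup>2 + (\<beta> * exp l)\<^sup>2 + 2 * (\<alpha> * exp l) * (\<beta> * exp l) * cosh \<tau>) / 4 * exp (- v)"
      proof -
        have f1: "exp (2 * l - v + ?q \<tau>) = exp (2 * l - v) * (\<alpha> * \<beta> / 4 * coshk a \<tau>)"
          using \<alpha> \<beta> \<tau> by (simp add: c_def exp_add)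
        have f2: "exp (2 * l - v) = (exp l)\<^sup>2 * exp (- v)"
          by (simp add: power2_eq_square flip: exp_add)
        have f3: "(\<alpha> * exp l)\<^sup>2 + (\<beta> * exp l)\<^sup>2 + 2 * (\<alpha> * exp l) * (\<beta> * exp l) * cosh \<tau> =
           (exp l)\<^sup>2 * (\<alpha>\<^sup>2 + \<beta>\<^sup>2 + 2 * \<alpha> * \<beta> * cosh \<tau>)"
          by (simp add: power_mult_distrib algebra_simps power2_eq_square)
        show ?thesis unfolding f1 f2 f3 rel by (simp add: coshk_def field_simps)
      qed
      finally show ?thesis by (simp only: exp_of_real)
    qed
    have int1: "integrable (lborel \<Otimes>\<^sub>M lborel) (\<lambda>(v, t). ?G v t)"
    proof (rule integrable_pair_bound)
      show "norm (?G v t) \<le> (exp (\<sigma> * (2 * l + ?q \<tau>)) * exp (- \<sigma> * v - 1 * exp v)) * norm (g t)" for v t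
        by (simp add: norm_mult Re_w algebra_simps flip: exp_add) (intro mult_left_mono, auto)
      show "integrable lborel (\<lambda>v. exp (\<sigma> * (2 * l + ?q \<tau>)) * exp (- \<sigma> * v - 1 * exp v))"
        using \<sigma> by (intro integrable_mult_right integrable_Gamma_exp_scaled_real) auto
    qed (use gi in \<open>auto intro: integrable_norm\<close>)
    have inner_v: "(LINT v|lborel. ?G v t) = g t * exp (w t * of_real (?q \<tau>)) * mellinV P l (w t)" for t
    proof -
      have "?G v t = g t * exp (w t * of_real (?q \<tau>)) * exp (w t * of_real (2 * l - v) - ?u v)" for v
      proof -
        have "exp (- ?u v) * exp (w t * of_real (2 * l - v + ?q \<tau>)) =
            exp (w t * of_real (?q \<tau>)) * exp (w t * of_real (2 * l - v) - ?u v)"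
          unfolding exp_add[symmetric] by (simp add: algebra_simps)
        then show ?thesis by (simp add: mult_ac)
      qed
      then show ?thesis unfolding mellinV_def by (simp only: integral_mult_right_zero)
    qed
    have "(LINT v|lborel. ?Z \<tau> v) =
      (LINT v|lborel. (LINT t|lborel. ?G v t)) / (2 * pi)"
      unfolding e by simp
    also have "(LINT v|lborel. (LINT t|lborel. ?G v t)) = (LINT t|lborel. (LINT v|lborel. ?G v t))"
      using lborel_pair.Fubini_integral[OF int1] by simp
    finally show ?thesis unfolding inner_v .
  qed
  \<comment> \<open>For the exchange of \<tau> and t the domination is a product: the assumed
    integrable power of \<open>coshk a\<close> in \<tau>, and Gamma on a vertical line in t, with
    \<open>norm_mellinV_le\<close> bounding the rest.\<close>
  let ?H = "\<lambda>\<tau> t. exp (\<i> * of_real (r * \<tau>)) * (g t * exp (w t * of_real (?q \<tau>)) * mellinV P l (w t))"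
  have int2: "integrable (lborel \<Otimes>\<^sub>M lborel) (\<lambda>(\<tau>, t). ?H \<tau> t)"
  proof (rule integrable_pair_bound)
    show "norm (?H \<tau> t) \<le> (exp (\<sigma> * c) * exp (\<sigma> * ln (coshk a \<tau>))) * (norm (g t) * (exp (2 * l * \<sigma>) * Gamma (- \<sigma>)))" for \<tau> t
    proof -
      have "norm (?H \<tau> t) = (exp (\<sigma> * c) * exp (\<sigma> * ln (coshk a \<tau>))) * (norm (g t) * norm (mellinV P l (w t)))"
        by (simp add: norm_mult Re_w algebra_simps flip: exp_add)
      also have "\<dots> \<le> (exp (\<sigma> * c) * exp (\<sigma> * ln (coshk a \<tau>))) * (norm (g t) * (exp (2 * l * \<sigma>) * Gamma (- \<sigma>)))"
        using norm_mellinV_le[of "w t" P l] \<sigma> by (intro mult_left_mono) (auto simp: Re_w)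
      finally show ?thesis .
    qed
  qed (use gi int in \<open>auto intro!: integrable_norm integrable_mult_right integrable_mult_left\<close>)
  have inner_tau: "(LINT \<tau>|lborel. ?H \<tau> t) = Gamma (- w t) * (2 * exp (w t * of_real (ln 2)) * calF r a (- 2 * w t)) *
        exp (w t * of_real (ln (\<alpha> * \<beta> / 4))) * mellinV P l (w t)" for t
  proof -
    have "?H \<tau> t = (g t * exp (w t * of_real c) * mellinV P l (w t)) *
        exp (\<i> * of_real (r * \<tau>) + w t * of_real (ln (coshk a \<tau>)))" for \<tau>
      by (simp add: exp_add algebra_simps)
    then have "(LINT \<tau>|lborel. ?H \<tau> t) = (g t * exp (w t * of_real c) * mellinV P l (w t)) *
        (LINT \<tau>|lborel. exp (\<i> * of_real (r * \<tau>) + w t * of_real (ln (coshk a \<tau>))))"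
      by (simp only: integral_mult_right_zero)
    also have "(LINT \<tau>|lborel. exp (\<i> * of_real (r * \<tau>) + w t * of_real (ln (coshk a \<tau>)))) =
        2 * exp (w t * of_real (ln 2)) * calF r a (- 2 * w t)"
      by (rule calF_eq[OF a]) (simp add: Re_w int)
    finally show ?thesis by (simp add: g c_def mult_ac)
  qed
  have "macK r (\<alpha> * exp l) * macK r (\<beta> * exp l) = (LINT \<tau>|lborel. (LINT t|lborel. ?H \<tau> t) / (2 * pi))"
  proof (subst macK_mult)
    show "(LINT \<tau>|lborel. exp (\<i> * of_real (r * \<tau>)) *
       (LINT v|lborel. ?Z \<tau> v)) =
       (LINT \<tau>|lborel. (LINT t|lborel. ?H \<tau> t) / (2 * pi))"
    proof (rule integral_cong_AE)
      show "AE \<tau> in lborel. exp (\<i> * of_real (r * \<tau>)) *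
       (LINT v|lborel. ?Z \<tau> v) = (LINT t|lborel. ?H \<tau> t) / (2 * pi)"
        using AE_coshk_pos[OF a]
      proof eventually_elim
        fix \<tau> assume "coshk a \<tau> > 0"
        then show "exp (\<i> * of_real (r * \<tau>)) *
          (LINT v|lborel. ?Z \<tau> v) = (LINT t|lborel. ?H \<tau> t) / (2 * pi)"
          by (simp only: inner integral_mult_right_zero times_divide_eq_right)
      qed
    qed measurable
  qed (use \<alpha> \<beta> in auto)
  also have "\<dots> = (LINT \<tau>|lborel. (LINT t|lborel. ?H \<tau> t)) / (2 * pi)"
    by (rule integral_divide_zero)
  also have "(LINT \<tau>|lborel. (LINT t|lborel. ?H \<tau> t)) = (LINT t|lborel. (LINT \<tau>|lborel. ?H \<tau> t))"
    using lborel_pair.Fubini_integral[OF int2] by simp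
  finally show ?thesis unfolding inner_tau .
qed

text \<open>Bookkeeping of powers: 2 ln pi comes from \<alpha> \<beta> / 4 = pi^2 p q with \<alpha>
  = 2 pi p, \<beta> = 2 pi q, and it cancels against (P/2)^(-2w), leaving h^(-2w). The factor 2^-s
  of the duplication completes (2 pi h)^-s.\<close>

lemma barnes_kernel_mellinV:
  fixes s w :: complex and h :: int and J :: complex
  assumes h: "h > 0" and s: "Re s > 0" and sw: "Re (s + 2 * w) > 0"
  defines "P \<equiv> 2 * pi * of_int h"
  shows "Gamma (- w) * (2 * exp (w * of_real (ln 2)) * F) * exp (w * of_real (2 * ln pi)) *
      (LINT l|lborel. exp (s * of_real l - of_real (P * exp l)) * mellinV P l w) =
    2 * Gamma s * exp (- s * of_real (ln (2 * pi * of_int h))) * (barnes_kernel h s w * F)"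
proof -
  have hr: "complex_of_int h = of_real (of_int h)" by simp
  have h': "real_of_int h > 0" using h by simp
  have P: "P > 0" using h by (simp add: P_def)
  have e1: "(2 :: complex) powr (- w) = exp (- (w * of_real (ln 2)))"
    using of_real_powr_eq_exp[of 2 "- w"] by simp
  have e2: "of_int h powr (2 * w) = exp (2 * w * of_real (ln (of_int h)))"
    unfolding hr using of_real_powr_eq_exp[OF h'] by simp
  have ln1: "ln (P / 2) = ln pi + ln (of_int h)" "ln (2 * pi * of_int h) = ln 2 + ln pi + ln (of_int h)"
    using h' by (simp_all add: P_def ln_mult)
  have bk: "barnes_kernel h s w = (Gamma (s / 2 + 1 / 2 + w) * Gamma (s / 2 + w) / Gamma (s + 1 / 2 + w)) *
      Gamma (- w) * exp (w * of_real (ln 2) - 2 * w * of_real (ln (of_int h)))"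
    unfolding barnes_kernel_def e1 e2 by (simp add: exp_diff exp_minus field_simps)
  have ex: "exp (w * of_real (ln 2)) * exp (w * of_real (2 * ln pi)) *
      exp (- (s + 2 * w) * of_real (ln (P / 2)) - s * of_real (ln 2)) =
    exp (- s * of_real (ln (2 * pi * of_int h))) * exp (w * of_real (ln 2) - 2 * w * of_real (ln (of_int h)))"
    unfolding exp_add[symmetric] ln1 by (simp add: algebra_simps)
  show ?thesis
    unfolding integral_mellinV[OF P s sw] bk
    using ex by (simp add: field_simps)
qed

section \<open>The Mellin-Barnes formula for one pair of Fourier modes\<close>

context
  fixes \<sigma> a r :: real and h :: int and s :: complex and w :: "real \<Rightarrow> complex" and P :: real
  assumes \<sigma>: "\<sigma> < 0" and a: "a \<ge> 0"
    and int: "integrable lborel (\<lambda>\<tau>. exp (\<sigma> * ln (coshk a \<tau>)))"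
    and h: "h > 0" and s: "Re s > 0" and sw: "Re s + 2 * \<sigma> > 0"
    and w_def: "w = (\<lambda>t. of_real \<sigma> + \<i> * of_real t)" and P_def: "P = 2 * pi * of_int h"
begin

private abbreviation (input) "J \<equiv> \<lambda>t. 2 * exp (w t * of_real (ln 2)) * calF r a (- 2 * w t)"
private abbreviation (input) "E \<equiv> \<lambda>t. LINT l|lborel. exp (s * of_real l - of_real (P * exp l)) * mellinV P l (w t)"
private abbreviation (input) "e \<equiv> \<lambda>l. exp (s * of_real l - of_real (P * exp l))"

private lemma Re_w: "Re (w t) = \<sigma>"
  by (simp add: w_def)

private lemma P: "P > 0"
  using h by (simp add: P_def)

private lemma measurable_w [measurable]: "w \<in> borel_measurable borel"
  unfolding w_def by measurable

private lemma J_eq: "J t = (LINT \<tau>|lborel. exp (\<i> * of_real (r * \<tau>) + w t * of_real (ln (coshk a \<tau>))))"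
  using calF_eq[OF a, of "w t" r] int by (simp only: Re_w)

private lemma measurable_J: "J \<in> borel_measurable borel"
  unfolding J_eq by measurable

private lemma norm_J_le: "norm (J t) \<le> (LINT \<tau>|lborel. exp (\<sigma> * ln (coshk a \<tau>)))"
  unfolding J_eq
proof (rule Bochner_Integration.integral_norm_bound_integral[OF _ int])
  show "integrable lborel (\<lambda>\<tau>. exp (\<i> * of_real (r * \<tau>) + w t * of_real (ln (coshk a \<tau>))))"
    by (rule Bochner_Integration.integrable_bound[OF int]) (auto intro!: AE_I2 simp: Re_w)
qed (simp add: Re_w)

private lemma measurable_mellinV: "(\<lambda>(l, t). mellinV P l (w t)) \<in> borel_measurable (borel \<Otimes>\<^sub>M borel)"
  unfolding mellinV_def by measurable

private lemma integrable_Gamma_w: "integrable lborel (\<lambda>t. Gamma (- w t))"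
  using integrable_Gamma_line[of "- \<sigma>"] \<sigma> by (simp add: w_def)

text \<open>The bound for \<open>mellinV\<close> contributes exp(2 l \<sigma>) and lowers the
  exponent at l -> -infinity from Re s to Re s + 2\<sigma>; positivity of the latter is
  \<open>sw\<close>. In t, Gamma(- w t) alone provides integrability, \<open>J\<close> being bounded
  on the line.\<close>

private lemma integrable_mellin_fubini:
  "integrable (lborel \<Otimes>\<^sub>M lborel)
    (\<lambda>(l, t). e l * (Gamma (- w t) * J t * exp (w t * of_real c) * mellinV P l (w t)))"
proof (rule integrable_pair_bound)
  let ?K = "LINT \<tau>|lborel. exp (\<sigma> * ln (coshk a \<tau>))"
  let ?p = "\<lambda>l. exp ((Re s + 2 * \<sigma>) * l - P * exp l)"
  let ?q = "\<lambda>t. norm (Gamma (- w t)) * (?K * exp (\<sigma> * c) * Gamma (- \<sigma>))"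
  note [measurable] = measurable_J measurable_mellinV borel_measurable_integrable[OF integrable_Gamma_w]
  show "(\<lambda>(l, t). e l * (Gamma (- w t) * J t * exp (w t * of_real c) * mellinV P l (w t)))
      \<in> borel_measurable (lborel \<Otimes>\<^sub>M lborel)"
    by measurable
  show "norm (e l * (Gamma (- w t) * J t * exp (w t * of_real c) * mellinV P l (w t))) \<le> ?p l * ?q t" for l t
  proof -
    have "norm (J t) * exp (\<sigma> * c) * norm (mellinV P l (w t)) \<le> ?K * exp (\<sigma> * c) * (exp (2 * l * \<sigma>) * Gamma (- \<sigma>))"
      using norm_mellinV_le[of "w t" P l] \<sigma> norm_J_le[of t]
      by (intro mult_mono) (auto simp: Re_w)
    then have "exp (Re s * l - P * exp l) * norm (Gamma (- w t)) * (norm (J t) * exp (\<sigma> * c) * norm (mellinV P l (w t)))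
      \<le> exp (Re s * l - P * exp l) * norm (Gamma (- w t)) * (?K * exp (\<sigma> * c) * (exp (2 * l * \<sigma>) * Gamma (- \<sigma>)))"
      by (intro mult_left_mono) auto
    also have "\<dots> = ?p l * ?q t"
    proof -
      have "?p l = exp (Re s * l - P * exp l) * exp (2 * l * \<sigma>)"
        unfolding exp_add[symmetric] by (simp add: algebra_simps)
      then show ?thesis by (simp only: mult_ac)
    qed
    also have "exp (Re s * l - P * exp l) * norm (Gamma (- w t)) * (norm (J t) * exp (\<sigma> * c) * norm (mellinV P l (w t))) =
       norm (e l * (Gamma (- w t) * J t * exp (w t * of_real c) * mellinV P l (w t)))"
    proof -
      have "norm (e l) = exp (Re s * l - P * exp l)" "norm (exp (w t * of_real c)) = exp (\<sigma> * c)"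
        by (simp_all add: Re_w)
      then show ?thesis by (simp only: norm_mult mult_ac)
    qed
    finally show ?thesis .
  qed
  show "integrable lborel ?p"
    using sw P by (intro integrable_Gamma_exp_scaled_real)
  show "integrable lborel ?q"
    using integrable_Gamma_w by (intro integrable_mult_left integrable_norm)
qed

private lemma mellin_inner:
  "(LINT l|lborel. e l * (Gamma (- w t) * J t * exp (w t * of_real (2 * ln pi + c)) * mellinV P l (w t))) =
    2 * Gamma s * exp (- s * of_real (ln (2 * pi * of_int h))) *
      (barnes_kernel h s (w t) * calF r a (- 2 * w t) * exp (w t * of_real c))"
proof -
  have "(LINT l|lborel. e l * (Gamma (- w t) * J t * exp (w t * of_real (2 * ln pi + c)) * mellinV P l (w t))) =
     (LINT l|lborel. (Gamma (- w t) * J t * exp (w t * of_real (2 * ln pi)) * exp (w t * of_real c)) * (e l * mellinV P l (w t)))"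
    by (intro Bochner_Integration.integral_cong refl) (simp add: exp_add algebra_simps)
  also have "\<dots> = (Gamma (- w t) * J t * exp (w t * of_real (2 * ln pi)) * E t) * exp (w t * of_real c)"
    by (subst integral_mult_right_zero) (simp only: mult_ac)
  also have "\<dots> = 2 * Gamma s * exp (- s * of_real (ln (2 * pi * of_int h))) *
      (barnes_kernel h s (w t) * calF r a (- 2 * w t) * exp (w t * of_real c))"
  proof -
    have re: "Re (s + 2 * w t) > 0" using sw by (simp add: Re_w)
    show ?thesis
      unfolding barnes_kernel_mellinV[OF h s re, folded P_def] P_def[symmetric] by (simp only: mult_ac)
  qed
  finally show ?thesis .
qed

text \<open>Up to the nonzero constant \<open>?C\<close> this is the marginal in t of the integrable
  function of (l, t) above, so Fubini provides its integrability.\<close>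

lemma integrable_barnes_kernel_calF:
  "integrable lborel (\<lambda>t. barnes_kernel h s (w t) * calF r a (- 2 * w t))"
proof -
  let ?C = "2 * Gamma s * exp (- s * of_real (ln (2 * pi * of_int h)))"
  let ?f = "\<lambda>t. barnes_kernel h s (w t) * calF r a (- 2 * w t)"
  have nz: "?C \<noteq> 0"
    using s not_nonpos_Int_Re[OF s] by (simp add: Gamma_eq_zero_iff)
  have "integrable lborel (\<lambda>t. ?C * (?f t * exp (w t * of_real 0)))"
    using lborel_pair.integrable_snd[OF integrable_mellin_fubini[of "2 * ln pi + 0"]]
    unfolding mellin_inner .
  then have "integrable lborel (\<lambda>t. inverse ?C * (?C * (?f t * exp (w t * of_real 0))))"
    by (rule integrable_mult_right)
  then show ?thesis
    unfolding mult.assoc[of "inverse ?C" ?C, symmetric] left_inverse[OF nz] by simp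
qed

lemma bessel_product_mellin_barnes:
  assumes p: "p > 0" and q: "q > 0" and rel: "p\<^sup>2 + q\<^sup>2 = (of_int h)\<^sup>2 + (2 * a - 2) * (p * q)"
  shows "(LINT l|lborel. exp (s * of_real l - of_real (2 * pi * of_int h * exp l)) *
      (bessel_K (\<i> * of_real r) (2 * pi * p * exp l) * bessel_K (\<i> * of_real r) (2 * pi * q * exp l))) =
    Gamma s / (2 * of_real (2 * pi * of_int h) powr s) *
     ((LINT t|lborel. barnes_kernel h s (w t) * calF r a (- 2 * w t) * of_real (p * q) powr w t) / (2 * pi))"
proof -
  let ?\<alpha> = "2 * pi * p" and ?\<beta> = "2 * pi * q"
  have rel': "?\<alpha>\<^sup>2 + ?\<beta>\<^sup>2 = P\<^sup>2 + (2 * a - 2) * (?\<alpha> * ?\<beta>)"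
  proof -
    have "?\<alpha>\<^sup>2 + ?\<beta>\<^sup>2 = (2 * pi)\<^sup>2 * (p\<^sup>2 + q\<^sup>2)" by (simp add: power_mult_distrib algebra_simps)
    then show ?thesis unfolding rel by (simp add: P_def power2_eq_square algebra_simps)
  qed
  have ln: "ln (?\<alpha> * ?\<beta> / 4) = 2 * ln pi + ln (p * q)"
  proof -
    have "?\<alpha> * ?\<beta> / 4 = pi\<^sup>2 * (p * q)" by (simp add: power2_eq_square)
    then show ?thesis using p q by (simp add: ln_mult ln_realpow)
  qed
  have pq: "of_real (p * q) powr w t = exp (w t * of_real (ln (p * q)))" for t
    using p q by (intro of_real_powr_eq_exp) auto
  have hs: "of_real (2 * pi * of_int h) powr s = exp (s * of_real (ln (2 * pi * of_int h)))"
    using h by (intro of_real_powr_eq_exp) auto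
  have "(LINT l|lborel. exp (s * of_real l - of_real (2 * pi * of_int h * exp l)) *
      (bessel_K (\<i> * of_real r) (?\<alpha> * exp l) * bessel_K (\<i> * of_real r) (?\<beta> * exp l))) =
    (LINT l|lborel. (LINT t|lborel. e l * (Gamma (- w t) * J t * exp (w t * of_real (2 * ln pi + ln (p * q))) * mellinV P l (w t))) / (8 * pi))"
  proof (intro Bochner_Integration.integral_cong refl)
    fix l
    \<comment> \<open>The divisor 8 pi is 2 pi from Mellin inversion times 4 from the two factors
      \<open>macK\<close>, each twice a Bessel function.\<close>
    have "bessel_K (\<i> * of_real r) (?\<alpha> * exp l) * bessel_K (\<i> * of_real r) (?\<beta> * exp l) =
       (LINT t|lborel. Gamma (- w t) * J t * exp (w t * of_real (2 * ln pi + ln (p * q))) * mellinV P l (w t)) / (2 * pi) / 4"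
      using macK_mult_mellin[OF \<sigma> a int _ _ rel', of r l] p q
      unfolding bessel_K_eq ln w_def by simp
    then show "exp (s * of_real l - of_real (2 * pi * of_int h * exp l)) *
      (bessel_K (\<i> * of_real r) (?\<alpha> * exp l) * bessel_K (\<i> * of_real r) (?\<beta> * exp l)) =
      (LINT t|lborel. e l * (Gamma (- w t) * J t * exp (w t * of_real (2 * ln pi + ln (p * q))) * mellinV P l (w t))) / (8 * pi)"
      unfolding integral_mult_right_zero P_def by simp
  qed
  also have "\<dots> = (LINT l|lborel. (LINT t|lborel. e l * (Gamma (- w t) * J t * exp (w t * of_real (2 * ln pi + ln (p * q))) * mellinV P l (w t)))) / (8 * pi)"
    by (rule integral_divide_zero)
  also have "(LINT l|lborel. (LINT t|lborel. e l * (Gamma (- w t) * J t * exp (w t * of_real (2 * ln pi + ln (p * q))) * mellinV P l (w t)))) =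
     (LINT t|lborel. (LINT l|lborel. e l * (Gamma (- w t) * J t * exp (w t * of_real (2 * ln pi + ln (p * q))) * mellinV P l (w t))))"
    by (rule lborel_pair.Fubini_integral[OF integrable_mellin_fubini, symmetric])
  also have "\<dots> = 2 * Gamma s * exp (- s * of_real (ln (2 * pi * of_int h))) *
     (LINT t|lborel. barnes_kernel h s (w t) * calF r a (- 2 * w t) * exp (w t * of_real (ln (p * q))))"
    unfolding mellin_inner by (rule integral_mult_right_zero)
  finally show ?thesis
    unfolding pq hs by (simp add: exp_minus field_simps)
qed

end

section \<open>Size of the Bessel function\<close>

text \<open>Because cosh x >= 1, the surplus A - A0 comes out of the integral as exp(A0 - A), while
  A0 keeps the integral finite.\<close>

lemma norm_bessel_K_le:
  assumes A0: "A0 > 0"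
  shows "\<exists>C\<ge>0. \<forall>A\<ge>A0. norm (bessel_K (\<i> * of_real r) A) \<le> C * exp (- A)"
proof (intro exI conjI allI impI)
  let ?I = "LINT x|lborel. exp (- (A0 * cosh x))"
  show "0 \<le> exp A0 * ?I / 2" by (intro divide_nonneg_pos mult_nonneg_nonneg Bochner_Integration.integral_nonneg) auto
  fix A assume A: "A0 \<le> A"
  have "norm (macK r A) \<le> (LINT x|lborel. exp (A0 - A) * exp (- (A0 * cosh x)))"
    unfolding macK_def
  proof (rule Bochner_Integration.integral_norm_bound_integral)
    show "norm (exp (\<i> * of_real (r * x) - of_real (A * cosh x))) \<le> exp (A0 - A) * exp (- (A0 * cosh x))" for x
    proof -
      have "(A - A0) * 1 \<le> (A - A0) * cosh x"
        using A by (intro mult_left_mono cosh_real_ge_1) auto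
      then show ?thesis by (simp add: algebra_simps flip: exp_add)
    qed
    show "integrable lborel (\<lambda>x. exp (\<i> * of_real (r * x) - of_real (A * cosh x)))"
      using A A0 by (intro integrable_macK) auto
  qed (use A0 in \<open>auto intro!: integrable_mult_right integrable_exp_cosh\<close>)
  then have "norm (macK r A) \<le> exp (A0 - A) * ?I"
    by (simp only: integral_mult_right_zero)
  also have "exp (A0 - A) = exp A0 * exp (- A)"
    by (simp flip: exp_add)
  finally show "norm (bessel_K (\<i> * of_real r) A) \<le> exp A0 * ?I / 2 * exp (- A)"
    by (simp add: bessel_K_eq norm_divide mult_ac)
qed

lemma cosh_mono_abs: "\<bar>x\<bar> \<le> \<bar>y\<bar> \<Longrightarrow> cosh x \<le> cosh (y :: real)"
  using cosh_real_nonneg_le_iff[of "\<bar>x\<bar>" "\<bar>y\<bar>"] by simp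

text \<open>The real part of the integrand is cos(r x) exp(-A cosh x), and the cosine is at least
  1/2 for |x| <= t. Only |x| <= t/2 is counted, the zone up to t is nonnegative and dropped, and
  beyond t the loss is estimated by taking exp(-(A-1) cosh t) out.\<close>

lemma Re_macK_ge:
  fixes r t A :: real
  assumes t: "t > 0" "\<bar>r\<bar> * t \<le> pi / 3" and A: "A \<ge> 1"
  shows "t / 2 * exp (- (A * cosh (t / 2))) - exp (- ((A - 1) * cosh t)) * (LINT x|lborel. exp (- (1 * cosh x)))
     \<le> Re (macK r A)"
proof -
  let ?f = "\<lambda>x. 1 / 2 * exp (- (A * cosh (t / 2))) * indicator {- t / 2..t / 2} x
      - exp (- ((A - 1) * cosh t)) * exp (- (1 * cosh x))"
  let ?g = "\<lambda>x. exp (\<i> * of_real (r * x) - of_real (A * cosh x))"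
  have g: "integrable lborel ?g" using A by (intro integrable_macK) auto
  have cosh1: "integrable lborel (\<lambda>x. exp (- (1 * cosh x :: real)))"
    by (rule integrable_exp_cosh) simp
  have Re_g: "Re (?g x) = cos (r * x) * exp (- (A * cosh x))" for x
    by (simp add: Re_exp mult.commute)
  have ind: "integrable lborel (indicator {- t / 2..t / 2} :: real \<Rightarrow> real)"
    by (subst integrable_indicator_iff) (auto simp: emeasure_lborel_Icc_eq)
  have "(LINT x|lborel. ?f x) \<le> (LINT x|lborel. Re (?g x))"
  proof (rule integral_mono)
    show "integrable lborel ?f"
      using ind cosh1 by (intro Bochner_Integration.integrable_diff integrable_mult_right)
    show "integrable lborel (\<lambda>x. Re (?g x))" using g by (rule integrable_Re)
    fix x :: real
    have cos_ge: "1 / 2 \<le> cos (r * x)" if "\<bar>x\<bar> \<le> t"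
    proof -
      have "\<bar>r * x\<bar> \<le> \<bar>r\<bar> * t" using that by (simp add: abs_mult mult_left_mono)
      then have "\<bar>r * x\<bar> \<le> pi / 3" using t(2) by linarith
      then have "cos (pi / 3) \<le> cos \<bar>r * x\<bar>"
        using pi_gt_zero by (intro cos_monotone_0_pi_le) auto
      then show ?thesis by (simp add: cos_60)
    qed
    consider "\<bar>x\<bar> \<le> t / 2" | "t / 2 < \<bar>x\<bar>" "\<bar>x\<bar> \<le> t" | "\<bar>x\<bar> > t" by linarith
    then show "?f x \<le> Re (?g x)"
    proof cases
      case 1
      have "1 / 2 * exp (- (A * cosh (t / 2))) \<le> cos (r * x) * exp (- (A * cosh x))"
        using cos_ge 1 t A cosh_mono_abs[of x "t / 2"] by (intro mult_mono) auto
      moreover have "indicator {- t / 2..t / 2} x = (1 :: real)" using 1 by (auto simp: indicator_def)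
      moreover have "0 \<le> exp (- ((A - 1) * cosh t)) * exp (- (1 * cosh x))" by simp
      ultimately show ?thesis unfolding Re_g by (simp only:)
    next
      case 2
      then have "0 \<le> cos (r * x) * exp (- (A * cosh x))" using cos_ge by simp
      moreover have "indicator {- t / 2..t / 2} x = (0 :: real)" using 2 by (auto simp: indicator_def)
      moreover have "0 \<le> exp (- ((A - 1) * cosh t)) * exp (- (1 * cosh x))" by simp
      ultimately show ?thesis unfolding Re_g by (simp only:)
    next
      case 3
      have "(A - 1) * cosh t \<le> (A - 1) * cosh x"
        using cosh_mono_abs[of t x] 3 t A by (intro mult_left_mono) auto
      then have "exp (- (A * cosh x)) \<le> exp (- ((A - 1) * cosh t)) * exp (- (1 * cosh x))"
        by (simp add: algebra_simps flip: exp_add)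
      moreover have "- 1 * exp (- (A * cosh x)) \<le> cos (r * x) * exp (- (A * cosh x))"
        by (intro mult_right_mono) auto
      moreover have "indicator {- t / 2..t / 2} x = (0 :: real)" using 3 t by (auto simp: indicator_def)
      ultimately show ?thesis unfolding Re_g by simp
    qed
  qed
  also have "(LINT x|lborel. Re (?g x)) = Re (macK r A)"
    unfolding macK_def by (rule integral_Re[OF g])
  also have "(LINT x|lborel. ?f x) = t / 2 * exp (- (A * cosh (t / 2)))
      - exp (- ((A - 1) * cosh t)) * (LINT x|lborel. exp (- (1 * cosh x)))"
    using t ind cosh1 by (subst Bochner_Integration.integral_diff) auto
  finally show ?thesis .
qed

text \<open>Used to read off \<open>c m\<close> from a Fourier coefficient of \<phi>. For r nonzero
  K_ir oscillates near 0, so only large A can be covered. The rate 2 comes from choosing t with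
  cosh(t/2) < 2.\<close>

lemma norm_bessel_K_ge:
  fixes r :: real
  shows "\<exists>A1 c. c > 0 \<and> (\<forall>A\<ge>A1. c * exp (- 2 * A) \<le> norm (bessel_K (\<i> * of_real r) A))"
proof -
  have "((\<lambda>t. cosh (t / 2) :: real) \<longlongrightarrow> cosh (0 / 2)) (at_right 0)"
    by (intro tendsto_intros) auto
  then have ev1: "\<forall>\<^sub>F t in at_right 0. cosh (t / 2 :: real) < 2"
    by (rule order_tendstoD) auto
  have "((\<lambda>t. \<bar>r\<bar> * t) \<longlongrightarrow> \<bar>r\<bar> * 0) (at_right 0)" by (intro tendsto_intros)
  then have ev2: "\<forall>\<^sub>F t in at_right 0. \<bar>r\<bar> * t < pi / 3"
    by (rule order_tendstoD) auto
  have "\<forall>\<^sub>F t in at_right (0 :: real). t > 0" by (simp add: eventually_at_right_less)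
  with ev1 ev2 have "\<forall>\<^sub>F t in at_right (0 :: real). t > 0 \<and> \<bar>r\<bar> * t < pi / 3 \<and> cosh (t / 2) < 2"
    by eventually_elim auto
  then obtain t where t: "t > 0" "\<bar>r\<bar> * t < pi / 3" "cosh (t / 2) < 2"
    using eventually_happens'[OF trivial_limit_at_right_real] by blast
  define I where "I = (LINT x|lborel. exp (- (1 * cosh x :: real)))"
  have I: "I \<ge> 0" unfolding I_def by (intro Bochner_Integration.integral_nonneg) auto
  define d where "d = cosh t - cosh (t / 2)"
  have d: "d > 0" using t cosh_real_nonneg_less_iff[of "t / 2" t] by (simp add: d_def)
  \<comment> \<open>From A1 on the tail is at most half of the main term: 4 I exp(cosh t) <= t A d
    <= t exp(A d), where d is the gap between the two values of cosh.\<close>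
  define A1 where "A1 = max 1 (4 * I * exp (cosh t) / (t * d))"
  show ?thesis
  proof (intro exI conjI allI impI)
    show "t / 8 > 0" using t by simp
    fix A assume A: "A1 \<le> A"
    have "4 * I * exp (cosh t) \<le> t * (A * d)"
      using A t d by (simp add: A1_def field_simps)
    also have "\<dots> \<le> t * exp (A * d)"
    proof (rule mult_left_mono)
      show "A * d \<le> exp (A * d)" using exp_ge_add_one_self[of "A * d"] by linarith
    qed (use t in simp)
    finally have "4 * I * exp (cosh t) * exp (- (A * cosh t)) \<le> t * exp (A * d) * exp (- (A * cosh t))"
      by (intro mult_right_mono) auto
    then have "4 * I * (exp (cosh t) * exp (- (A * cosh t))) \<le> t * (exp (A * d) * exp (- (A * cosh t)))"
      by (simp only: mult.assoc)
    moreover have "exp (cosh t) * exp (- (A * cosh t)) = exp (- ((A - 1) * cosh t))"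
      by (simp add: algebra_simps flip: exp_add)
    moreover have "exp (A * d) * exp (- (A * cosh t)) = exp (- (A * cosh (t / 2)))"
      by (simp add: d_def algebra_simps flip: exp_add)
    ultimately have "exp (- ((A - 1) * cosh t)) * I \<le> t / 4 * exp (- (A * cosh (t / 2)))"
      by (simp add: algebra_simps)
    moreover have "t / 2 * exp (- (A * cosh (t / 2))) - exp (- ((A - 1) * cosh t)) * I \<le> Re (macK r A)"
      unfolding I_def using t A by (intro Re_macK_ge) (auto simp: A1_def)
    ultimately have "t / 4 * exp (- (A * cosh (t / 2))) \<le> Re (macK r A)" by simp
    moreover have "exp (- 2 * A) \<le> exp (- (A * cosh (t / 2)))"
      using t A by (auto simp: A1_def)
    ultimately have "t / 4 * exp (- 2 * A) \<le> Re (macK r A)"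
      using t by (meson mult_left_mono order_trans less_imp_le zero_less_divide_iff zero_less_numeral)
    also have "\<dots> \<le> norm (macK r A)" by (rule complex_Re_le_cmod)
    finally show "t / 8 * exp (- 2 * A) \<le> norm (bessel_K (\<i> * of_real r) A)"
      by (simp add: bessel_K_eq norm_divide)
  qed
qed

section \<open>Fourier coefficients\<close>

text \<open>The m-th Fourier coefficient of \<phi> along the horizontal line at height y.\<close>

definition whitt :: "real \<Rightarrow> (int \<Rightarrow> complex) \<Rightarrow> real \<Rightarrow> int \<Rightarrow> complex" where
  "whitt r c y m = c m * of_real (sqrt y) * bessel_K (\<i> * of_real r) (2 * pi * \<bar>of_int m\<bar> * y)"

lemma fourier_has_sum:
  assumes "has_fourier_expansion \<phi> r c" "y > 0"
  shows "((\<lambda>m. whitt r c y m * exp (2 * of_real pi * \<i> * of_int m * of_real x)) has_sum \<phi> (Complex x y)) (- {0})"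
proof -
  have "Complex x y \<in> upper_half_plane" using assms(2) by (simp add: upper_half_plane_def)
  then have "((\<lambda>m. c m * of_real (sqrt (Im (Complex x y))) * bessel_K (\<i> * of_real r) (2 * pi * \<bar>of_int m\<bar> * Im (Complex x y))
      * exp (2 * of_real pi * \<i> * of_int m * of_real (Re (Complex x y)))) has_sum \<phi> (Complex x y)) (- {0})"
    using assms(1) unfolding has_fourier_expansion_def by blast
  then show ?thesis by (simp add: whitt_def)
qed

text \<open>At x = 0 all characters equal 1, and an unconditionally convergent complex family
  converges absolutely.\<close>

lemma whitt_abs_summable:
  assumes "has_fourier_expansion \<phi> r c" "y > 0"
  shows "(\<lambda>m. norm (whitt r c y m)) summable_on (- {0})"
  using has_sum_imp_summable[OF fourier_has_sum[OF assms, of 0]]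
  unfolding summable_on_iff_abs_summable_on_complex by simp

text \<open>At height 1/4 the Bessel argument is pi |m| / 2, so the lower bound with rate 2 costs
  exp(pi |m|). This growth is slower than the decay exp(-2 pi |m| y) for y >= 4/5, which is why that
  height is chosen.\<close>

lemma fourier_coeff_bound:
  assumes "has_fourier_expansion \<phi> r c"
  shows "\<exists>C. \<forall>m. m \<noteq> 0 \<longrightarrow> norm (c m) \<le> C * exp (pi * \<bar>of_int m\<bar>)"
proof -
  obtain A1 c0 where c0: "c0 > 0" and low: "\<And>A. A \<ge> A1 \<Longrightarrow> c0 * exp (- 2 * A) \<le> norm (bessel_K (\<i> * of_real r) A)"
    using norm_bessel_K_ge by blast
  define S where "S = infsum (\<lambda>m. norm (whitt r c (1 / 4) m)) (- {0})"
  have S: "norm (whitt r c (1 / 4) m) \<le> S" if "m \<noteq> 0" for m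
    unfolding S_def
    using finite_sum_le_infsum[OF whitt_abs_summable[OF assms, of "1 / 4"], of "{m}"] that by simp
  \<comment> \<open>The finitely many m whose Bessel argument is too small for the lower bound;
    their coefficients enter C directly.\<close>
  define F where "F = {m :: int. of_int \<bar>m\<bar> * (pi / 2) < A1}"
  have finF: "finite F"
  proof (rule finite_subset)
    show "F \<subseteq> {- \<lceil>\<bar>A1\<bar>\<rceil>..\<lceil>\<bar>A1\<bar>\<rceil>}"
    proof
      fix m assume "m \<in> F"
      then have "of_int \<bar>m\<bar> * (pi / 2) < A1" by (simp add: F_def)
      moreover have "of_int \<bar>m\<bar> * 1 \<le> of_int \<bar>m\<bar> * (pi / 2)"
        using pi_gt3 by (intro mult_left_mono) auto
      ultimately have "of_int \<bar>m\<bar> \<le> \<bar>A1\<bar>" by linarith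
      then have "\<bar>m\<bar> \<le> \<lceil>\<bar>A1\<bar>\<rceil>" by linarith
      then show "m \<in> {- \<lceil>\<bar>A1\<bar>\<rceil>..\<lceil>\<bar>A1\<bar>\<rceil>}" by auto
    qed
  qed simp
  define C where "C = (\<Sum>m\<in>F. norm (c m)) + 2 * S / c0"
  have S0: "S \<ge> 0" using order.trans[OF norm_ge_zero S[of 1]] by simp
  have "norm (c m) \<le> C * exp (pi * \<bar>of_int m\<bar>)" if m: "m \<noteq> 0" for m
  proof (cases "m \<in> F")
    case True
    then have "norm (c m) \<le> (\<Sum>m\<in>F. norm (c m))" using finF by (intro member_le_sum) auto
    also have "\<dots> \<le> C" using S0 c0 by (simp add: C_def)
    also have "C \<le> C * exp (pi * \<bar>of_int m\<bar>)"
    proof -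
      have "C * 1 \<le> C * exp (pi * \<bar>of_int m\<bar>)"
        using S0 c0 by (intro mult_left_mono) (auto simp: C_def intro!: add_nonneg_nonneg sum_nonneg)
      then show ?thesis by simp
    qed
    finally show ?thesis .
  next
    case False
    then have "c0 * exp (- 2 * (2 * pi * \<bar>of_int m\<bar> * (1 / 4))) \<le> norm (bessel_K (\<i> * of_real r) (2 * pi * \<bar>of_int m\<bar> * (1 / 4)))"
      by (intro low) (simp add: F_def field_simps)
    then have "norm (c m) * (1 / 2) * (c0 * exp (- (pi * \<bar>of_int m\<bar>))) \<le> norm (c m) * (1 / 2) * norm (bessel_K (\<i> * of_real r) (2 * pi * \<bar>of_int m\<bar> * (1 / 4)))"
      by (intro mult_left_mono) auto
    also have "\<dots> = norm (whitt r c (1 / 4) m)"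
      by (simp add: whitt_def norm_mult real_sqrt_divide)
    also have "\<dots> \<le> S" by (rule S[OF m])
    finally have "norm (c m) \<le> 2 * S / c0 * exp (pi * \<bar>of_int m\<bar>)"
      using c0 by (simp add: exp_minus field_simps)
    also have "\<dots> \<le> C * exp (pi * \<bar>of_int m\<bar>)"
      by (intro mult_right_mono) (auto simp: C_def intro!: sum_nonneg)
    finally show ?thesis .
  qed
  then show ?thesis by blast
qed

lemma summable_on_exp_abs_int: "(\<lambda>m. exp (- \<bar>of_int m :: real\<bar>)) summable_on (UNIV :: int set)"
proof -
  have "summable (\<lambda>n. exp (- 1 :: real) ^ n)" by (rule summable_geometric) simp
  then have *: "(\<lambda>n. exp (- real n)) summable_on (UNIV :: nat set)"
    by (intro norm_summable_imp_summable_on) (simp add: exp_of_nat_mult[symmetric])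
  have 1: "(\<lambda>m. exp (- \<bar>of_int m :: real\<bar>)) summable_on (range int)"
    by (subst summable_on_reindex) (use * in \<open>auto simp: o_def\<close>)
  have 2: "(\<lambda>m. exp (- \<bar>of_int m :: real\<bar>)) summable_on (range (\<lambda>n. - int n))"
    by (subst summable_on_reindex) (use * in \<open>auto simp: o_def inj_on_def\<close>)
  have "UNIV = range int \<union> range (\<lambda>n. - int n)"
    using int_cases2 by blast
  then show ?thesis using summable_on_union[OF 1 2] by simp
qed

text \<open>The height 4/5 lies below sqrt 3 / 2, the lowest height in the fundamental domain. There
  the Bessel decay beats the growth of c, and each term is dominated by a multiple of exp(-|m|)
  uniformly in y.\<close>

lemma fourier_bounded_high:
  assumes "has_fourier_expansion \<phi> r c"
  shows "\<exists>B. \<forall>z. Im z \<ge> 4 / 5 \<longrightarrow> norm (\<phi> z) \<le> B"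
proof -
  obtain C where C: "\<And>m. m \<noteq> 0 \<Longrightarrow> norm (c m) \<le> C * exp (pi * \<bar>of_int m\<bar>)"
    using fourier_coeff_bound[OF assms] by blast
  obtain D where D: "D \<ge> 0" "\<And>A. A \<ge> 1 \<Longrightarrow> norm (bessel_K (\<i> * of_real r) A) \<le> D * exp (- A)"
    using norm_bessel_K_le[of 1 r] by auto
  have C0: "C \<ge> 0"
    using order.trans[OF norm_ge_zero C[of 1]] by (simp add: zero_le_mult_iff)
  have "norm (\<phi> z) \<le> infsum (\<lambda>m. C * D * exp (- \<bar>of_int m\<bar>)) (- {0})" if z: "Im z \<ge> 4 / 5" for z
  proof -
    define y where "y = Im z"
    have y: "y \<ge> 4 / 5" using z by (simp add: y_def)
    have hs: "((\<lambda>m. whitt r c y m * exp (2 * of_real pi * \<i> * of_int m * of_real (Re z))) has_sum \<phi> z) (- {0})"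
      using fourier_has_sum[OF assms, of y "Re z"] y by (simp add: y_def)
    have sm: "(\<lambda>m. C * D * exp (- \<bar>of_int m :: real\<bar>)) summable_on (- {0 :: int})"
      by (intro summable_on_cmult_right summable_on_subset[OF summable_on_exp_abs_int]) auto
    show ?thesis
    proof (rule norm_infsum_le[OF hs has_sum_infsum[OF sm]])
      fix m :: int assume "m \<in> - {0}"
      then have m: "m \<noteq> 0" by simp
      define k where "k = \<bar>real_of_int m\<bar>"
      have k: "k \<ge> 1" using m unfolding k_def by linarith
      \<comment> \<open>Multiplied by k >= 1 this absorbs the growth exp(pi k), the factor exp y
        standing for sqrt y, and the desired decay exp(-k). It holds with little to spare at y =
        4/5.\<close>
      have pos: "2 * pi * y - pi - 1 \<ge> y"
      proof -
        have "(2 * pi - 1) * (4 / 5) \<le> (2 * pi - 1) * y" using y pi_gt3 by (intro mult_left_mono) auto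
        then show ?thesis using pi_gt3 unfolding left_diff_distrib by linarith
      qed
      have "1 * (2 * pi * y - pi - 1) \<le> k * (2 * pi * y - pi - 1)"
        using k pos y by (intro mult_right_mono) auto
      then have ex: "pi * k + y - 2 * pi * k * y \<le> - k" using pos by (simp add: algebra_simps)
      have "1 * 1 \<le> 2 * pi * k * y"
      proof -
        have "1 * (4 / 5) \<le> k * y" using k y by (intro mult_mono) auto
        then have "6 * (4 / 5) \<le> 2 * pi * (k * y)" using pi_gt3 by (intro mult_mono) auto
        then show ?thesis by (simp add: mult.assoc)
      qed
      then have K: "norm (bessel_K (\<i> * of_real r) (2 * pi * \<bar>of_int m\<bar> * y)) \<le> D * exp (- (2 * pi * k * y))"
        unfolding k_def by (intro D) simp
      have sq: "sqrt y \<le> exp y"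
      proof (rule real_le_lsqrt)
        have "y \<le> exp y" using exp_ge_add_one_self[of y] by linarith
        also have "exp y * 1 \<le> exp y * exp y" using y by (intro mult_left_mono) auto
        finally show "y \<le> (exp y)\<^sup>2" by (simp add: power2_eq_square)
      qed simp
      have "norm (whitt r c y m * exp (2 * of_real pi * \<i> * of_int m * of_real (Re z))) =
          norm (c m) * sqrt y * norm (bessel_K (\<i> * of_real r) (2 * pi * \<bar>of_int m\<bar> * y))"
        using y by (simp add: whitt_def norm_mult)
      also have "\<dots> \<le> (C * exp (pi * k)) * exp y * (D * exp (- (2 * pi * k * y)))"
        using C[OF m] sq K y C0 unfolding k_def by (intro mult_mono mult_nonneg_nonneg) auto
      also have "\<dots> = C * D * exp (pi * k + y - 2 * pi * k * y)"
        by (simp add: exp_add exp_diff exp_minus field_simps)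
      also have "\<dots> \<le> C * D * exp (- \<bar>of_int m\<bar>)"
        using ex C0 D(1) unfolding k_def by (intro mult_left_mono) auto
      finally show "norm (whitt r c y m * exp (2 * of_real pi * \<i> * of_int m * of_real (Re z))) \<le> C * D * exp (- \<bar>of_int m\<bar>)" .
    qed
  qed
  then show ?thesis by blast
qed

section \<open>The modular group\<close>

lemma matrix_2_eq_iff: "A = B \<longleftrightarrow> A$1$1 = B$1$1 \<and> A$1$2 = B$1$2 \<and> A$2$1 = B$2$1 \<and> A$2$2 = B$2$2"
  for A B :: "int^2^2"
  by (auto simp: vec_eq_iff forall_2)

lemma matrix_mult_2:
  fixes A B :: "int^2^2"
  shows "(A ** B)$i$j = A$i$1 * B$1$j + A$i$2 * B$2$j"
  by (simp add: matrix_matrix_mult_def sum_2)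

lemma SL2Z_iff: "A \<in> SL2Z \<longleftrightarrow> A$1$1 * A$2$2 - A$1$2 * A$2$1 = 1"
  by (simp add: SL2Z_def det_2)

lemma SL2Z_mult: "A \<in> SL2Z \<Longrightarrow> B \<in> SL2Z \<Longrightarrow> A ** B \<in> SL2Z"
  by (simp add: SL2Z_def det_mul)

lemma SL2Z_uminus: "- A \<in> SL2Z \<longleftrightarrow> A \<in> SL2Z"
  by (simp add: SL2Z_iff)

text \<open>The adjugate: inverse in determinant 1, with visibly integral entries.\<close>

definition sl2_inv :: "int^2^2 \<Rightarrow> int^2^2" where
  "sl2_inv A = vector [vector [A$2$2, - A$1$2], vector [- A$2$1, A$1$1]]"

lemma sl2_inv_nth [simp]:
  "sl2_inv A $1$1 = A$2$2" "sl2_inv A $1$2 = - A$1$2" "sl2_inv A $2$1 = - A$2$1" "sl2_inv A $2$2 = A$1$1"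
  by (simp_all add: sl2_inv_def)

lemma SL2Z_inv: "A \<in> SL2Z \<Longrightarrow> sl2_inv A \<in> SL2Z"
  by (simp add: SL2Z_iff algebra_simps)

definition transl :: "int \<Rightarrow> int^2^2" where
  "transl m = vector [vector [1, m], vector [0, 1]]"

lemma transl_nth [simp]: "transl m $1$1 = 1" "transl m $1$2 = m" "transl m $2$1 = 0" "transl m $2$2 = 1"
  by (simp_all add: transl_def)

lemma Gamma_inf_eq: "Gamma_inf = range transl"
  by (auto simp: Gamma_inf_def transl_def)

lemma transl_SL2Z: "transl m \<in> SL2Z"
  by (simp add: SL2Z_iff)

lemma act_eq: "act A z = (of_int (A$1$1) * z + of_int (A$1$2)) / (of_int (A$2$1) * z + of_int (A$2$2))"
  by (simp add: act_def moebius_def)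

lemma act_denom_nonzero:
  assumes "A \<in> SL2Z" "Im z > 0"
  shows "of_int (A$2$1) * z + of_int (A$2$2) \<noteq> 0"
proof
  assume *: "of_int (A$2$1) * z + of_int (A$2$2) = 0"
  moreover have "Im (of_int (A$2$1) * z + of_int (A$2$2)) = of_int (A$2$1) * Im z" by simp
  ultimately have "of_int (A$2$1) * Im z = 0" by (simp only: zero_complex.sel)
  then have "A$2$1 = 0" using assms(2) by simp
  moreover from this * have "A$2$2 = 0" by simp
  ultimately show False using assms(1) by (simp add: SL2Z_iff)
qed

lemma Im_act:
  assumes "A \<in> SL2Z" "Im z > 0"
  shows "Im (act A z) = Im z / (norm (of_int (A$2$1) * z + of_int (A$2$2)))\<^sup>2"
proof -
  define a b c d where "a = real_of_int (A$1$1)" "b = real_of_int (A$1$2)" "c = real_of_int (A$2$1)" "d = real_of_int (A$2$2)"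
  have det: "a * d - b * c = 1"
    using assms(1) unfolding SL2Z_iff a_b_c_d_def by (simp flip: of_int_mult of_int_diff)
  have "act A z = (of_real a * z + of_real b) / (of_real c * z + of_real d)"
    by (simp add: act_eq a_b_c_d_def)
  then have "Im (act A z) = (a * Im z * (c * Re z + d) - (a * Re z + b) * (c * Im z)) / (norm (of_real c * z + of_real d))\<^sup>2"
    by (simp add: Im_divide cmod_power2)
  also have "a * Im z * (c * Re z + d) - (a * Re z + b) * (c * Im z) = (a * d - b * c) * Im z"
    by (simp add: algebra_simps)
  finally show ?thesis unfolding det by (simp add: a_b_c_d_def)
qed

lemma Im_act_pos:
  assumes "A \<in> SL2Z" "Im z > 0"
  shows "Im (act A z) > 0"
  using act_denom_nonzero[OF assms] assms(2) by (simp add: Im_act[OF assms])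

lemma act_mult:
  assumes "A \<in> SL2Z" "B \<in> SL2Z" "Im z > 0"
  shows "act (A ** B) z = act A (act B z)"
proof -
  have nz: "of_int (B$2$1) * z + of_int (B$2$2) \<noteq> 0" "of_int ((A ** B)$2$1) * z + of_int ((A ** B)$2$2) \<noteq> 0"
    using act_denom_nonzero[OF assms(2,3)] act_denom_nonzero[OF SL2Z_mult[OF assms(1,2)] assms(3)] by blast+
  let ?q = "of_int (B$2$1) * z + of_int (B$2$2)"
  have "of_int (A$i$1) * act B z + of_int (A$i$2) = (of_int ((A ** B)$i$1) * z + of_int ((A ** B)$i$2)) / ?q" for i
    using nz(1) unfolding act_eq[of B] by (simp add: matrix_mult_2 field_simps)
  then show ?thesis
    unfolding act_eq[of A] act_eq[of "A ** B"] using nz by simp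
qed

lemma act_uminus: "act (- A) z = act A z"
proof -
  have "act (- A) z = (- (of_int (A$1$1) * z + of_int (A$1$2))) / (- (of_int (A$2$1) * z + of_int (A$2$2)))"
    by (simp add: act_eq)
  then show ?thesis by (simp only: minus_divide_divide act_eq)
qed

lemma act_transl: "act (transl m) z = z + of_int m"
  by (simp add: act_eq)

lemma sl2_inv_mult: "A \<in> SL2Z \<Longrightarrow> sl2_inv A ** A = mat 1" "A \<in> SL2Z \<Longrightarrow> A ** sl2_inv A = mat 1"
  by (simp_all add: matrix_2_eq_iff matrix_mult_2 SL2Z_iff mat_def algebra_simps)

lemma act_one: "act (mat 1) z = z"
  by (simp add: act_eq mat_def)

lemma act_inv_act: "A \<in> SL2Z \<Longrightarrow> Im z > 0 \<Longrightarrow> act (sl2_inv A) (act A z) = z"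
  by (simp add: act_mult[symmetric] SL2Z_inv sl2_inv_mult act_one)

lemma act_act_inv: "A \<in> SL2Z \<Longrightarrow> Im z > 0 \<Longrightarrow> act A (act (sl2_inv A) z) = z"
  by (simp add: act_mult[symmetric] SL2Z_inv sl2_inv_mult act_one)

text \<open>One matrix out of each pair \<open>A\<close>, \<open>- A\<close>.\<close>

definition SL2Z_pos :: "(int^2^2) set" where
  "SL2Z_pos = {A \<in> SL2Z. A$2$1 > 0 \<or> (A$2$1 = 0 \<and> A$2$2 > 0)}"

lemma SL2Z_pos_SL2Z: "A \<in> SL2Z_pos \<Longrightarrow> A \<in> SL2Z"
  by (simp add: SL2Z_pos_def)

lemma SL2Z_pos_cases:
  assumes "A \<in> SL2Z"
  shows "A \<in> SL2Z_pos \<or> - A \<in> SL2Z_pos"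
proof -
  have "\<not> (A$2$1 = 0 \<and> A$2$2 = 0)" using assms by (auto simp: SL2Z_iff)
  then show ?thesis using assms by (auto simp: SL2Z_pos_def SL2Z_uminus)
qed

lemma SL2Z_pos_uminus: "A \<in> SL2Z_pos \<Longrightarrow> - A \<notin> SL2Z_pos"
  by (auto simp: SL2Z_pos_def)

lemma countable_SL2Z_pos: "countable SL2Z_pos"
proof -
  have "inj (\<lambda>A :: int^2^2. (A$1$1, A$1$2, A$2$1, A$2$2))"
    by (auto simp: inj_on_def matrix_2_eq_iff)
  then have "countable (UNIV :: (int^2^2) set)"
    by (metis countableI_type countable_image_inj_on countable_subset subset_UNIV)
  then show ?thesis by (rule countable_subset[OF subset_UNIV])
qed

section \<open>Cosets and the Poincare series\<close>

abbreviation (input) strip :: "complex set" where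
  "strip \<equiv> {z. 0 \<le> Re z \<and> Re z < 1}"

definition coset_rel :: "((int^2^2) \<times> (int^2^2)) set" where
  "coset_rel = {(A, B). A \<in> SL2Z \<and> (\<exists>N\<in>Gamma_inf. B = N ** A \<or> B = - (N ** A))}"

lemma coset_rel_Image: "A \<in> SL2Z \<Longrightarrow> coset_rel `` {A} = (\<Union>m. {transl m ** A, - (transl m ** A)})"
  by (auto simp: coset_rel_def Gamma_inf_eq)

lemma transl_transl_mult: "transl m ** (transl k ** A) = transl (m + k) ** A"
  for A :: "int^2^2"
  by (simp add: matrix_2_eq_iff matrix_mult_2 algebra_simps)

lemma transl_mult_uminus: "transl m ** (- A) = - (transl m ** A)"
  for A :: "int^2^2"
  by (simp add: matrix_2_eq_iff matrix_mult_2)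

lemma coset_rel_Image_transl:
  assumes "A \<in> SL2Z"
  shows "coset_rel `` {transl k ** A} = coset_rel `` {A}"
proof -
  have "(\<Union>m. {transl (m + k) ** A, - (transl (m + k) ** A)}) = (\<Union>m. {transl m ** A, - (transl m ** A)})"
  proof -
    have "(\<Union>m. f (m + k)) = (\<Union>m. f m)" for f :: "int \<Rightarrow> (int^2^2) set"
      by (auto, metis diff_add_cancel)
    then show ?thesis .
  qed
  then show ?thesis
    using assms by (simp add: coset_rel_Image SL2Z_mult transl_SL2Z transl_transl_mult)
qed

lemma coset_rel_Image_uminus:
  assumes "A \<in> SL2Z"
  shows "coset_rel `` {- A} = coset_rel `` {A}"
  using assms by (auto simp: coset_rel_Image SL2Z_uminus transl_mult_uminus)

text \<open>A coset consists of the matrices \<plusminus> T^m A, T being translation by 1. The sign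
  is fixed by \<open>SL2Z_pos\<close>, and m by the strip, which is half-open so that exactly one
  translate of each point lies in it. The representatives depend on z, so the coset sum becomes a
  sum over one fixed countable set with a condition on \<open>act A z\<close>, the shape in which it
  can be integrated over z.\<close>

lemma bij_betw_cosets:
  assumes z: "Im z > 0"
  shows "bij_betw (\<lambda>A. coset_rel `` {A}) {A \<in> SL2Z_pos. act A z \<in> strip} cosets"
  unfolding bij_betw_def
proof
  show "inj_on (\<lambda>A. coset_rel `` {A}) {A \<in> SL2Z_pos. act A z \<in> strip}"
  proof (rule inj_onI)
    fix A B assume A: "A \<in> {A \<in> SL2Z_pos. act A z \<in> strip}" and B: "B \<in> {A \<in> SL2Z_pos. act A z \<in> strip}"
      and eq: "coset_rel `` {A} = coset_rel `` {B}"
    have sl: "A \<in> SL2Z" "B \<in> SL2Z" using A B by (auto intro: SL2Z_pos_SL2Z)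
    have "transl 0 ** B \<in> coset_rel `` {A}" unfolding eq using sl by (auto simp: coset_rel_Image)
    moreover have "transl 0 ** B = B" by (simp add: matrix_2_eq_iff matrix_mult_2)
    ultimately obtain m where m: "B = transl m ** A \<or> B = - (transl m ** A)"
      using sl by (auto simp: coset_rel_Image)
    have "transl m ** A \<in> SL2Z_pos"
      using A by (auto simp: SL2Z_pos_def SL2Z_mult transl_SL2Z matrix_mult_2)
    then have "B = transl m ** A" using m B SL2Z_pos_uminus by auto
    moreover from this have "act B z = act A z + of_int m"
      using z sl by (simp add: act_mult transl_SL2Z act_transl)
    then have "m = 0" using A B by (auto simp: algebra_simps)
    ultimately show "A = B" by (simp add: matrix_2_eq_iff matrix_mult_2)
  qed
  show "(\<lambda>A. coset_rel `` {A}) ` {A \<in> SL2Z_pos. act A z \<in> strip} = cosets"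
  proof (intro equalityI subsetI)
    fix C assume "C \<in> (\<lambda>A. coset_rel `` {A}) ` {A \<in> SL2Z_pos. act A z \<in> strip}"
    then show "C \<in> cosets"
      unfolding cosets_def coset_rel_def[symmetric] by (auto intro!: quotientI SL2Z_pos_SL2Z)
  next
    fix C assume "C \<in> cosets"
    then obtain A where A: "A \<in> SL2Z" "C = coset_rel `` {A}"
      unfolding cosets_def coset_rel_def[symmetric] by (auto elim!: quotientE)
    obtain B where B: "B \<in> SL2Z_pos" "C = coset_rel `` {B}"
      using SL2Z_pos_cases[OF A(1)] A coset_rel_Image_uminus by metis
    define k where "k = - \<lfloor>Re (act B z)\<rfloor>"
    have sl: "B \<in> SL2Z" using B by (simp add: SL2Z_pos_SL2Z)
    have "act (transl k ** B) z = act B z + of_int k"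
      using z sl by (simp add: act_mult transl_SL2Z act_transl)
    then have "act (transl k ** B) z \<in> strip" unfolding k_def by simp linarith
    moreover have "transl k ** B \<in> SL2Z_pos"
      using B by (auto simp: SL2Z_pos_def SL2Z_mult transl_SL2Z matrix_mult_2)
    ultimately show "C \<in> (\<lambda>A. coset_rel `` {A}) ` {A \<in> SL2Z_pos. act A z \<in> strip}"
      using coset_rel_Image_transl[OF sl, of k] B by blast
  qed
qed

definition poincare_seed :: "int \<Rightarrow> complex \<Rightarrow> complex \<Rightarrow> complex" where
  "poincare_seed h s z = of_real (Im z) powr s * exp (2 * of_real pi * \<i> * of_int h * z)"

lemma poincare_seed_transl: "poincare_seed h s (z + of_int m) = poincare_seed h s z"
proof -
  have "exp (2 * of_real pi * \<i> * of_int h * (z + of_int m)) =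
      exp (2 * of_real pi * \<i> * of_int h * z) * exp (2 * of_real pi * \<i> * of_int (h * m))"
    unfolding exp_add[symmetric] by (simp add: algebra_simps)
  also have "exp (2 * of_real pi * \<i> * of_int (h * m)) = 1"
    using exp_integer_2pi[of "of_int (h * m)"] by (simp add: mult_ac)
  finally show ?thesis by (simp add: poincare_seed_def)
qed

lemma poincare_eq_infsum:
  assumes z: "Im z > 0"
  shows "poincare h z s =
    (\<Sum>\<^sub>\<infinity>A\<in>SL2Z_pos. if act A z \<in> strip then poincare_seed h s (act A z) else 0)"
proof -
  have "poincare h z s = (\<Sum>\<^sub>\<infinity>C\<in>cosets. poincare_seed h s (act (SOME \<gamma>. \<gamma> \<in> C) z))"
    by (simp add: poincare_def poincare_seed_def Let_def)
  also have "\<dots> = (\<Sum>\<^sub>\<infinity>A\<in>{A \<in> SL2Z_pos. act A z \<in> strip}. poincare_seed h s (act (SOME \<gamma>. \<gamma> \<in> coset_rel `` {A}) z))"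
    by (rule infsum_reindex_bij_betw[OF bij_betw_cosets[OF z], symmetric])
  also have "\<dots> = (\<Sum>\<^sub>\<infinity>A\<in>{A \<in> SL2Z_pos. act A z \<in> strip}. poincare_seed h s (act A z))"
  proof (rule infsum_cong)
    fix A assume "A \<in> {A \<in> SL2Z_pos. act A z \<in> strip}"
    then have A: "A \<in> SL2Z" by (auto intro: SL2Z_pos_SL2Z)
    have "transl 0 ** A \<in> coset_rel `` {A}" using A by (auto simp: coset_rel_Image)
    then have "(SOME \<gamma>. \<gamma> \<in> coset_rel `` {A}) \<in> coset_rel `` {A}" by (rule someI)
    then obtain m where "(SOME \<gamma>. \<gamma> \<in> coset_rel `` {A}) = transl m ** A \<or> (SOME \<gamma>. \<gamma> \<in> coset_rel `` {A}) = - (transl m ** A)"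
      using A by (auto simp: coset_rel_Image)
    then have "act (SOME \<gamma>. \<gamma> \<in> coset_rel `` {A}) z = act A z + of_int m"
      using A z by (auto simp: act_uminus act_mult transl_SL2Z act_transl)
    then show "poincare_seed h s (act (SOME \<gamma>. \<gamma> \<in> coset_rel `` {A}) z) = poincare_seed h s (act A z)"
      by (simp add: poincare_seed_transl)
  qed
  also have "\<dots> = (\<Sum>\<^sub>\<infinity>A\<in>SL2Z_pos. if act A z \<in> strip then poincare_seed h s (act A z) else 0)"
    by (rule infsum_cong_neutral) auto
  finally show ?thesis .
qed

section \<open>The fundamental domain\<close>

text \<open>By \<open>Im_act\<close> the height is Im z / Q^2 with Q = |c z + d|. Only finitely many
  pairs (c, d) give Q <= 1, and the identity matrix is among them, so Q attains its minimum.\<close>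

lemma act_Im_max:
  assumes z: "Im z > 0"
  shows "\<exists>A\<in>SL2Z. \<forall>B\<in>SL2Z. Im (act B z) \<le> Im (act A z)"
proof -
  define Q where "Q A = norm (of_int (A$2$1) * z + of_int (A$2$2))" for A :: "int^2^2"
  define W where "W = {A \<in> SL2Z. Q A \<le> 1}"
  \<comment> \<open>From |c z + d| <= 1 follow |c| <= 1 / Im z and |d| <= 1 + |z| / Im z; M exceeds
    both bounds.\<close>
  define M where "M = \<lceil>1 + (1 + norm z) / Im z\<rceil>"
  have "Q ` W \<subseteq> (\<lambda>(c, d). norm (of_int c * z + of_int d)) ` ({-M..M} \<times> {-M..M})"
  proof
    fix q assume "q \<in> Q ` W"
    then obtain A where A: "q = Q A" "Q A \<le> 1" by (auto simp: W_def)
    define c d where "c = A$2$1" and "d = A$2$2"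
    have "\<bar>real_of_int c * Im z\<bar> \<le> Q A"
      using abs_Im_le_cmod[of "of_int c * z + of_int d"] by (simp add: Q_def c_def d_def)
    then have c: "\<bar>real_of_int c\<bar> \<le> 1 / Im z"
      using A z by (simp add: abs_mult field_simps)
    have "norm (of_int d :: complex) \<le> Q A + norm (of_int c * z)"
      using norm_triangle_ineq4[of "of_int c * z + of_int d" "of_int c * z"] by (simp add: Q_def c_def d_def)
    also have "\<dots> \<le> 1 + 1 / Im z * norm z"
    proof (intro add_mono)
      show "norm (of_int c * z) \<le> 1 / Im z * norm z"
        unfolding norm_mult norm_of_int by (rule mult_right_mono[OF c norm_ge_zero])
    qed (rule A)
    finally have "\<bar>real_of_int d\<bar> \<le> 1 + (1 + norm z) / Im z"
      using z by (simp add: add_divide_distrib) (smt (verit) divide_nonneg_pos)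
    moreover have "\<bar>real_of_int c\<bar> \<le> 1 + (1 + norm z) / Im z"
      using c z by (simp add: add_divide_distrib) (smt (verit) divide_nonneg_pos norm_ge_zero)
    ultimately have "\<bar>d\<bar> \<le> M" "\<bar>c\<bar> \<le> M" unfolding M_def by linarith+
    then show "q \<in> (\<lambda>(c, d). norm (of_int c * z + of_int d)) ` ({-M..M} \<times> {-M..M})"
      using A(1) by (intro rev_image_eqI[of "(c, d)"]) (auto simp: Q_def c_def d_def)
  qed
  then have fin: "finite (Q ` W)" by (rule finite_subset) auto
  have one: "mat 1 \<in> W" by (simp add: W_def SL2Z_iff Q_def mat_def)
  then have "Min (Q ` W) \<in> Q ` W" using fin by (intro Min_in) auto
  then obtain A where A: "A \<in> W" "Q A = Min (Q ` W)" by auto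
  have Qmin: "Q A \<le> Q B" if "B \<in> SL2Z" for B
  proof (cases "B \<in> W")
    case True
    then show ?thesis using fin A by auto
  next
    case False
    then show ?thesis using A that by (auto simp: W_def)
  qed
  have AS: "A \<in> SL2Z" using A by (simp add: W_def)
  have "Im (act B z) \<le> Im (act A z)" if B: "B \<in> SL2Z" for B
  proof -
    have "Q A > 0" "Q B > 0" using act_denom_nonzero[OF AS z] act_denom_nonzero[OF B z] by (simp_all add: Q_def)
    then have "Im z / (Q B)\<^sup>2 \<le> Im z / (Q A)\<^sup>2"
      using Qmin[OF B] z by (intro divide_left_mono power_mono mult_pos_pos) auto
    then show ?thesis by (simp add: Im_act AS B z Q_def)
  qed
  then show ?thesis using AS by blast
qed

text \<open>A highest point of the orbit, translated to |Re w| <= 1/2, must satisfy |w| >= 1: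
  otherwise -1/w would lie higher.\<close>

lemma act_fundamental_domain:
  assumes z: "Im z > 0"
  shows "\<exists>A\<in>SL2Z. act A z \<in> fundamental_domain"
proof -
  obtain A where A: "A \<in> SL2Z" and max: "\<And>B. B \<in> SL2Z \<Longrightarrow> Im (act B z) \<le> Im (act A z)"
    using act_Im_max[OF z] by blast
  define k where "k = - \<lfloor>Re (act A z) + 1 / 2\<rfloor>"
  define B where "B = transl k ** A"
  have B: "B \<in> SL2Z" by (simp add: B_def SL2Z_mult transl_SL2Z A)
  define w where "w = act B z"
  have w: "w = act A z + of_int k"
    using z A by (simp add: w_def B_def act_mult transl_SL2Z act_transl)
  have Re: "\<bar>Re w\<bar> \<le> 1 / 2"
  proof -
    define y where "y = Re (act A z) + 1 / 2"
    have "Re w = y - 1 / 2 - of_int \<lfloor>y\<rfloor>" by (simp add: w k_def y_def)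
    then show ?thesis by linarith
  qed
  have Im: "Im w > 0" unfolding w_def by (rule Im_act_pos[OF B z])
  have "norm w \<ge> 1"
  proof (rule ccontr)
    assume "\<not> norm w \<ge> 1"
    then have n: "norm w < 1" by simp
    define S :: "int^2^2" where "S = vector [vector [0, -1], vector [1, 0]]"
    have S: "S \<in> SL2Z" by (simp add: SL2Z_iff S_def)
    have "Im w / (norm w)\<^sup>2 = Im (act S w)"
      unfolding Im_act[OF S Im] by (simp add: S_def)
    also have "\<dots> = Im (act (S ** B) z)" by (simp add: act_mult S B z w_def)
    also have "\<dots> \<le> Im (act A z)" by (intro max SL2Z_mult S B)
    also have "\<dots> = Im w" by (simp add: w)
    finally have "Im w / (norm w)\<^sup>2 \<le> Im w" .
    moreover have "(norm w)\<^sup>2 < 1" "(norm w)\<^sup>2 > 0"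
      using n Im by (auto simp: power_less_one_iff)
    ultimately show False using Im by (simp add: field_simps)
  qed
  then show ?thesis using Re Im B by (auto simp: fundamental_domain_def w_def)
qed

text \<open>The exact minimum is sqrt 3 / 2; the rational 4/5 below it suits the estimates of
  \<open>fourier_bounded_high\<close>.\<close>

lemma fundamental_domain_Im: "z \<in> fundamental_domain \<Longrightarrow> Im z \<ge> 4 / 5"
proof -
  assume z: "z \<in> fundamental_domain"
  then have "1 \<le> (Re z)\<^sup>2 + (Im z)\<^sup>2" by (simp add: fundamental_domain_def flip: cmod_power2)
  moreover have "(Re z)\<^sup>2 \<le> (1 / 2)\<^sup>2"
    using z by (intro power2_le_iff_abs_le[THEN iffD2]) (auto simp: fundamental_domain_def)
  ultimately have "(4 / 5)\<^sup>2 \<le> (Im z)\<^sup>2" by (simp add: power2_eq_square)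
  then show ?thesis using z by (intro power2_le_imp_le[of "4 / 5"]) (auto simp: fundamental_domain_def)
qed

section \<open>Translates of the open fundamental domain\<close>

definition fd_interior :: "complex set" where
  "fd_interior = {z. Im z > 0 \<and> \<bar>Re z\<bar> < 1 / 2 \<and> norm z > 1}"

text \<open>With |z| > 1, |Re z| < 1/2 and c nonzero, |c z + d|^2 exceeds c^2 - |c d| + d^2, a
  positive integer, so the height drops.\<close>

lemma Im_act_less:
  assumes z: "z \<in> fd_interior" and A: "A \<in> SL2Z" "A$2$1 \<noteq> 0"
  shows "Im (act A z) < Im z"
proof -
  define c d where "c = A$2$1" and "d = A$2$2"
  have Im: "Im z > 0" using z by (simp add: fd_interior_def)
  have "norm z > 1" using z by (simp add: fd_interior_def)
  then have n1: "(norm z)\<^sup>2 > 1" by (simp add: one_less_power)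
  have "(norm (of_int c * z + of_int d))\<^sup>2 = (of_int c)\<^sup>2 * (norm z)\<^sup>2 + 2 * of_int c * of_int d * Re z + (of_int d)\<^sup>2"
    unfolding cmod_power2 by (simp add: algebra_simps power2_eq_square)
  moreover have "(of_int c)\<^sup>2 * (norm z)\<^sup>2 > (of_int c)\<^sup>2 * 1"
    using n1 A by (intro mult_strict_left_mono) (auto simp: c_def)
  moreover have "2 * of_int c * of_int d * Re z \<ge> - \<bar>of_int c * of_int d\<bar>"
  proof -
    have "\<bar>of_int c * of_int d\<bar> * \<bar>Re z\<bar> \<le> \<bar>real_of_int c * of_int d\<bar> * (1 / 2)"
      using z by (intro mult_left_mono) (auto simp: fd_interior_def)
    then have "\<bar>of_int c * of_int d * Re z\<bar> \<le> \<bar>real_of_int c * of_int d\<bar> * (1 / 2)"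
      by (simp add: abs_mult)
    then show ?thesis by linarith
  qed
  moreover have "(real_of_int c)\<^sup>2 - \<bar>of_int c * of_int d\<bar> + (of_int d)\<^sup>2 \<ge> 1"
  proof -
    \<comment> \<open>Twice the form is (|c| - |d|)^2 + c^2 + d^2, which is positive for nonzero c;
      integrality gives 1.\<close>
    have "1 \<le> c\<^sup>2 - \<bar>c * d\<bar> + d\<^sup>2"
    proof -
      have c: "c \<noteq> 0" using A by (simp add: c_def)
      have "2 * (c\<^sup>2 - \<bar>c * d\<bar> + d\<^sup>2) = (\<bar>c\<bar> - \<bar>d\<bar>)\<^sup>2 + c\<^sup>2 + d\<^sup>2"
        by (simp add: power2_eq_square algebra_simps abs_mult)
      moreover have "c\<^sup>2 > 0" using c by simp
      ultimately have "2 * (c\<^sup>2 - \<bar>c * d\<bar> + d\<^sup>2) > 0"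
        by (smt (verit) zero_le_power2)
      then show ?thesis by (simp only: zero_less_mult_iff) simp
    qed
    then have "real_of_int 1 \<le> of_int (c\<^sup>2 - \<bar>c * d\<bar> + d\<^sup>2)" by (simp only: of_int_le_iff)
    then show ?thesis by simp
  qed
  ultimately have gt: "(norm (of_int c * z + of_int d))\<^sup>2 > 1" by linarith
  have "Im (act A z) = Im z / (norm (of_int c * z + of_int d))\<^sup>2"
    by (simp add: Im_act[OF A(1) Im] c_def d_def)
  also have "\<dots> < Im z" using gt Im by (simp add: divide_less_eq mult_less_cancel_left1 del: zero_less_power2)
  finally show ?thesis .
qed

text \<open>If the lower left entry were nonzero, both A and its inverse would strictly lower the
  height. Otherwise A is up to sign a translation, and the width of the domain leaves only
  translation by 0.\<close>

lemma fd_interior_unique: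
  assumes z: "z \<in> fd_interior" and A: "A \<in> SL2Z" and Az: "act A z \<in> fd_interior"
  shows "A = mat 1 \<or> A = - mat 1"
proof -
  have Im: "Im z > 0" using z by (simp add: fd_interior_def)
  have c: "A$2$1 = 0"
  proof (rule ccontr)
    assume c: "A$2$1 \<noteq> 0"
    have "Im (act (sl2_inv A) (act A z)) < Im (act A z)"
      using c by (intro Im_act_less[OF Az] SL2Z_inv A) auto
    then show False using Im_act_less[OF z A c] by (simp add: act_inv_act A Im)
  qed
  then have "A$1$1 * A$2$2 = 1" using A by (simp add: SL2Z_iff)
  then have ad: "A$1$1 = 1 \<and> A$2$2 = 1 \<or> A$1$1 = -1 \<and> A$2$2 = -1"
    by (simp add: zmult_eq_1_iff)
  then have "act A z = z + of_int (A$1$2) \<or> act A z = z - of_int (A$1$2)"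
    using c by (auto simp: act_eq)
  then have "Re (act A z) = Re z + of_int (A$1$2) \<or> Re (act A z) = Re z - of_int (A$1$2)"
    by auto
  moreover have "\<bar>Re z\<bar> < 1 / 2" "\<bar>Re (act A z)\<bar> < 1 / 2"
    using z Az by (simp_all add: fd_interior_def)
  ultimately have "\<bar>real_of_int (A$1$2)\<bar> < 1" by linarith
  then have "A$1$2 = 0" by linarith
  then show ?thesis using c ad by (auto simp: matrix_2_eq_iff mat_def)
qed

section \<open>Hyperbolic measure\<close>

text \<open>
  In the coordinates \<open>x = a e\<^sup>l\<close>, \<open>y = e\<^sup>l\<close> the measure \<open>dx dy / y\<^sup>2\<close> is \<open>da dl\<close>.  Real translations shift
  \<open>a\<close>, dilations shift \<open>l\<close>, and \<open>z \<mapsto> - 1 / z\<close> is \<open>(l, a) \<mapsto> (- l - ln (1 + a\<^sup>2), - a)\<close>, so invariance only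
  needs Fubini.
\<close>

definition hyp_point :: "real \<times> real \<Rightarrow> complex" where
  "hyp_point p = Complex (snd p * exp (fst p)) (exp (fst p))"

definition hyp_measure :: "complex measure" where
  "hyp_measure = distr (lborel \<Otimes>\<^sub>M lborel) borel hyp_point"

lemma measurable_Complex' [measurable (raw)]:
  assumes [measurable]: "f \<in> borel_measurable M" "g \<in> borel_measurable M"
  shows "(\<lambda>x. Complex (f x) (g x)) \<in> borel_measurable M"
  using measurable_compose[OF measurable_Pair[OF assms] measurable_Complex] by simp

lemma measurable_hyp_point [measurable]:
  "hyp_point \<in> borel_measurable (borel \<Otimes>\<^sub>M borel)"
  "hyp_point \<in> borel_measurable (lborel \<Otimes>\<^sub>M lborel)"
  unfolding hyp_point_def by measurable

lemma sets_hyp_measure [measurable_cong, simp]: "sets hyp_measure = sets borel"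
  by (simp add: hyp_measure_def)

lemma space_hyp_measure [simp]: "space hyp_measure = UNIV"
  by (simp add: hyp_measure_def)

lemma nn_integral_hyp_measure:
  assumes [measurable]: "f \<in> borel_measurable borel"
  shows "(\<integral>\<^sup>+z. f z \<partial>hyp_measure) = (\<integral>\<^sup>+l. \<integral>\<^sup>+a. f (hyp_point (l, a)) \<partial>lborel \<partial>lborel)"
  unfolding hyp_measure_def
  by (subst nn_integral_distr) (auto simp: lborel.nn_integral_fst[symmetric])

lemma Im_hyp_point [simp]: "Im (hyp_point p) > 0"
  by (simp add: hyp_point_def)

lemma AE_hyp_measure_Im: "AE z in hyp_measure. Im z > 0"
  unfolding hyp_measure_def by (subst AE_distr_iff) auto

lemma nn_integral_hyp_measure_add_real:
  assumes [measurable]: "f \<in> borel_measurable borel"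
  shows "(\<integral>\<^sup>+z. f (z + of_real x) \<partial>hyp_measure) = (\<integral>\<^sup>+z. f z \<partial>hyp_measure)"
proof -
  have *: "hyp_point (l, a) + of_real x = hyp_point (l, x * exp (- l) + 1 * a)" for l a
    by (simp add: hyp_point_def complex_eq_iff algebra_simps flip: exp_add)
  have "(\<integral>\<^sup>+a. f (hyp_point (l, x * exp (- l) + 1 * a)) \<partial>lborel) = (\<integral>\<^sup>+a. f (hyp_point (l, a)) \<partial>lborel)" for l
    using nn_integral_real_affine[of "\<lambda>a. f (hyp_point (l, a))" 1 "x * exp (- l)"] by simp
  then show ?thesis
    by (simp add: nn_integral_hyp_measure * del: mult_1)
qed

lemma nn_integral_hyp_measure_scale:
  assumes [measurable]: "f \<in> borel_measurable borel" and k: "k > 0"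
  shows "(\<integral>\<^sup>+z. f (of_real k * z) \<partial>hyp_measure) = (\<integral>\<^sup>+z. f z \<partial>hyp_measure)"
proof -
  have *: "of_real k * hyp_point (l, a) = hyp_point (ln k + 1 * l, a)" for l a
    using k by (simp add: hyp_point_def complex_eq_iff exp_add)
  have [measurable]: "(\<lambda>l. \<integral>\<^sup>+a. f (hyp_point (l, a)) \<partial>lborel) \<in> borel_measurable borel" by measurable
  show ?thesis
    using nn_integral_real_affine[of "\<lambda>l. \<integral>\<^sup>+a. f (hyp_point (l, a)) \<partial>lborel" 1 "ln k"]
    by (simp add: nn_integral_hyp_measure * del: mult_1) simp
qed

lemma nn_integral_hyp_measure_inversion:
  assumes [measurable]: "f \<in> borel_measurable borel"
  shows "(\<integral>\<^sup>+z. f (- 1 / z) \<partial>hyp_measure) = (\<integral>\<^sup>+z. f z \<partial>hyp_measure)"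
proof -
  have *: "- 1 / hyp_point (l, a) = hyp_point (- ln (1 + a\<^sup>2) + - 1 * l, - a)" for l a
  proof -
    have p: "1 + a\<^sup>2 > 0" by (simp add: add_pos_nonneg)
    obtain X where X: "exp (- ln (1 + a\<^sup>2) + - 1 * l) = X" "X * ((1 + a\<^sup>2) * exp l) = 1"
      using p by (simp add: exp_diff exp_minus)
    then have "X * exp l + a * a * X * exp l = 1" by (simp add: algebra_simps power2_eq_square)
    then have "hyp_point (- ln (1 + a\<^sup>2) + - 1 * l, - a) * hyp_point (l, a) = - 1"
      unfolding hyp_point_def fst_conv snd_conv X(1) by (simp add: complex_eq_iff algebra_simps)
    moreover have "hyp_point (l, a) \<noteq> 0" by (simp add: hyp_point_def complex_eq_iff)
    ultimately show ?thesis by (simp add: field_simps)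
  qed
  have "(\<integral>\<^sup>+z. f (- 1 / z) \<partial>hyp_measure) = (\<integral>\<^sup>+l. \<integral>\<^sup>+a. f (hyp_point (- ln (1 + a\<^sup>2) + - 1 * l, - a)) \<partial>lborel \<partial>lborel)"
    by (subst nn_integral_hyp_measure) (simp_all only: *, measurable)
  also have "\<dots> = (\<integral>\<^sup>+a. \<integral>\<^sup>+l. f (hyp_point (- ln (1 + a\<^sup>2) + - 1 * l, - a)) \<partial>lborel \<partial>lborel)"
    by (rule lborel_pair.Fubini') measurable
  also have "\<dots> = (\<integral>\<^sup>+a. \<integral>\<^sup>+l. f (hyp_point (l, - a)) \<partial>lborel \<partial>lborel)"
  proof (rule nn_integral_cong)
    fix a :: real
    show "(\<integral>\<^sup>+l. f (hyp_point (- ln (1 + a\<^sup>2) + - 1 * l, - a)) \<partial>lborel) = (\<integral>\<^sup>+l. f (hyp_point (l, - a)) \<partial>lborel)"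
      using nn_integral_real_affine[of "\<lambda>l. f (hyp_point (l, - a))" "-1" "- ln (1 + a\<^sup>2)"] by simp
  qed
  also have "\<dots> = (\<integral>\<^sup>+a. \<integral>\<^sup>+l. f (hyp_point (l, a)) \<partial>lborel \<partial>lborel)"
    using nn_integral_real_affine[of "\<lambda>a. \<integral>\<^sup>+l. f (hyp_point (l, a)) \<partial>lborel" "-1" 0] by simp
  also have "\<dots> = (\<integral>\<^sup>+l. \<integral>\<^sup>+a. f (hyp_point (l, a)) \<partial>lborel \<partial>lborel)"
    by (rule lborel_pair.Fubini') measurable
  finally show ?thesis by (simp add: nn_integral_hyp_measure)
qed

lemma measurable_act [measurable]: "act A \<in> borel_measurable borel"
  unfolding act_eq by measurable

text \<open>Every A is composed of translations, a dilation and z -> -1/z, for each of which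
  invariance is known.\<close>

lemma nn_integral_hyp_measure_act:
  assumes f [measurable]: "f \<in> borel_measurable borel" and A: "A \<in> SL2Z"
  shows "(\<integral>\<^sup>+z. f (act A z) \<partial>hyp_measure) = (\<integral>\<^sup>+z. f z \<partial>hyp_measure)"
proof -
  define a b c d where "a = real_of_int (A$1$1)" "b = real_of_int (A$1$2)" "c = real_of_int (A$2$1)" "d = real_of_int (A$2$2)"
  have det: "a * d - b * c = 1"
    using A unfolding SL2Z_iff a_b_c_d_def by (simp flip: of_int_mult of_int_diff)
  have act: "act A z = (of_real a * z + of_real b) / (of_real c * z + of_real d)" for z
    by (simp add: act_eq a_b_c_d_def)
  show ?thesis
  proof (cases "c = 0")
    case True
    then have "A$2$1 = 0" by (simp add: a_b_c_d_def)
    then have "A$1$1 * A$2$2 = 1" using A by (simp add: SL2Z_iff)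
    then have "a = 1 \<and> d = 1 \<or> a = - 1 \<and> d = - 1" by (auto simp: zmult_eq_1_iff a_b_c_d_def)
    then have "act A z = z + of_real (b / d)" for z
      unfolding act using True by (elim disjE conjE) simp_all
    then show ?thesis by (simp only: nn_integral_hyp_measure_add_real[OF f])
  next
    case False
    \<comment> \<open>Bruhat decomposition: translate by d/c, dilate by c^2, invert, translate by
      a/c.\<close>
    have "act A z = - 1 / (of_real (c\<^sup>2) * (z + of_real (d / c))) + of_real (a / c)" if "Im z > 0" for z
    proof -
      have "of_real c * z + of_real d \<noteq> 0"
        using act_denom_nonzero[OF A that] by (simp add: a_b_c_d_def)
      moreover have "of_real (c\<^sup>2) * (z + of_real (d / c)) = of_real c * (of_real c * z + of_real d)"
        using False by (simp add: field_simps power2_eq_square)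
      moreover have "of_real a * (of_real c * z + of_real d) - 1 = of_real c * (of_real a * z + of_real b)"
      proof -
        have "of_real a * of_real d - (1 :: complex) = of_real b * of_real c"
        proof -
          have "complex_of_real (a * d - b * c) = 1" unfolding det by simp
          then show ?thesis by (simp add: algebra_simps)
        qed
        then show ?thesis by (simp add: algebra_simps)
      qed
      ultimately show ?thesis
        unfolding act using False by (simp add: divide_simps)
    qed
    then have "(\<integral>\<^sup>+z. f (act A z) \<partial>hyp_measure) =
        (\<integral>\<^sup>+z. f (- 1 / (of_real (c\<^sup>2) * (z + of_real (d / c))) + of_real (a / c)) \<partial>hyp_measure)"
      by (intro nn_integral_cong_AE eventually_mono[OF AE_hyp_measure_Im]) simp
    also have "\<dots> = (\<integral>\<^sup>+z. f (- 1 / (of_real (c\<^sup>2) * z) + of_real (a / c)) \<partial>hyp_measure)"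
      by (rule nn_integral_hyp_measure_add_real) measurable
    also have "\<dots> = (\<integral>\<^sup>+z. f (- 1 / z + of_real (a / c)) \<partial>hyp_measure)"
      using False by (intro nn_integral_hyp_measure_scale[of "\<lambda>z. f (- 1 / z + of_real (a / c))" "c\<^sup>2"]) auto
    also have "\<dots> = (\<integral>\<^sup>+z. f (z + of_real (a / c)) \<partial>hyp_measure)"
      by (rule nn_integral_hyp_measure_inversion) measurable
    also have "\<dots> = (\<integral>\<^sup>+z. f z \<partial>hyp_measure)"
      by (rule nn_integral_hyp_measure_add_real) measurable
    finally show ?thesis .
  qed
qed

text \<open>The substitutions y = e^l and x = a e^l contribute one factor e^l each, cancelling y^-2.
  This ties the coordinates used for invariance to the measure in \<open>petersson\<close>.\<close>

lemma hyp_measure_density: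
  "hyp_measure = density lborel (\<lambda>z. ennreal (indicator {z. Im z > 0} z / (Im z)\<^sup>2))"
proof (rule measure_eqI)
  fix B assume "B \<in> sets hyp_measure"
  then have [measurable]: "B \<in> sets borel" by simp
  let ?d = "\<lambda>z. ennreal (indicator {z. Im z > 0} z / (Im z)\<^sup>2)"
  let ?I = "\<lambda>y. \<integral>\<^sup>+x. indicator B (Complex x y) \<partial>lborel"
  have [measurable]: "{z. Im z > 0} \<in> sets borel" by measurable
  have "emeasure (density lborel ?d) B = (\<integral>\<^sup>+z. ?d z * indicator B z \<partial>lborel)"
    by (rule emeasure_density) auto
  also have "\<dots> = (\<integral>\<^sup>+p. ?d (Complex (fst p) (snd p)) * indicator B (Complex (fst p) (snd p)) \<partial>(lborel \<Otimes>\<^sub>M lborel))"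
    by (subst lborel_complex_distr, subst nn_integral_distr) auto
  also have "\<dots> = (\<integral>\<^sup>+y. \<integral>\<^sup>+x. ?d (Complex x y) * indicator B (Complex x y) \<partial>lborel \<partial>lborel)"
    by (subst lborel_pair.nn_integral_snd[symmetric]) auto
  also have "\<dots> = (\<integral>\<^sup>+y\<in>{0<..}. ennreal (1 / y\<^sup>2) * ?I y \<partial>lborel)"
    by (intro nn_integral_cong, subst nn_integral_cmult[symmetric])
       (auto simp: indicator_def intro!: nn_integral_cong)
  also have "\<dots> = (\<integral>\<^sup>+l. ennreal (exp l) * (ennreal (1 / (exp l)\<^sup>2) * ?I (exp l)) \<partial>lborel)"
    by (rule nn_integral_exp_substitution) measurable
  also have "\<dots> = (\<integral>\<^sup>+l. \<integral>\<^sup>+a. indicator B (hyp_point (l, a)) \<partial>lborel \<partial>lborel)"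
  proof (rule nn_integral_cong)
    fix l :: real
    have "?I (exp l) = ennreal \<bar>exp l\<bar> * (\<integral>\<^sup>+a. indicator B (Complex (0 + exp l * a) (exp l)) \<partial>lborel)"
      by (rule nn_integral_real_affine) auto
    also have "(\<integral>\<^sup>+a. indicator B (Complex (0 + exp l * a) (exp l)) \<partial>lborel) = (\<integral>\<^sup>+a. indicator B (hyp_point (l, a)) \<partial>lborel)"
      by (simp add: hyp_point_def mult.commute)
    finally have I: "?I (exp l) = ennreal (exp l) * (\<integral>\<^sup>+a. indicator B (hyp_point (l, a)) \<partial>lborel)"
      by simp
    have "ennreal (exp l) * (ennreal (1 / (exp l)\<^sup>2) * ennreal (exp l)) = ennreal (exp l * (1 / (exp l)\<^sup>2 * exp l))"
      by (subst ennreal_mult, simp, simp, subst ennreal_mult) auto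
    also have "exp l * (1 / (exp l)\<^sup>2 * exp l) = 1" by (simp add: power2_eq_square)
    finally show "ennreal (exp l) * (ennreal (1 / (exp l)\<^sup>2) * ?I (exp l)) = (\<integral>\<^sup>+a. indicator B (hyp_point (l, a)) \<partial>lborel)"
      unfolding I by (simp add: mult.assoc[symmetric])
  qed
  also have "\<dots> = (\<integral>\<^sup>+z. indicator B z \<partial>hyp_measure)"
    by (rule nn_integral_hyp_measure[symmetric]) auto
  also have "\<dots> = emeasure hyp_measure B" by simp
  finally show "emeasure hyp_measure B = emeasure (density lborel ?d) B" ..
qed simp

lemma sigma_finite_hyp_measure: "sigma_finite_measure hyp_measure"
  unfolding hyp_measure_density
  by (subst sigma_finite_measure.sigma_finite_iff_density_finite[OF sigma_finite_lborel]) auto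

lemma nn_integral_hyp_measure_strip:
  assumes [measurable]: "f \<in> borel_measurable borel"
  shows "(\<integral>\<^sup>+z. f z \<partial>hyp_measure) = (\<integral>\<^sup>+l. ennreal (exp (- l)) * (\<integral>\<^sup>+x. f (Complex x (exp l)) \<partial>lborel) \<partial>lborel)"
proof -
  have "(\<integral>\<^sup>+a. f (hyp_point (l, a)) \<partial>lborel) = ennreal (exp (- l)) * (\<integral>\<^sup>+x. f (Complex x (exp l)) \<partial>lborel)" for l
  proof -
    have "(\<integral>\<^sup>+a. f (hyp_point (l, a)) \<partial>lborel) = ennreal \<bar>exp (- l)\<bar> * (\<integral>\<^sup>+x. f (hyp_point (l, 0 + exp (- l) * x)) \<partial>lborel)"
      by (rule nn_integral_real_affine) auto
    moreover have "hyp_point (l, 0 + exp (- l) * x) = Complex x (exp l)" for x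
      by (simp add: hyp_point_def exp_minus)
    ultimately show ?thesis by simp
  qed
  then show ?thesis by (simp add: nn_integral_hyp_measure)
qed

lemma integral_hyp_measure_strip:
  fixes f :: "complex \<Rightarrow> complex"
  assumes f: "integrable hyp_measure f"
  shows "(LINT z|hyp_measure. f z) = (LINT l|lborel. exp (- l) *\<^sub>R (LINT x|lborel. f (Complex x (exp l))))"
proof -
  have [measurable]: "f \<in> borel_measurable borel" using borel_measurable_integrable[OF f] by simp
  have "integrable (lborel \<Otimes>\<^sub>M lborel) (\<lambda>p. f (hyp_point p))"
    using f unfolding hyp_measure_def by (subst (asm) integrable_distr_eq) auto
  then have i: "integrable (lborel \<Otimes>\<^sub>M lborel) (\<lambda>(l, a). f (hyp_point (l, a)))"
    by (simp add: case_prod_unfold)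
  have "(LINT z|hyp_measure. f z) = (LINT p|(lborel \<Otimes>\<^sub>M lborel). (\<lambda>(l, a). f (hyp_point (l, a))) p)"
    unfolding hyp_measure_def by (subst integral_distr) (auto simp: case_prod_unfold)
  also have "\<dots> = (LINT l|lborel. (LINT a|lborel. f (hyp_point (l, a))))"
    using lborel_pair.integral_fst[OF i] by (simp only: case_prod_eta)
  also have "(\<lambda>l. LINT a|lborel. f (hyp_point (l, a))) = (\<lambda>l. exp (- l) *\<^sub>R (LINT x|lborel. f (Complex x (exp l))))"
  proof
    fix l
    have "hyp_point (l, 0 + exp (- l) * x) = Complex x (exp l)" for x
      by (simp add: hyp_point_def exp_minus)
    then show "(LINT a|lborel. f (hyp_point (l, a))) = exp (- l) *\<^sub>R (LINT x|lborel. f (Complex x (exp l)))"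
      using lborel_integral_real_affine[of "exp (- l)" "\<lambda>a. f (hyp_point (l, a))" 0] by simp
  qed
  finally show ?thesis .
qed

section \<open>Unfolding\<close>

lemma distr_hyp_measure_act:
  assumes A: "A \<in> SL2Z"
  shows "distr hyp_measure borel (act A) = hyp_measure"
proof (rule measure_eqI)
  fix B assume "B \<in> sets (distr hyp_measure borel (act A))"
  then have [measurable]: "B \<in> sets borel" by simp
  have "emeasure (distr hyp_measure borel (act A)) B = (\<integral>\<^sup>+z. indicator B z \<partial>distr hyp_measure borel (act A))"
    by simp
  also have "\<dots> = (\<integral>\<^sup>+z. indicator B (act A z) \<partial>hyp_measure)"
    by (rule nn_integral_distr) auto
  also have "\<dots> = emeasure hyp_measure B"
    by (subst nn_integral_hyp_measure_act[OF _ A]) auto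
  finally show "emeasure (distr hyp_measure borel (act A)) B = emeasure hyp_measure B" .
qed simp

lemma AE_lborel_not_in_finite: "finite N \<Longrightarrow> AE x in lborel. x \<notin> N" for N :: "real set"
  by (rule AE_not_in) (rule finite_imp_null_set_lborel)

text \<open>At fixed height e^l the boundary meets at most four values of a: the vertical sides are
  |a| = e^-l / 2 and the circle is a^2 = e^(-2l) - 1.\<close>

lemma AE_fundamental_domain_interior:
  "AE z in hyp_measure. z \<in> fundamental_domain \<longrightarrow> z \<in> fd_interior"
proof -
  have "AE l in lborel. AE a in lborel. \<bar>Re (hyp_point (l, a))\<bar> \<noteq> 1 / 2 \<and> norm (hyp_point (l, a)) \<noteq> 1"
  proof (rule AE_I2)
    fix l :: real
    let ?q = "sqrt (exp (- 2 * l) - 1)" and ?r = "exp (- l) / 2"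
    have "AE a in lborel. a \<notin> {?q, - ?q, ?r, - ?r}" by (rule AE_lborel_not_in_finite) auto
    then show "AE a in lborel. \<bar>Re (hyp_point (l, a))\<bar> \<noteq> 1 / 2 \<and> norm (hyp_point (l, a)) \<noteq> 1"
    proof eventually_elim
      fix a assume a: "a \<notin> {?q, - ?q, ?r, - ?r}"
      have "\<bar>Re (hyp_point (l, a))\<bar> \<noteq> 1 / 2"
      proof
        assume "\<bar>Re (hyp_point (l, a))\<bar> = 1 / 2"
        then have "\<bar>a\<bar> * exp l = 1 / 2" by (simp add: hyp_point_def abs_mult)
        then have "\<bar>a\<bar> = ?r" by (simp add: exp_minus field_simps)
        then show False using a by (auto simp: abs_if split: if_splits)
      qed
      moreover have "norm (hyp_point (l, a)) \<noteq> 1"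
      proof
        assume "norm (hyp_point (l, a)) = 1"
        then have "(norm (hyp_point (l, a)))\<^sup>2 = 1" by simp
        then have "a\<^sup>2 * (exp l)\<^sup>2 + (exp l)\<^sup>2 = 1"
          unfolding cmod_power2 by (simp add: hyp_point_def power_mult_distrib)
        moreover have "(exp l)\<^sup>2 * exp (- 2 * l) = 1"
          by (simp add: power2_eq_square flip: exp_add)
        ultimately have "(exp l)\<^sup>2 * a\<^sup>2 = (exp l)\<^sup>2 * (exp (- 2 * l) - 1)"
          by (simp add: algebra_simps)
        then have "a\<^sup>2 = exp (- 2 * l) - 1" by simp
        then have "\<bar>a\<bar> = ?q" by (metis real_sqrt_abs)
        then show False using a by (auto simp: abs_if split: if_splits)
      qed
      ultimately show "\<bar>Re (hyp_point (l, a))\<bar> \<noteq> 1 / 2 \<and> norm (hyp_point (l, a)) \<noteq> 1" ..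
    qed
  qed
  then have "AE p in lborel \<Otimes>\<^sub>M lborel. \<bar>Re (hyp_point p)\<bar> \<noteq> 1 / 2 \<and> norm (hyp_point p) \<noteq> 1"
  proof (rule lborel_pair.AE_pair_measure[rotated])
    show "{p \<in> space (lborel \<Otimes>\<^sub>M lborel). \<bar>Re (hyp_point p)\<bar> \<noteq> 1 / 2 \<and> norm (hyp_point p) \<noteq> 1} \<in> sets (lborel \<Otimes>\<^sub>M lborel)"
      by measurable
  qed
  then have "AE z in hyp_measure. \<bar>Re z\<bar> \<noteq> 1 / 2 \<and> norm z \<noteq> 1"
    unfolding hyp_measure_def by (subst AE_distr_iff) auto
  then show ?thesis
    by eventually_elim (auto simp: fundamental_domain_def fd_interior_def)
qed

lemma countable_SL2Z: "countable SL2Z"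
proof -
  have "SL2Z \<subseteq> SL2Z_pos \<union> uminus ` SL2Z_pos"
    using SL2Z_pos_cases by (auto simp: image_iff) (metis minus_minus)
  then show ?thesis
    using countable_SL2Z_pos by (meson countable_Un countable_image countable_subset)
qed

text \<open>Outside the countably many preimages of the boundary, null by invariance, every
  translate of z that lands in the fundamental domain lands in its interior. Two such matrices then
  differ by a sign, and \<open>SL2Z_pos\<close> contains one of each pair.\<close>

lemma AE_unique_translate:
  "AE z in hyp_measure. \<exists>!A. A \<in> SL2Z_pos \<and> act (sl2_inv A) z \<in> fundamental_domain"
proof -
  have "AE z in hyp_measure. \<forall>A\<in>SL2Z. act A z \<in> fundamental_domain \<longrightarrow> act A z \<in> fd_interior"
  proof (subst AE_ball_countable[OF countable_SL2Z], intro ballI)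
    fix A assume A: "A \<in> SL2Z"
    have "AE z in distr hyp_measure borel (act A). z \<in> fundamental_domain \<longrightarrow> z \<in> fd_interior"
      unfolding distr_hyp_measure_act[OF A] by (rule AE_fundamental_domain_interior)
    then show "AE z in hyp_measure. act A z \<in> fundamental_domain \<longrightarrow> act A z \<in> fd_interior"
      by (rule AE_distrD[rotated]) auto
  qed
  with AE_hyp_measure_Im show ?thesis
  proof eventually_elim
    fix z assume z: "Im z > 0" and int: "\<forall>A\<in>SL2Z. act A z \<in> fundamental_domain \<longrightarrow> act A z \<in> fd_interior"
    obtain B where B: "B \<in> SL2Z" "act B z \<in> fundamental_domain"
      using act_fundamental_domain[OF z] by blast
    have invinv: "sl2_inv (sl2_inv B) = B" by (simp add: matrix_2_eq_iff)
    have "\<exists>A. A \<in> SL2Z_pos \<and> act (sl2_inv A) z \<in> fundamental_domain"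
    proof (cases "sl2_inv B \<in> SL2Z_pos")
      case True
      then show ?thesis using B invinv by (intro exI[of _ "sl2_inv B"]) simp
    next
      case False
      then have "- sl2_inv B \<in> SL2Z_pos" using SL2Z_pos_cases[OF SL2Z_inv[OF B(1)]] by blast
      moreover have "sl2_inv (- sl2_inv B) = - B" by (simp add: matrix_2_eq_iff)
      ultimately show ?thesis using B by (intro exI[of _ "- sl2_inv B"]) (simp add: act_uminus)
    qed
    moreover have "A = A'"
      if A: "A \<in> SL2Z_pos" "act (sl2_inv A) z \<in> fundamental_domain"
        and A': "A' \<in> SL2Z_pos" "act (sl2_inv A') z \<in> fundamental_domain" for A A'
    proof -
      have sl: "A \<in> SL2Z" "A' \<in> SL2Z" using A A' by (auto intro: SL2Z_pos_SL2Z)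
      have "act (sl2_inv A' ** A) (act (sl2_inv A) z) = act (sl2_inv A') z"
        using sl z by (simp add: act_mult SL2Z_inv Im_act_pos act_act_inv)
      then have "sl2_inv A' ** A = mat 1 \<or> sl2_inv A' ** A = - mat 1"
        using int A A' sl
        by (intro fd_interior_unique[of "act (sl2_inv A) z"]) (auto simp: SL2Z_mult SL2Z_inv)
      then have "A' ** (sl2_inv A' ** A) = A' \<or> A' ** (sl2_inv A' ** A) = - A'"
        by (auto simp: matrix_2_eq_iff matrix_mult_2 mat_def)
      moreover have "A' ** (sl2_inv A' ** A) = A"
        using sl by (simp add: matrix_mul_assoc sl2_inv_mult)
      ultimately show ?thesis using A A' SL2Z_pos_uminus by auto
    qed
    ultimately show "\<exists>!A. A \<in> SL2Z_pos \<and> act (sl2_inv A) z \<in> fundamental_domain" by blast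
  qed
qed

lemma nn_integral_count_space_swap:
  assumes A: "countable A" and M: "sigma_finite_measure M"
    and f: "\<And>a. a \<in> A \<Longrightarrow> f a \<in> borel_measurable M"
  shows "(\<integral>\<^sup>+x. (\<integral>\<^sup>+a. f a x \<partial>count_space A) \<partial>M) = (\<integral>\<^sup>+a. (\<integral>\<^sup>+x. f a x \<partial>M) \<partial>count_space A)"
proof -
  interpret M: sigma_finite_measure M by fact
  interpret C: sigma_finite_measure "count_space A"
    by (simp add: A sigma_finite_measure_count_space_countable)
  interpret P: pair_sigma_finite "count_space A" M ..
  have "(\<lambda>(a, x). f a x) \<in> borel_measurable (count_space A \<Otimes>\<^sub>M M)"
    by (intro measurable_pair_measure_countable1 A) (simp add: f)
  from P.Fubini'[OF this] show ?thesis .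
qed

lemma measurable_fundamental_domain [measurable]: "fundamental_domain \<in> sets borel"
  unfolding fundamental_domain_def by measurable

text \<open>Term by term: \<open>?X A\<close> has z in the fundamental domain and k at A z, and it
  is \<open>?Y A\<close> composed with A, so invariance equates their integrals. Summed over A, the
  \<open>?Y A\<close> tile the half plane and give back k on the strip. Measurability of S on the
  domain comes out of the same exchange of sum and integral.\<close>

lemma unfold_to_strip:
  fixes k :: "complex \<Rightarrow> complex"
  assumes [measurable]: "k \<in> borel_measurable borel"
    and fin: "(\<integral>\<^sup>+z. ennreal (norm (indicator strip z *\<^sub>R k z)) \<partial>hyp_measure) < \<infinity>"
  defines "S \<equiv> \<lambda>z. \<Sum>\<^sub>\<infinity>A\<in>SL2Z_pos. if act A z \<in> strip then k (act A z) else 0"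
  shows "(\<lambda>z. indicator fundamental_domain z *\<^sub>R S z) \<in> borel_measurable borel"
    and "(LINT z|hyp_measure. indicator fundamental_domain z *\<^sub>R S z) = (LINT z|hyp_measure. indicator strip z *\<^sub>R k z)"
proof -
  have [measurable]: "strip \<in> sets borel" by measurable
  define k' where "k' z = indicator strip z *\<^sub>R k z" for z
  have [measurable]: "k' \<in> borel_measurable borel" unfolding k'_def by measurable
  let ?X = "\<lambda>A z. indicator fundamental_domain z *\<^sub>R k' (act A z)"
  let ?Y = "\<lambda>A z. indicator fundamental_domain (act (sl2_inv A) z) *\<^sub>R k' z"
  have XY: "AE z in hyp_measure. ?X A z = ?Y A (act A z)" if "A \<in> SL2Z_pos" for A
    using AE_hyp_measure_Im by eventually_elim (simp add: act_inv_act SL2Z_pos_SL2Z that)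
  have nnXY: "(\<integral>\<^sup>+z. ennreal (norm (?X A z)) \<partial>hyp_measure) = (\<integral>\<^sup>+z. ennreal (norm (?Y A z)) \<partial>hyp_measure)"
    if A: "A \<in> SL2Z_pos" for A
  proof -
    have "(\<integral>\<^sup>+z. ennreal (norm (?X A z)) \<partial>hyp_measure) = (\<integral>\<^sup>+z. ennreal (norm (?Y A (act A z))) \<partial>hyp_measure)"
      using XY[OF A] by (intro nn_integral_cong_AE) auto
    also have "\<dots> = (\<integral>\<^sup>+z. ennreal (norm (?Y A z)) \<partial>hyp_measure)"
      by (rule nn_integral_hyp_measure_act[where f="\<lambda>z. ennreal (norm (?Y A z))"]) (use A in \<open>auto simp: SL2Z_pos_SL2Z\<close>)
    finally show ?thesis .
  qed
  have intXY: "(LINT z|hyp_measure. ?X A z) = (LINT z|hyp_measure. ?Y A z)" if A: "A \<in> SL2Z_pos" for A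
  proof -
    have "(LINT z|hyp_measure. ?X A z) = (LINT z|hyp_measure. ?Y A (act A z))"
      using XY[OF A] by (intro integral_cong_AE) auto
    also have "\<dots> = (LINT z|distr hyp_measure borel (act A). ?Y A z)"
      by (rule integral_distr[symmetric]) auto
    finally show ?thesis by (simp add: distr_hyp_measure_act SL2Z_pos_SL2Z[OF A])
  qed
  \<comment> \<open>Almost everywhere exactly one A contributes, so the total mass is that of k on
    the strip. Tonelli and \<open>nnXY\<close> then carry finiteness over to
    \<open>?X\<close>.\<close>
  have finY: "(\<integral>\<^sup>+z. (\<integral>\<^sup>+A. ennreal (norm (?Y A z)) \<partial>count_space SL2Z_pos) \<partial>hyp_measure) < \<infinity>"
  proof -
    have "AE z in hyp_measure. (\<integral>\<^sup>+A. ennreal (norm (?Y A z)) \<partial>count_space SL2Z_pos) = ennreal (norm (k' z))"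
      using AE_unique_translate
    proof eventually_elim
      fix z assume "\<exists>!A. A \<in> SL2Z_pos \<and> act (sl2_inv A) z \<in> fundamental_domain"
      then obtain A0 where A0: "A0 \<in> SL2Z_pos" "act (sl2_inv A0) z \<in> fundamental_domain"
        "\<And>A. A \<in> SL2Z_pos \<Longrightarrow> act (sl2_inv A) z \<in> fundamental_domain \<Longrightarrow> A = A0" by blast
      have ind: "indicator fundamental_domain (act (sl2_inv A) z) = (indicator {A0} A :: real)" if "A \<in> SL2Z_pos" for A
      proof -
        have "act (sl2_inv A) z \<in> fundamental_domain \<longleftrightarrow> A = A0" using A0(2) A0(3)[OF that] by blast
        then show ?thesis by (simp add: indicator_def)
      qed
      have "(\<integral>\<^sup>+A. ennreal (norm (?Y A z)) \<partial>count_space SL2Z_pos) =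
        (\<integral>\<^sup>+A. ennreal (norm (k' z)) * indicator {A0} A \<partial>count_space SL2Z_pos)"
        by (intro nn_integral_cong) (simp add: ind, simp add: indicator_def)
      also have "\<dots> = ennreal (norm (k' z))"
        using A0(1) by (subst nn_integral_cmult_indicator) auto
      finally show "(\<integral>\<^sup>+A. ennreal (norm (?Y A z)) \<partial>count_space SL2Z_pos) = ennreal (norm (k' z))" .
    qed
    then have "(\<integral>\<^sup>+z. (\<integral>\<^sup>+A. ennreal (norm (?Y A z)) \<partial>count_space SL2Z_pos) \<partial>hyp_measure) =
      (\<integral>\<^sup>+z. ennreal (norm (k' z)) \<partial>hyp_measure)"
      by (rule nn_integral_cong_AE)
    then show ?thesis using fin by (simp add: k'_def)
  qed
  have finX: "(\<integral>\<^sup>+z. (\<integral>\<^sup>+A. ennreal (norm (?X A z)) \<partial>count_space SL2Z_pos) \<partial>hyp_measure) < \<infinity>"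
  proof -
    have "(\<integral>\<^sup>+z. (\<integral>\<^sup>+A. ennreal (norm (?X A z)) \<partial>count_space SL2Z_pos) \<partial>hyp_measure) =
      (\<integral>\<^sup>+A. (\<integral>\<^sup>+z. ennreal (norm (?X A z)) \<partial>hyp_measure) \<partial>count_space SL2Z_pos)"
      by (intro nn_integral_count_space_swap countable_SL2Z_pos sigma_finite_hyp_measure) auto
    also have "\<dots> = (\<integral>\<^sup>+A. (\<integral>\<^sup>+z. ennreal (norm (?Y A z)) \<partial>hyp_measure) \<partial>count_space SL2Z_pos)"
      by (rule nn_integral_cong) (simp only: nnXY space_count_space)
    also have "\<dots> = (\<integral>\<^sup>+z. (\<integral>\<^sup>+A. ennreal (norm (?Y A z)) \<partial>count_space SL2Z_pos) \<partial>hyp_measure)"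
      by (intro nn_integral_count_space_swap[symmetric] countable_SL2Z_pos sigma_finite_hyp_measure) auto
    finally show ?thesis using finY by simp
  qed
  have SX: "indicator fundamental_domain z *\<^sub>R S z = (\<Sum>\<^sub>\<infinity>A\<in>SL2Z_pos. ?X A z)" for z
    unfolding S_def k'_def
    by (cases "z \<in> fundamental_domain") (auto simp: indicator_def intro!: infsum_cong)
  note X = integral_infsum[OF countable_SL2Z_pos sigma_finite_hyp_measure _ finX]
  note Y = integral_infsum[OF countable_SL2Z_pos sigma_finite_hyp_measure _ finY]
  have "integrable hyp_measure (\<lambda>z. \<Sum>\<^sub>\<infinity>A\<in>SL2Z_pos. ?X A z)"
    by (rule X) auto
  then show "(\<lambda>z. indicator fundamental_domain z *\<^sub>R S z) \<in> borel_measurable borel"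
    unfolding SX using borel_measurable_integrable by fastforce
  have "(LINT z|hyp_measure. indicator fundamental_domain z *\<^sub>R S z) = (\<Sum>\<^sub>\<infinity>A\<in>SL2Z_pos. LINT z|hyp_measure. ?X A z)"
    unfolding SX by (rule X) auto
  also have "\<dots> = (\<Sum>\<^sub>\<infinity>A\<in>SL2Z_pos. LINT z|hyp_measure. ?Y A z)"
    by (intro infsum_cong intXY)
  also have "\<dots> = (LINT z|hyp_measure. (\<Sum>\<^sub>\<infinity>A\<in>SL2Z_pos. ?Y A z))"
    by (rule Y(4)[symmetric]) auto
  also have "\<dots> = (LINT z|hyp_measure. k' z)"
  proof (rule integral_cong_AE)
    show "(\<lambda>z. \<Sum>\<^sub>\<infinity>A\<in>SL2Z_pos. ?Y A z) \<in> borel_measurable hyp_measure"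
      by (rule borel_measurable_integrable, rule Y) auto
    show "AE z in hyp_measure. (\<Sum>\<^sub>\<infinity>A\<in>SL2Z_pos. ?Y A z) = k' z"
      using AE_unique_translate
    proof eventually_elim
      fix z assume "\<exists>!A. A \<in> SL2Z_pos \<and> act (sl2_inv A) z \<in> fundamental_domain"
      then obtain A0 where A0: "A0 \<in> SL2Z_pos" "act (sl2_inv A0) z \<in> fundamental_domain"
        "\<And>A. A \<in> SL2Z_pos \<Longrightarrow> act (sl2_inv A) z \<in> fundamental_domain \<Longrightarrow> A = A0" by blast
      have ind: "indicator fundamental_domain (act (sl2_inv A) z) = (indicator {A0} A :: real)" if "A \<in> SL2Z_pos" for A
      proof -
        have "act (sl2_inv A) z \<in> fundamental_domain \<longleftrightarrow> A = A0" using A0(2) A0(3)[OF that] by blast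
        then show ?thesis by (simp add: indicator_def)
      qed
      have "(\<Sum>\<^sub>\<infinity>A\<in>SL2Z_pos. ?Y A z) = (\<Sum>\<^sub>\<infinity>A\<in>{A0}. ?Y A z)"
        using A0(1) by (intro infsum_cong_neutral) (auto simp: ind)
      then show "(\<Sum>\<^sub>\<infinity>A\<in>SL2Z_pos. ?Y A z) = k' z" using A0(2) by simp
    qed
  qed auto
  finally show "(LINT z|hyp_measure. indicator fundamental_domain z *\<^sub>R S z) = (LINT z|hyp_measure. indicator strip z *\<^sub>R k z)"
    by (simp add: k'_def)
qed

section \<open>Parseval\<close>

definition ex :: "int \<Rightarrow> real \<Rightarrow> complex" where
  "ex k x = exp (2 * of_real pi * \<i> * of_int k * of_real x)"

lemma norm_ex [simp]: "norm (ex k x) = 1"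
  by (simp add: ex_def)

lemma ex_mult: "ex k x * ex m x = ex (k + m) x"
  unfolding ex_def exp_add[symmetric] by (simp add: algebra_simps)

lemma cnj_ex: "cnj (ex k x) = ex (- k) x"
  by (simp add: ex_def exp_cnj)

lemma measurable_ex [measurable]: "ex k \<in> borel_measurable borel"
  unfolding ex_def by measurable

lemma measurable_cnj [measurable (raw)]:
  "f \<in> borel_measurable M \<Longrightarrow> (\<lambda>x. cnj (f x)) \<in> borel_measurable M"
  by (rule measurable_compose[where g=cnj])
     (auto intro!: borel_measurable_continuous_onI continuous_intros)

lemma integral_ex: "(LINT x:{0..1}|lborel. ex k x) = (if k = 0 then 1 else 0)"
proof (cases "k = 0")
  case True
  then show ?thesis by (simp add: ex_def set_lebesgue_integral_def)
next
  case False
  define q where "q = 2 * of_real pi * \<i> * complex_of_int k"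
  have q: "q \<noteq> 0" using False by (simp add: q_def)
  have "(LINT x|lborel. indicator {0..1::real} x *\<^sub>R ex k x) = exp (q * of_real 1) / q - exp (q * of_real 0) / q"
  proof (rule integral_FTC_atLeastAtMost)
    show "((\<lambda>x. exp (q * of_real x) / q) has_vector_derivative ex k x) (at x within {0..1})" for x
    proof -
      have "((\<lambda>z. exp (q * z) / q) has_field_derivative exp (q * of_real x)) (at (of_real x))"
        using q by (auto intro!: derivative_eq_intros)
      from has_vector_derivative_real_field[OF this]
      show ?thesis by (simp add: ex_def q_def o_def has_vector_derivative_at_within)
    qed
    show "continuous_on {0..1} (ex k)"
      unfolding ex_def by (intro continuous_intros)
  qed simp
  also have "exp (q * of_real 1) = 1"
    using exp_integer_2pi[of "of_int k"] by (simp add: q_def mult_ac)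
  finally show ?thesis using False by (simp add: set_lebesgue_integral_def)
qed

lemma nn_integral_count_space_norm:
  fixes a :: "'a \<Rightarrow> 'b :: {banach, second_countable_topology}"
  assumes "(\<lambda>m. norm (a m)) summable_on X"
  shows "(\<integral>\<^sup>+m. ennreal (norm (a m)) \<partial>count_space X) = ennreal (infsum (\<lambda>m. norm (a m)) X)"
proof -
  have "Infinite_Set_Sum.abs_summable_on (\<lambda>m. norm (a m)) X"
    using assms abs_summable_equivalent[of "\<lambda>m. norm (a m)" X] by simp
  then show ?thesis by (simp add: nn_integral_conv_infsetsum infsetsum_infsum)
qed

section \<open>Absolutely convergent Fourier series on the unit interval\<close>

context
  fixes a :: "int \<Rightarrow> complex" and g :: "real \<Rightarrow> complex" and X :: "int set"
  assumes summ: "(\<lambda>m. norm (a m)) summable_on X"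
    and sums: "\<And>x. ((\<lambda>m. a m * ex m x) has_sum g x) X"
    and g [measurable]: "g \<in> borel_measurable borel"
begin

private lemma trig_norm_le: "norm (g x) \<le> infsum (\<lambda>m. norm (a m)) X"
  by (rule norm_infsum_le[OF sums[of x] has_sum_infsum[OF summ]]) (simp add: norm_mult)

private lemma trig_exchange:
  fixes b :: "int \<Rightarrow> complex" and f :: "int \<Rightarrow> real \<Rightarrow> complex" and B :: real
  assumes b: "(\<lambda>m. norm (b m)) summable_on X"
    and f [measurable]: "\<And>m. f m \<in> borel_measurable borel" and fB: "\<And>m x. norm (f m x) \<le> B"
  shows "(LINT x:{0..1}|lborel. (\<Sum>\<^sub>\<infinity>m\<in>X. b m * f m x)) = (\<Sum>\<^sub>\<infinity>m\<in>X. b m * (LINT x:{0..1}|lborel. f m x))"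
proof -
  have B: "B \<ge> 0" using fB[of 0 0] norm_ge_zero order_trans by blast
  have "(LINT x:{0..1}|lborel. (\<Sum>\<^sub>\<infinity>m\<in>X. b m * f m x)) =
      (LINT x|lborel. (\<Sum>\<^sub>\<infinity>m\<in>X. indicator {0..1::real} x *\<^sub>R (b m * f m x)))"
    unfolding set_lebesgue_integral_def
    by (intro Bochner_Integration.integral_cong) (auto simp: indicator_def)
  also have "\<dots> = (\<Sum>\<^sub>\<infinity>m\<in>X. LINT x|lborel. indicator {0..1::real} x *\<^sub>R (b m * f m x))"
  proof (rule integral_infsum(4))
    have "(\<integral>\<^sup>+x. (\<integral>\<^sup>+m. ennreal (norm (indicator {0..1::real} x *\<^sub>R (b m * f m x))) \<partial>count_space X) \<partial>lborel)
      \<le> (\<integral>\<^sup>+x. ennreal (B * infsum (\<lambda>m. norm (b m)) X) * indicator {0..1::real} x \<partial>lborel)"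
    proof (rule nn_integral_mono)
      fix x :: real
      have "(\<integral>\<^sup>+m. ennreal (norm (indicator {0..1::real} x *\<^sub>R (b m * f m x))) \<partial>count_space X)
        \<le> (\<integral>\<^sup>+m. ennreal (B * indicator {0..1::real} x) * ennreal (norm (b m)) \<partial>count_space X)"
      proof (rule nn_integral_mono)
        fix m
        have "norm (b m) * norm (f m x) \<le> norm (b m) * B" by (intro mult_left_mono fB) simp
        then show "ennreal (norm (indicator {0..1::real} x *\<^sub>R (b m * f m x))) \<le> ennreal (B * indicator {0..1::real} x) * ennreal (norm (b m))"
          using B by (auto simp: norm_mult indicator_def mult.commute simp flip: ennreal_mult intro!: ennreal_leI)
      qed
      also have "\<dots> = ennreal (B * indicator {0..1::real} x) * ennreal (infsum (\<lambda>m. norm (b m)) X)"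
        by (subst nn_integral_cmult) (auto simp: nn_integral_count_space_norm[OF b])
      also have "\<dots> = ennreal (B * infsum (\<lambda>m. norm (b m)) X) * indicator {0..1::real} x"
        using B by (auto simp: indicator_def ennreal_mult' infsum_nonneg)
      finally show "(\<integral>\<^sup>+m. ennreal (norm (indicator {0..1::real} x *\<^sub>R (b m * f m x))) \<partial>count_space X)
        \<le> ennreal (B * infsum (\<lambda>m. norm (b m)) X) * indicator {0..1::real} x" .
    qed
    also have "\<dots> < \<infinity>"
      by (subst nn_integral_cmult_indicator) (auto simp: emeasure_lborel_Icc_eq)
    finally show "(\<integral>\<^sup>+x. (\<integral>\<^sup>+m. ennreal (norm (indicator {0..1::real} x *\<^sub>R (b m * f m x))) \<partial>count_space X) \<partial>lborel) < \<infinity>" .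
  qed (auto intro: sigma_finite_lborel)
  also have "\<dots> = (\<Sum>\<^sub>\<infinity>m\<in>X. b m * (LINT x:{0..1}|lborel. f m x))"
    unfolding set_lebesgue_integral_def integral_mult_right_zero[symmetric] by simp
  finally show ?thesis .
qed

lemma fourier_coefficient:
  "(LINT x:{0..1}|lborel. g x * ex k x) = (if - k \<in> X then a (- k) else 0)"
proof -
  have "(\<lambda>x. g x * ex k x) = (\<lambda>x. \<Sum>\<^sub>\<infinity>m\<in>X. a m * ex (m + k) x)"
  proof
    fix x
    have "((\<lambda>m. a m * ex m x * ex k x) has_sum g x * ex k x) X"
      by (rule has_sum_cmult_left[OF sums])
    then show "g x * ex k x = (\<Sum>\<^sub>\<infinity>m\<in>X. a m * ex (m + k) x)"
      by (simp add: mult.assoc ex_mult infsumI)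
  qed
  then have "(LINT x:{0..1}|lborel. g x * ex k x) = (LINT x:{0..1}|lborel. (\<Sum>\<^sub>\<infinity>m\<in>X. a m * ex (m + k) x))"
    by simp
  also have "\<dots> = (\<Sum>\<^sub>\<infinity>m\<in>X. a m * (LINT x:{0..1}|lborel. ex (m + k) x))"
    by (rule trig_exchange[OF summ, where B=1]) auto
  also have "\<dots> = (\<Sum>\<^sub>\<infinity>m\<in>X \<inter> {- k}. a m)"
    unfolding integral_ex by (intro infsum_cong_neutral) auto
  also have "\<dots> = (if - k \<in> X then a (- k) else 0)"
    by simp
  finally show ?thesis .
qed

text \<open>Only the conjugate factor is expanded; against each of its modes there remains a Fourier
  coefficient of g, so a single series appears. The last step renames m = n + k.\<close>

lemma parseval:
  "(LINT x:{0..1}|lborel. g x * cnj (g x) * ex k x) = (\<Sum>\<^sub>\<infinity>n\<in>{n \<in> X. n + k \<in> X}. a n * cnj (a (n + k)))"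
proof -
  have "(\<lambda>x. g x * cnj (g x) * ex k x) = (\<lambda>x. \<Sum>\<^sub>\<infinity>m\<in>X. cnj (a m) * (g x * ex (k - m) x))"
  proof
    fix x
    have "((\<lambda>m. cnj (a m * ex m x)) has_sum cnj (g x)) X"
      using sums[of x] by (rule has_sum_cnj_iff[THEN iffD2])
    then have "((\<lambda>m. cnj (a m * ex m x) * (g x * ex k x)) has_sum cnj (g x) * (g x * ex k x)) X"
      by (rule has_sum_cmult_left)
    moreover have "cnj (a m * ex m x) * (g x * ex k x) = cnj (a m) * (g x * ex (k - m) x)" for m
      using ex_mult[of "- m" x k] by (simp add: cnj_ex mult_ac)
    ultimately have "((\<lambda>m. cnj (a m) * (g x * ex (k - m) x)) has_sum cnj (g x) * (g x * ex k x)) X"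
      by (simp only:)
    from infsumI[OF this] show "g x * cnj (g x) * ex k x = (\<Sum>\<^sub>\<infinity>m\<in>X. cnj (a m) * (g x * ex (k - m) x))"
      by (simp only: mult_ac)
  qed
  then have "(LINT x:{0..1}|lborel. g x * cnj (g x) * ex k x) =
      (LINT x:{0..1}|lborel. (\<Sum>\<^sub>\<infinity>m\<in>X. cnj (a m) * (g x * ex (k - m) x)))" by simp
  also have "\<dots> = (\<Sum>\<^sub>\<infinity>m\<in>X. cnj (a m) * (LINT x:{0..1}|lborel. g x * ex (k - m) x))"
    by (rule trig_exchange[where B="infsum (\<lambda>m. norm (a m)) X"]) (auto simp: norm_mult summ intro: trig_norm_le)
  also have "\<dots> = (\<Sum>\<^sub>\<infinity>m\<in>{m \<in> X. m - k \<in> X}. a (m - k) * cnj (a m))"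
    unfolding fourier_coefficient by (intro infsum_cong_neutral) auto
  also have "\<dots> = (\<Sum>\<^sub>\<infinity>n\<in>{n \<in> X. n + k \<in> X}. a n * cnj (a (n + k)))"
    by (rule infsum_reindex_bij_witness[of _ "\<lambda>n. n + k" "\<lambda>m. m - k"]) auto
  finally show ?thesis .
qed

text \<open>Parseval at k = 0, the integrand being at most B^2 on an interval of length 1. For a
  bounded \<phi> this is uniform in the height y.\<close>

lemma sum_norm_square_le:
  assumes B: "\<And>x. norm (g x) \<le> B"
  shows "(\<lambda>n. (norm (a n))\<^sup>2) summable_on X" and "infsum (\<lambda>n. (norm (a n))\<^sup>2) X \<le> B\<^sup>2"
proof -
  define S where "S = infsum (\<lambda>m. norm (a m)) X"
  have le: "norm (a n) \<le> S" if "n \<in> X" for n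
    unfolding S_def using finite_sum_le_infsum[OF summ, of "{n}"] that by simp
  show sq: "(\<lambda>n. (norm (a n))\<^sup>2) summable_on X"
  proof (rule summable_on_comparison_test)
    show "(\<lambda>n. S * norm (a n)) summable_on X" by (intro summable_on_cmult_right summ)
    show "(norm (a n))\<^sup>2 \<le> S * norm (a n)" if "n \<in> X" for n
      using le[OF that] by (simp add: power2_eq_square mult_right_mono)
  qed auto
  have B0: "B \<ge> 0" using B[of 0] norm_ge_zero order_trans by blast
  have "complex_of_real (infsum (\<lambda>n. (norm (a n))\<^sup>2) X) = (\<Sum>\<^sub>\<infinity>n\<in>X. of_real ((norm (a n))\<^sup>2))"
    by (rule infsumI[OF has_sum_of_real_iff[THEN iffD2, OF has_sum_infsum[OF sq]], symmetric])
  also have "\<dots> = (\<Sum>\<^sub>\<infinity>n\<in>{n \<in> X. n + 0 \<in> X}. a n * cnj (a (n + 0)))"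
    by (simp add: complex_norm_square del: of_real_power)
  also have "\<dots> = (LINT x:{0..1}|lborel. g x * cnj (g x) * ex 0 x)"
    by (rule parseval[symmetric])
  finally have "infsum (\<lambda>n. (norm (a n))\<^sup>2) X \<le> norm (LINT x:{0..1}|lborel. g x * cnj (g x) * ex 0 x)"
    by (metis abs_ge_self norm_of_real)
  also have "\<dots> \<le> (LINT x|lborel. B\<^sup>2 * indicator {0..1::real} x)"
    unfolding set_lebesgue_integral_def
  proof (rule Bochner_Integration.integral_norm_bound_integral)
    show i: "integrable lborel (\<lambda>x. B\<^sup>2 * indicator {0..1::real} x :: real)"
      by (intro integrable_mult_right, subst integrable_indicator_iff) (auto simp: emeasure_lborel_Icc_eq)
    have le2: "norm (indicator {0..1::real} x *\<^sub>R (g x * cnj (g x) * ex 0 x)) \<le> B\<^sup>2 * indicator {0..1::real} x" for x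
      using mult_mono[OF B B B0 norm_ge_zero, of x x] by (auto simp: indicator_def norm_mult power2_eq_square)
    show "integrable lborel (\<lambda>x. indicator {0..1::real} x *\<^sub>R (g x * cnj (g x) * ex 0 x))"
      by (rule Bochner_Integration.integrable_bound[OF i]) (use le2 in \<open>auto intro!: AE_I2 intro: order.trans[OF _ abs_ge_self] simp del: norm_scaleR\<close>)
    show "norm (indicator {0..1::real} x *\<^sub>R (g x * cnj (g x) * ex 0 x)) \<le> B\<^sup>2 * indicator {0..1::real} x" for x
      by (rule le2)
  qed
  also have "\<dots> = B\<^sup>2" by simp
  finally show "infsum (\<lambda>n. (norm (a n))\<^sup>2) X \<le> B\<^sup>2" .
qed

end

section \<open>The cusp form\<close>

text \<open>Any point can be moved into the fundamental domain, which lies above height 4/5, where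
  the Fourier expansion gives a bound; \<phi> does not change under the move.\<close>

lemma maass_bounded:
  assumes m: "maass_cusp_form \<mu> \<phi>" and f: "has_fourier_expansion \<phi> r c"
  shows "\<exists>B\<ge>0. \<forall>z. Im z > 0 \<longrightarrow> norm (\<phi> z) \<le> B"
proof -
  obtain B where B: "\<And>z. Im z \<ge> 4 / 5 \<Longrightarrow> norm (\<phi> z) \<le> B"
    using fourier_bounded_high[OF f] by blast
  have "norm (\<phi> z) \<le> B" if z: "Im z > 0" for z
  proof -
    obtain A where A: "A \<in> SL2Z" "act A z \<in> fundamental_domain"
      using act_fundamental_domain[OF z] by blast
    have "\<phi> z = \<phi> (act A z)"
      using m A(1) z by (simp add: maass_cusp_form_def upper_half_plane_def)
    then show ?thesis using B[OF fundamental_domain_Im[OF A(2)]] by simp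
  qed
  moreover have "B \<ge> 0" using order.trans[OF norm_ge_zero B[of \<i>]] by simp
  ultimately show ?thesis by blast
qed

lemma maass_continuous:
  assumes "maass_cusp_form \<mu> \<phi>"
  shows "continuous_on upper_half_plane \<phi>"
proof -
  have "C_k 0 \<phi>" using assms unfolding maass_cusp_form_def by blast
  then show ?thesis by simp
qed

context
  fixes \<mu> :: complex and \<phi> :: "complex \<Rightarrow> complex" and r B :: real and c :: "int \<Rightarrow> complex"
  assumes m: "maass_cusp_form \<mu> \<phi>" and f: "has_fourier_expansion \<phi> r c"
    and B: "\<And>z. Im z > 0 \<Longrightarrow> norm (\<phi> z) \<le> B"
begin

lemma measurable_maass_horizontal:
  assumes "y > 0"
  shows "(\<lambda>x. \<phi> (Complex x y)) \<in> borel_measurable borel"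
proof -
  have "continuous_on UNIV (\<lambda>x. \<phi> (Complex x y))"
    using assms by (intro continuous_on_compose2[OF maass_continuous[OF m]])
      (auto simp: upper_half_plane_def complex_eq intro!: continuous_intros)
  then show ?thesis by (rule borel_measurable_continuous_onI)
qed

lemma maass_parseval:
  assumes y: "y > 0"
  shows "(LINT x:{0..1}|lborel. \<phi> (Complex x y) * cnj (\<phi> (Complex x y)) * ex k x) =
      (\<Sum>\<^sub>\<infinity>n\<in>{n. n \<noteq> 0 \<and> n + k \<noteq> 0}. whitt r c y n * cnj (whitt r c y (n + k)))"
    and "(\<lambda>n. (norm (whitt r c y n))\<^sup>2) summable_on (- {0})"
    and "infsum (\<lambda>n. (norm (whitt r c y n))\<^sup>2) (- {0}) \<le> B\<^sup>2"
proof -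
  have sums: "((\<lambda>m. whitt r c y m * ex m x) has_sum \<phi> (Complex x y)) (- {0})" for x
    using fourier_has_sum[OF f y, of x] by (simp add: ex_def)
  note P = whitt_abs_summable[OF f y] sums measurable_maass_horizontal[OF y]
  have "{n \<in> - {0}. n + k \<in> - {0}} = {n. n \<noteq> 0 \<and> n + k \<noteq> 0}" by auto
  then show "(LINT x:{0..1}|lborel. \<phi> (Complex x y) * cnj (\<phi> (Complex x y)) * ex k x) =
      (\<Sum>\<^sub>\<infinity>n\<in>{n. n \<noteq> 0 \<and> n + k \<noteq> 0}. whitt r c y n * cnj (whitt r c y (n + k)))"
    using parseval[OF P, of k] by simp
  show "(\<lambda>n. (norm (whitt r c y n))\<^sup>2) summable_on (- {0})"
    using y by (intro sum_norm_square_le(1)[OF P, of B] B) simp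
  show "infsum (\<lambda>n. (norm (whitt r c y n))\<^sup>2) (- {0}) \<le> B\<^sup>2"
    using y by (intro sum_norm_square_le(2)[OF P, of B] B) simp
qed

text \<open>
  The Parseval bound holds at every height \<open>y = e\<^sup>l\<close>; it is integrated against \<open>exp (\<delta> l) dl\<close> over \<open>l \<le> L\<close>, keeping for
  each \<open>n\<close> only the window \<open>I n\<close> on which \<open>\<bar>n\<bar>y\<close> is comparable to \<open>e\<^sup>L\<close>.
\<close>

lemma coeff_square_summable:
  assumes d: "\<delta> > 0"
  shows "(\<lambda>n. (norm (c n))\<^sup>2 * \<bar>of_int n\<bar> powr (- 1 - \<delta>)) summable_on (- {0 :: int})"
proof -
  obtain A1 c0 where c0: "c0 > 0" and low: "\<And>A. A \<ge> A1 \<Longrightarrow> c0 * exp (- 2 * A) \<le> norm (bessel_K (\<i> * of_real r) A)"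
    using norm_bessel_K_ge by blast
  \<comment> \<open>Chosen so that exp(L - 1) >= A1: on a window of length 1 ending at L every
    Bessel argument is in the range of \<open>low\<close>, and c1 is a common lower bound.\<close>
  define L where "L = 1 + ln (max A1 1)"
  define c1 where "c1 = c0 * exp (- 2 * (2 * pi * exp L))"
  have c1: "c1 > 0" using c0 by (simp add: c1_def)
  have K: "c1 \<le> norm (bessel_K (\<i> * of_real r) (2 * pi * exp l))" if "L - 1 \<le> l" "l \<le> L" for l
  proof -
    have "max A1 1 = exp (L - 1)" by (simp add: L_def)
    also have "\<dots> \<le> exp l" using that by simp
    also have "1 * exp l \<le> 2 * pi * exp l" using pi_gt3 by (intro mult_right_mono) auto
    finally have "A1 \<le> 2 * pi * exp l" by simp
    from low[OF this] have "c0 * exp (- 2 * (2 * pi * exp l)) \<le> norm (bessel_K (\<i> * of_real r) (2 * pi * exp l))" .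
    moreover have "c1 \<le> c0 * exp (- 2 * (2 * pi * exp l))"
      unfolding c1_def using c0 that by (intro mult_left_mono) auto
    ultimately show ?thesis by linarith
  qed
  define \<kappa> where "\<kappa> = c1\<^sup>2 * exp ((1 + \<delta>) * (L - 1))"
  have \<kappa>: "\<kappa> > 0" using c1 by (simp add: \<kappa>_def)
  define I where "I n = {L - 1 - ln \<bar>real_of_int n\<bar>..L - ln \<bar>real_of_int n\<bar>}" for n
  have pt: "(norm (c n))\<^sup>2 * \<bar>of_int n\<bar> powr (- 1 - \<delta>) * \<kappa> * indicator (I n) l \<le>
      exp (\<delta> * l) * indicator {..L} l * (norm (whitt r c (exp l) n))\<^sup>2" if n: "n \<noteq> 0" for n l
  proof (cases "l \<in> I n")
    case True
    define N where "N = \<bar>real_of_int n\<bar>"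
    have N: "N \<ge> 1" using n unfolding N_def by linarith
    have lb: "L - 1 \<le> l + ln N" "l + ln N \<le> L" using True by (auto simp: I_def N_def)
    have "l \<le> L" using lb N ln_ge_zero[of N] by linarith
    have e: "2 * pi * N * exp l = 2 * pi * exp (l + ln N)" using N by (simp add: exp_add)
    have nw: "(norm (whitt r c (exp l) n))\<^sup>2 = (norm (c n))\<^sup>2 * exp l * (norm (bessel_K (\<i> * of_real r) (2 * pi * exp (l + ln N))))\<^sup>2"
      unfolding whitt_def N_def[symmetric] e by (simp add: norm_mult power_mult_distrib)
    have k: "c1\<^sup>2 \<le> (norm (bessel_K (\<i> * of_real r) (2 * pi * exp (l + ln N))))\<^sup>2"
      using K[OF lb] c1 by (intro power_mono) auto
    \<comment> \<open>On the window e^l is at least e^(L-1) / N. The exponent 1 + \<delta> combines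
      the weight exp(\<delta> l) with the factor y = e^l in the squared coefficient.\<close>
    have "N powr (- 1 - \<delta>) * exp ((1 + \<delta>) * (L - 1)) \<le> exp (\<delta> * l) * exp l"
    proof -
      have "N powr (- 1 - \<delta>) * exp ((1 + \<delta>) * (L - 1)) = exp ((1 + \<delta>) * (L - 1 - ln N))"
        using N by (simp add: powr_def algebra_simps flip: exp_add)
      also have "\<dots> \<le> exp ((1 + \<delta>) * l)" using lb d by (simp add: mult_left_mono)
      also have "\<dots> = exp (\<delta> * l) * exp l" by (simp add: algebra_simps flip: exp_add)
      finally show ?thesis .
    qed
    then have "(norm (c n))\<^sup>2 * ((N powr (- 1 - \<delta>) * exp ((1 + \<delta>) * (L - 1))) * c1\<^sup>2) \<le>
      (norm (c n))\<^sup>2 * ((exp (\<delta> * l) * exp l) * (norm (bessel_K (\<i> * of_real r) (2 * pi * exp (l + ln N))))\<^sup>2)"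
      using k by (rule mult_left_mono[OF mult_mono]) auto
    then show ?thesis using True \<open>l \<le> L\<close> by (simp add: nw \<kappa>_def N_def mult_ac)
  next
    case False
    then show ?thesis by simp
  qed
  define D where "D = B\<^sup>2 * exp (exp L) * Gamma \<delta>"
  have "(\<Sum>n\<in>F. (norm (c n))\<^sup>2 * \<bar>of_int n\<bar> powr (- 1 - \<delta>)) \<le> D / \<kappa>" if F: "finite F" "F \<subseteq> - {0}" for F
  proof -
    let ?t = "\<lambda>n. (norm (c n))\<^sup>2 * \<bar>of_int n\<bar> powr (- 1 - \<delta>) * \<kappa>"
    have ind: "integrable lborel (\<lambda>l. indicator (I n) l :: real)" for n
      by (subst integrable_indicator_iff) (auto simp: I_def emeasure_lborel_Icc_eq)
    have one: "(LINT l|lborel. indicator (I n) l) = (1 :: real)" for n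
      by (simp add: I_def)
    have "(\<Sum>n\<in>F. ?t n) = (\<Sum>n\<in>F. LINT l|lborel. ?t n * indicator (I n) l)"
      by (simp only: integral_mult_right_zero one mult_1_right)
    also have "\<dots> = (LINT l|lborel. (\<Sum>n\<in>F. ?t n * indicator (I n) l))"
      by (rule Bochner_Integration.integral_sum[symmetric]) (intro integrable_mult_right ind)
    also have "\<dots> \<le> (LINT l|lborel. B\<^sup>2 * exp (exp L) * exp (\<delta> * l - 1 * exp l))"
    proof (rule integral_mono)
      show "integrable lborel (\<lambda>l. \<Sum>n\<in>F. ?t n * indicator (I n) l)"
        by (intro Bochner_Integration.integrable_sum integrable_mult_right ind)
      show "integrable lborel (\<lambda>l. B\<^sup>2 * exp (exp L) * exp (\<delta> * l - 1 * exp l))"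
        using d by (intro integrable_mult_right integrable_Gamma_exp_scaled_real) auto
      fix l :: real
      have "(\<Sum>n\<in>F. ?t n * indicator (I n) l) \<le> (\<Sum>n\<in>F. exp (\<delta> * l) * indicator {..L} l * (norm (whitt r c (exp l) n))\<^sup>2)"
        using F by (intro sum_mono pt) auto
      also have "\<dots> = exp (\<delta> * l) * indicator {..L} l * (\<Sum>n\<in>F. (norm (whitt r c (exp l) n))\<^sup>2)"
        by (simp only: sum_distrib_left)
      also have "(\<Sum>n\<in>F. (norm (whitt r c (exp l) n))\<^sup>2) \<le> infsum (\<lambda>n. (norm (whitt r c (exp l) n))\<^sup>2) (- {0})"
        using F by (intro finite_sum_le_infsum maass_parseval) auto
      also have "\<dots> \<le> B\<^sup>2" by (rule maass_parseval) simp
      finally have "(\<Sum>n\<in>F. ?t n * indicator (I n) l) \<le> exp (\<delta> * l) * indicator {..L} l * B\<^sup>2"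
        by (simp add: mult_left_mono)
      \<comment> \<open>For l <= L the new exponential is at least 1; it replaces the cutoff and
        produces an Euler integral.\<close>
      also have "\<dots> \<le> exp (\<delta> * l) * exp (exp L - exp l) * B\<^sup>2"
        by (intro mult_right_mono mult_left_mono) (auto simp: indicator_def)
      also have "\<dots> = B\<^sup>2 * exp (exp L) * exp (\<delta> * l - 1 * exp l)"
        by (simp add: exp_diff field_simps)
      finally show "(\<Sum>n\<in>F. ?t n * indicator (I n) l) \<le> B\<^sup>2 * exp (exp L) * exp (\<delta> * l - 1 * exp l)" .
    qed
    also have "\<dots> = D"
      using integral_Gamma_exp_scaled_real[of \<delta> 1] d by (simp add: D_def)
    finally show ?thesis using \<kappa> unfolding sum_distrib_right[symmetric] by (simp add: pos_le_divide_eq)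
  qed
  then show ?thesis
    by (intro nonneg_bdd_above_summable_on bdd_aboveI2[where M="D / \<kappa>"]) auto
qed

end

lemma petersson_eq_hyp_measure:
  assumes S: "(\<lambda>z. indicator fundamental_domain z *\<^sub>R S z) \<in> borel_measurable borel"
    and eq: "\<And>z. z \<in> fundamental_domain \<Longrightarrow> f z * cnj (g z) = S z"
  shows "petersson f g = (LINT z|hyp_measure. indicator fundamental_domain z *\<^sub>R S z)"
proof -
  have [measurable]: "{z. Im z > 0} \<in> sets borel" by measurable
  have "petersson f g = (LINT z|lborel. (indicator {z. Im z > 0} z / (Im z)\<^sup>2) *\<^sub>R (indicator fundamental_domain z *\<^sub>R S z))"
    unfolding petersson_def set_lebesgue_integral_def
  proof (intro Bochner_Integration.integral_cong refl)
    fix z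
    show "indicator fundamental_domain z *\<^sub>R (f z * cnj (g z) / of_real ((Im z)\<^sup>2)) =
        (indicator {z. Im z > 0} z / (Im z)\<^sup>2) *\<^sub>R (indicator fundamental_domain z *\<^sub>R S z)"
    proof (cases "z \<in> fundamental_domain")
      case True
      then have "Im z > 0" by (simp add: fundamental_domain_def)
      then show ?thesis using True by (simp add: eq scaleR_conv_of_real)
    qed simp
  qed
  also have "\<dots> = (LINT z|hyp_measure. indicator fundamental_domain z *\<^sub>R S z)"
    unfolding hyp_measure_density using S by (subst integral_density) auto
  finally show ?thesis .
qed

lemma measurable_bessel_K_exp [measurable]:
  "(\<lambda>l. bessel_K (\<i> * of_real r) (\<alpha> * exp l)) \<in> borel_measurable borel"
  unfolding bessel_K_eq macK_def by measurable

text \<open>x y <= (x^2 + y^2) / 2, with n and n + h each running injectively through nonzero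
  integers. It is applied both to the Fourier coefficients at a fixed height and to the weighted c
  n.\<close>

lemma infsum_product_shift_le:
  fixes x :: "int \<Rightarrow> real" and h :: int
  assumes sq: "(\<lambda>n. (x n)\<^sup>2) summable_on (- {0})" and x: "\<And>n. x n \<ge> 0"
  defines "X \<equiv> {n. n \<noteq> 0 \<and> n + h \<noteq> 0}"
  shows "(\<lambda>n. x n * x (n + h)) summable_on X"
    and "infsum (\<lambda>n. x n * x (n + h)) X \<le> infsum (\<lambda>n. (x n)\<^sup>2) (- {0})"
proof -
  have sub: "X \<subseteq> - {0}" "(\<lambda>n. n + h) ` X \<subseteq> - {0}" by (auto simp: X_def)
  have inj: "inj_on (\<lambda>n. n + h) X" by (auto simp: inj_on_def)
  have s1: "(\<lambda>n. (x n)\<^sup>2) summable_on X" by (rule summable_on_subset[OF sq sub(1)])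
  have s2': "(\<lambda>n. (x n)\<^sup>2) summable_on ((\<lambda>n. n + h) ` X)" by (rule summable_on_subset[OF sq sub(2)])
  have s2: "(\<lambda>n. (x (n + h))\<^sup>2) summable_on X"
    using s2' by (subst (asm) summable_on_reindex[OF inj]) (simp add: o_def)
  have amgm: "x n * x (n + h) \<le> 1 / 2 * (x n)\<^sup>2 + 1 / 2 * (x (n + h))\<^sup>2" for n
    using sum_squares_bound[of "x n" "x (n + h)"] by simp
  have s12: "(\<lambda>n. 1 / 2 * (x n)\<^sup>2 + 1 / 2 * (x (n + h))\<^sup>2) summable_on X"
    by (intro summable_on_add summable_on_cmult_right s1 s2)
  show s: "(\<lambda>n. x n * x (n + h)) summable_on X"
    by (rule summable_on_comparison_test[OF s12]) (use amgm x in auto)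
  have "infsum (\<lambda>n. x n * x (n + h)) X \<le> infsum (\<lambda>n. 1 / 2 * (x n)\<^sup>2 + 1 / 2 * (x (n + h))\<^sup>2) X"
    by (rule infsum_mono[OF s s12 amgm])
  also have "\<dots> = 1 / 2 * infsum (\<lambda>n. (x n)\<^sup>2) X + 1 / 2 * infsum (\<lambda>n. (x (n + h))\<^sup>2) X"
    by (simp only: infsum_add[OF summable_on_cmult_right[OF s1] summable_on_cmult_right[OF s2]] infsum_cmult_right')
  also have "infsum (\<lambda>n. (x (n + h))\<^sup>2) X = infsum (\<lambda>n. (x n)\<^sup>2) ((\<lambda>n. n + h) ` X)"
    by (subst infsum_reindex[OF inj]) (simp add: o_def)
  also have "1 / 2 * infsum (\<lambda>n. (x n)\<^sup>2) X + 1 / 2 * infsum (\<lambda>n. (x n)\<^sup>2) ((\<lambda>n. n + h) ` X) \<le>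
    1 / 2 * infsum (\<lambda>n. (x n)\<^sup>2) (- {0}) + 1 / 2 * infsum (\<lambda>n. (x n)\<^sup>2) (- {0})"
    using sub by (intro add_mono mult_left_mono infsum_mono_neutral s1 s2' sq) auto
  finally show "infsum (\<lambda>n. x n * x (n + h)) X \<le> infsum (\<lambda>n. (x n)\<^sup>2) (- {0})" by simp
qed

section \<open>The unfolded inner product as a sum of Mellin-Barnes integrals\<close>

context
  fixes \<mu> :: complex and \<phi> :: "complex \<Rightarrow> complex" and r B :: real and c :: "int \<Rightarrow> complex"
    and h :: int and s :: complex
  assumes m: "maass_cusp_form \<mu> \<phi>" and f: "has_fourier_expansion \<phi> r c"
    and B: "\<And>z. Im z > 0 \<Longrightarrow> norm (\<phi> z) \<le> B"
    and h: "h > 0" and s: "Re s > 1"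
begin

private abbreviation (input) "X \<equiv> {n. n \<noteq> 0 \<and> n + h \<noteq> 0}"
private abbreviation (input) "kern \<equiv> \<lambda>l :: real. exp (s * of_real l - of_real (2 * pi * of_int h * exp l))"
private abbreviation (input) "K \<equiv> \<lambda>(n :: int) (l :: real). bessel_K (\<i> * of_real r) (2 * pi * \<bar>of_int n\<bar> * exp l)"
private abbreviation (input) "b \<equiv> \<lambda>n. c n * cnj (c (n + h))"

private lemma B0: "B \<ge> 0"
  using order.trans[OF norm_ge_zero B[of \<i>]] by simp

private lemma whitt_product: "whitt r c (exp l) n * cnj (whitt r c (exp l) (n + h)) = of_real (exp l) * (b n * (K n l * K (n + h) l))"
proof -
  have "complex_of_real (sqrt (exp l)) * complex_of_real (sqrt (exp l)) = of_real (exp l)"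
    unfolding of_real_mult[symmetric] by simp
  moreover have "cnj (bessel_K (\<i> * of_real r) A) = bessel_K (\<i> * of_real r) A" for A
    by (simp add: bessel_K_eq cnj_macK)
  ultimately show ?thesis by (simp add: whitt_def mult_ac)
qed

private lemma norm_e: "norm (kern l) = exp l * exp ((Re s - 1) * l - 2 * pi * of_int h * exp l)"
  by (simp add: algebra_simps flip: exp_add)

private lemma nn_integral_bound_finite:
  "(\<integral>\<^sup>+l. ennreal (B\<^sup>2 * exp ((Re s - 1) * l - 2 * pi * of_int h * exp l)) \<partial>lborel) < \<infinity>"
proof -
  have "integrable lborel (\<lambda>l. B\<^sup>2 * exp ((Re s - 1) * l - 2 * pi * of_int h * exp l))"
    using s h by (intro integrable_mult_right integrable_Gamma_exp_scaled_real) auto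
  then have "(\<integral>\<^sup>+l. ennreal (norm (B\<^sup>2 * exp ((Re s - 1) * l - 2 * pi * of_int h * exp l))) \<partial>lborel) < \<infinity>"
    unfolding integrable_iff_bounded by blast
  then show ?thesis by (simp add: abs_mult)
qed

text \<open>At every height the Parseval bound B^2 controls the sum over n. Two factors sqrt(e^l)
  from the coefficients account for the drop from Re s to Re s - 1 in the exponent, so integrability
  over l is Re s > 1.\<close>

private lemma sum_norm_le:
  "(\<integral>\<^sup>+n. ennreal (norm (b n * (kern l * (K n l * K (n + h) l)))) \<partial>count_space X)
    \<le> ennreal (B\<^sup>2 * exp ((Re s - 1) * l - 2 * pi * of_int h * exp l))"
proof -
  let ?x = "\<lambda>n. norm (whitt r c (exp l) n)"
  let ?q = "exp ((Re s - 1) * l - 2 * pi * of_int h * exp l)"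
  have sq: "(\<lambda>n. (?x n)\<^sup>2) summable_on (- {0})" "infsum (\<lambda>n. (?x n)\<^sup>2) (- {0}) \<le> B\<^sup>2"
    by (rule maass_parseval[OF m f B], simp_all)+
  note prod = infsum_product_shift_le[OF sq(1), of h, simplified]
  have eq: "norm (b n * (kern l * (K n l * K (n + h) l))) = ?q * norm (?x n * ?x (n + h))" for n
  proof -
    have "?x n * ?x (n + h) = exp l * norm (b n * (K n l * K (n + h) l))"
      using arg_cong[OF whitt_product, of norm l n] by (simp add: norm_mult)
    then show ?thesis using norm_e[of l] by (simp add: norm_mult del: norm_exp_eq_Re)
  qed
  have "(\<integral>\<^sup>+n. ennreal (norm (b n * (kern l * (K n l * K (n + h) l)))) \<partial>count_space X) =
      (\<integral>\<^sup>+n. ennreal ?q * ennreal (norm (?x n * ?x (n + h))) \<partial>count_space X)"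
    unfolding eq by (simp add: ennreal_mult)
  also have "\<dots> = ennreal ?q * ennreal (infsum (\<lambda>n. norm (?x n * ?x (n + h))) X)"
  proof -
    have "(\<lambda>n. norm (?x n * ?x (n + h))) summable_on X" using prod(1) by simp
    from nn_integral_count_space_norm[OF this] show ?thesis
      by (subst nn_integral_cmult) simp_all
  qed
  also have "\<dots> = ennreal (?q * infsum (\<lambda>n. ?x n * ?x (n + h)) X)"
    by (simp add: ennreal_mult infsum_nonneg)
  also have "\<dots> \<le> ennreal (?q * B\<^sup>2)"
    using prod(2) sq(2) by (intro ennreal_leI mult_left_mono) auto
  finally show ?thesis by (simp add: mult.commute)
qed

private lemma exchange_sum:
  "(\<lambda>n. b n * (LINT l|lborel. kern l * (K n l * K (n + h) l))) summable_on X"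
  "(LINT l|lborel. (\<Sum>\<^sub>\<infinity>n\<in>X. b n * (kern l * (K n l * K (n + h) l)))) =
     (\<Sum>\<^sub>\<infinity>n\<in>X. b n * (LINT l|lborel. kern l * (K n l * K (n + h) l)))"
proof -
  have fin: "(\<integral>\<^sup>+l. (\<integral>\<^sup>+n. ennreal (norm (b n * (kern l * (K n l * K (n + h) l)))) \<partial>count_space X) \<partial>lborel) < \<infinity>"
    by (rule le_less_trans[OF nn_integral_mono[OF sum_norm_le] nn_integral_bound_finite])
  have c: "countable X" by simp
  have me: "(\<lambda>l. b n * (kern l * (K n l * K (n + h) l))) \<in> borel_measurable lborel" for n
    by measurable
  note I = integral_infsum[OF c sigma_finite_lborel me fin]
  show "(\<lambda>n. b n * (LINT l|lborel. kern l * (K n l * K (n + h) l))) summable_on X"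
    using I(3) by (simp only: integral_mult_right_zero)
  show "(LINT l|lborel. (\<Sum>\<^sub>\<infinity>n\<in>X. b n * (kern l * (K n l * K (n + h) l)))) =
     (\<Sum>\<^sub>\<infinity>n\<in>X. b n * (LINT l|lborel. kern l * (K n l * K (n + h) l)))"
    using I(4) by (simp only: integral_mult_right_zero)
qed

text \<open>The seed times |\<phi>|^2. The indicators make it Borel on the whole plane, since
  continuity of \<phi> is known only on the upper half plane.\<close>

private definition "k z = indicator upper_half_plane z *\<^sub>R
  (exp (s * of_real (ln (Im z))) * exp (2 * of_real pi * \<i> * of_int h * z) *
    of_real ((norm (indicator upper_half_plane z *\<^sub>R \<phi> z))\<^sup>2))"

private lemma k_eq:
  assumes "Im z > 0"
  shows "k z = poincare_seed h s z * of_real ((norm (\<phi> z))\<^sup>2)"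
  using assms by (simp add: k_def poincare_seed_def upper_half_plane_def of_real_powr_eq_exp)

private lemma k_strip:
  "k (Complex x (exp l)) = kern l * (\<phi> (Complex x (exp l)) * cnj (\<phi> (Complex x (exp l))) * ex h x)"
proof -
  have "exp (s * of_real l) * exp (2 * of_real pi * \<i> * of_int h * Complex x (exp l)) = kern l * ex h x"
    unfolding ex_def exp_add[symmetric] by (simp add: Complex_eq algebra_simps)
  then show ?thesis
    by (simp add: k_def upper_half_plane_def complex_norm_square mult_ac del: of_real_power)
qed

private lemma measurable_k: "k \<in> borel_measurable borel"
proof -
  have op: "upper_half_plane \<in> sets borel" unfolding upper_half_plane_def by measurable
  have "(\<lambda>z. indicator upper_half_plane z *\<^sub>R \<phi> z) \<in> borel_measurable borel"
    by (rule borel_measurable_continuous_on_indicator[OF op maass_continuous[OF m]])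
  then show ?thesis unfolding k_def using op by measurable
qed

private lemma k_strip_finite: "(\<integral>\<^sup>+z. ennreal (norm (indicator strip z *\<^sub>R k z)) \<partial>hyp_measure) < \<infinity>"
proof -
  note [measurable] = measurable_k
  have [measurable]: "strip \<in> sets borel" by measurable
  let ?q = "\<lambda>l. exp ((Re s - 1) * l - 2 * pi * of_int h * exp l)"
  have "(\<integral>\<^sup>+z. ennreal (norm (indicator strip z *\<^sub>R k z)) \<partial>hyp_measure) =
    (\<integral>\<^sup>+l. ennreal (exp (- l)) * (\<integral>\<^sup>+x. ennreal (norm (indicator strip (Complex x (exp l)) *\<^sub>R k (Complex x (exp l)))) \<partial>lborel) \<partial>lborel)"
    by (rule nn_integral_hyp_measure_strip) measurable
  also have "\<dots> \<le> (\<integral>\<^sup>+l. ennreal (B\<^sup>2 * ?q l) \<partial>lborel)"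
  proof (rule nn_integral_mono)
    fix l :: real
    have "(\<integral>\<^sup>+x. ennreal (norm (indicator strip (Complex x (exp l)) *\<^sub>R k (Complex x (exp l)))) \<partial>lborel) \<le>
      (\<integral>\<^sup>+x. ennreal (exp l * (B\<^sup>2 * ?q l)) * indicator {0..1::real} x \<partial>lborel)"
    proof (rule nn_integral_mono)
      fix x :: real
      have "norm (k (Complex x (exp l))) = norm (kern l) * (norm (\<phi> (Complex x (exp l))))\<^sup>2"
        unfolding k_strip by (simp add: norm_mult power2_eq_square del: norm_exp_eq_Re)
      also have "\<dots> \<le> norm (kern l) * B\<^sup>2"
        using B[of "Complex x (exp l)"] by (intro mult_left_mono power_mono) auto
      finally have "norm (k (Complex x (exp l))) \<le> exp l * (B\<^sup>2 * ?q l)"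
        unfolding norm_e by (simp only: mult_ac)
      then show "ennreal (norm (indicator strip (Complex x (exp l)) *\<^sub>R k (Complex x (exp l)))) \<le>
          ennreal (exp l * (B\<^sup>2 * ?q l)) * indicator {0..1::real} x"
        by (auto simp: indicator_def intro!: ennreal_leI)
    qed
    also have "\<dots> = ennreal (exp l * (B\<^sup>2 * ?q l))"
      by (subst nn_integral_cmult_indicator) (auto simp: emeasure_lborel_Icc_eq)
    finally have "ennreal (exp (- l)) * (\<integral>\<^sup>+x. ennreal (norm (indicator strip (Complex x (exp l)) *\<^sub>R k (Complex x (exp l)))) \<partial>lborel)
       \<le> ennreal (exp (- l)) * ennreal (exp l * (B\<^sup>2 * ?q l))"
      by (rule mult_left_mono) simp
    also have "\<dots> = ennreal (exp (- l) * exp l * (B\<^sup>2 * ?q l))"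
      by (subst ennreal_mult[symmetric]) (auto simp: mult.assoc)
    also have "exp (- l) * exp l = 1" by (simp flip: exp_add)
    finally show "ennreal (exp (- l)) * (\<integral>\<^sup>+x. ennreal (norm (indicator strip (Complex x (exp l)) *\<^sub>R k (Complex x (exp l)))) \<partial>lborel)
       \<le> ennreal (B\<^sup>2 * ?q l)" by simp
  qed
  also have "\<dots> < \<infinity>" by (rule nn_integral_bound_finite)
  finally show ?thesis .
qed

private lemma petersson_poincare:
  "petersson (\<lambda>z. poincare h z s) (\<lambda>z. of_real ((norm (\<phi> z))\<^sup>2)) =
    (\<Sum>\<^sub>\<infinity>n\<in>X. b n * (LINT l|lborel. kern l * (K n l * K (n + h) l)))"
proof -
  note [measurable] = measurable_k
  have [measurable]: "strip \<in> sets borel" by measurable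
  let ?S = "\<lambda>z. \<Sum>\<^sub>\<infinity>A\<in>SL2Z_pos. if act A z \<in> strip then k (act A z) else 0"
  have S: "poincare h z s * cnj (of_real ((norm (\<phi> z))\<^sup>2)) = ?S z" if "z \<in> fundamental_domain" for z
  proof -
    have z: "Im z > 0" using that by (simp add: fundamental_domain_def)
    have "k (act A z) = poincare_seed h s (act A z) * of_real ((norm (\<phi> z))\<^sup>2)" if "A \<in> SL2Z_pos" for A
    proof -
      have "\<phi> (act A z) = \<phi> z"
        using m z SL2Z_pos_SL2Z[OF that] by (simp add: maass_cusp_form_def upper_half_plane_def)
      then show ?thesis using Im_act_pos[OF SL2Z_pos_SL2Z[OF that] z] by (simp add: k_eq)
    qed
    then have "?S z = (\<Sum>\<^sub>\<infinity>A\<in>SL2Z_pos. (if act A z \<in> strip then poincare_seed h s (act A z) else 0) * of_real ((norm (\<phi> z))\<^sup>2))"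
      by (intro infsum_cong) auto
    also have "\<dots> = poincare h z s * of_real ((norm (\<phi> z))\<^sup>2)"
      unfolding poincare_eq_infsum[OF z] by (rule infsum_cmult_left')
    finally show ?thesis by simp
  qed
  note unf = unfold_to_strip[OF measurable_k k_strip_finite]
  have "petersson (\<lambda>z. poincare h z s) (\<lambda>z. of_real ((norm (\<phi> z))\<^sup>2)) = (LINT z|hyp_measure. indicator fundamental_domain z *\<^sub>R ?S z)"
    by (rule petersson_eq_hyp_measure[OF unf(1) S])
  also have "\<dots> = (LINT z|hyp_measure. indicator strip z *\<^sub>R k z)"
    by (rule unf(2))
  also have "\<dots> = (LINT l|lborel. exp (- l) *\<^sub>R (LINT x|lborel. indicator strip (Complex x (exp l)) *\<^sub>R k (Complex x (exp l))))"
    by (rule integral_hyp_measure_strip) (rule integrableI_bounded, measurable, rule k_strip_finite)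
  also have "\<dots> = (LINT l|lborel. (\<Sum>\<^sub>\<infinity>n\<in>X. b n * (kern l * (K n l * K (n + h) l))))"
  proof (intro Bochner_Integration.integral_cong refl)
    fix l :: real
    let ?p = "\<lambda>x. \<phi> (Complex x (exp l)) * cnj (\<phi> (Complex x (exp l))) * ex h x"
    have [measurable]: "(\<lambda>x. \<phi> (Complex x (exp l))) \<in> borel_measurable borel"
      by (rule measurable_maass_horizontal[OF m f B]) auto
    have "(LINT x|lborel. indicator strip (Complex x (exp l)) *\<^sub>R k (Complex x (exp l))) =
        (LINT x|lborel. kern l * (indicator {0..1::real} x *\<^sub>R ?p x))"
    proof (rule integral_cong_AE)
      \<comment> \<open>The half-open strip and the closed interval differ at x = 1 only.\<close>
      show "AE x in lborel. indicator strip (Complex x (exp l)) *\<^sub>R k (Complex x (exp l)) = kern l * (indicator {0..1::real} x *\<^sub>R ?p x)"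
        using AE_lborel_singleton[of 1] by eventually_elim (auto simp: indicator_def k_strip)
    qed measurable
    also have "\<dots> = kern l * (LINT x:{0..1}|lborel. ?p x)"
      unfolding set_lebesgue_integral_def by (rule integral_mult_right_zero)
    also have "(LINT x:{0..1}|lborel. ?p x) = (\<Sum>\<^sub>\<infinity>n\<in>X. of_real (exp l) * (b n * (K n l * K (n + h) l)))"
      using maass_parseval(1)[OF m f B, of "exp l" h] unfolding whitt_product by simp
    also have "\<dots> = of_real (exp l) * (\<Sum>\<^sub>\<infinity>n\<in>X. b n * (K n l * K (n + h) l))"
      by (rule infsum_cmult_right')
    finally have "exp (- l) *\<^sub>R (LINT x|lborel. indicator strip (Complex x (exp l)) *\<^sub>R k (Complex x (exp l))) =
        (of_real (exp (- l)) * of_real (exp l)) * (kern l * (\<Sum>\<^sub>\<infinity>n\<in>X. b n * (K n l * K (n + h) l)))"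
      by (simp only: scaleR_conv_of_real mult_ac)
    also have "of_real (exp (- l)) * of_real (exp l) = (1 :: complex)"
      by (simp flip: of_real_mult exp_add)
    also have "1 * (kern l * (\<Sum>\<^sub>\<infinity>n\<in>X. b n * (K n l * K (n + h) l))) = (\<Sum>\<^sub>\<infinity>n\<in>X. b n * (kern l * (K n l * K (n + h) l)))"
      unfolding mult_1 infsum_cmult_right'[symmetric] by (rule infsum_cong) (rule mult.left_commute)
    finally show "exp (- l) *\<^sub>R (LINT x|lborel. indicator strip (Complex x (exp l)) *\<^sub>R k (Complex x (exp l))) =
        (\<Sum>\<^sub>\<infinity>n\<in>X. b n * (kern l * (K n l * K (n + h) l)))" .
  qed
  also have "\<dots> = (\<Sum>\<^sub>\<infinity>n\<in>X. b n * (LINT l|lborel. kern l * (K n l * K (n + h) l)))"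
    by (rule exchange_sum(2))
  finally show ?thesis .
qed

text \<open>On a set N where n(n+h) has constant sign, \<open>rel\<close> holds with one a and the
  formula for a single pair of modes applies to every n. On the line the n-th power has modulus
  independent of t, so the double integrand is dominated by \<open>summ\<close> times the integrable
  kernel.\<close>

private lemma sum_mellin_barnes:
  fixes \<sigma> a :: real
  assumes \<sigma>: "\<sigma> < 0" and a: "a \<ge> 0" and int: "integrable lborel (\<lambda>\<tau>. exp (\<sigma> * ln (coshk a \<tau>)))"
    and sw: "Re s + 2 * \<sigma> > 0" and N: "N \<subseteq> X"
    and rel: "\<And>n. n \<in> N \<Longrightarrow> \<bar>of_int n\<bar>\<^sup>2 + \<bar>of_int (n + h)\<bar>\<^sup>2 = (of_int h)\<^sup>2 + (2 * a - 2) * (\<bar>of_int n\<bar> * \<bar>real_of_int (n + h)\<bar>)"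
    and summ: "(\<lambda>n. norm (b n) * (\<bar>of_int n\<bar> * \<bar>of_int (n + h)\<bar>) powr \<sigma>) summable_on N"
  shows "(\<Sum>\<^sub>\<infinity>n\<in>N. b n * (LINT l|lborel. kern l * (K n l * K (n + h) l))) =
    Gamma s / (2 * of_real (2 * pi * of_int h) powr s) * (1 / (2 * of_real pi * \<i>) *
      vertical_integral \<sigma> (\<lambda>w. barnes_kernel h s w * calF r a (- 2 * w) *
       (\<Sum>\<^sub>\<infinity>n\<in>N. b n * of_int \<bar>n * (n + h)\<bar> powr w)))"
proof -
  define w where "w = (\<lambda>t. of_real \<sigma> + \<i> * of_real t)"
  have s0: "Re s > 0" using s by simp
  let ?C = "Gamma s / (2 * of_real (2 * pi * of_int h) powr s)"
  let ?F = "\<lambda>t. barnes_kernel h s (w t) * calF r a (- 2 * w t)"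
  let ?P = "\<lambda>n. \<bar>real_of_int n\<bar> * \<bar>real_of_int (n + h)\<bar>"
  have F: "integrable lborel ?F"
    by (rule integrable_barnes_kernel_calF[OF \<sigma> a int h s0 sw w_def refl])
  have [measurable]: "?F \<in> borel_measurable lborel" using F by auto
  have P: "?P n > 0" if "n \<in> N" for n using that N by (auto simp del: of_int_add)
  have powr: "of_int \<bar>n * (n + h)\<bar> powr w t = of_real (?P n) powr w t" for n t
    unfolding of_real_of_int_eq[where 'a=complex, symmetric] of_int_abs of_int_mult abs_mult ..
  have norm_powr: "norm (of_real (?P n) powr w t) = ?P n powr \<sigma>" if "n \<in> N" for n t
    using P[OF that] by (simp add: norm_powr_real_powr w_def del: of_real_mult)
  have "(\<lambda>t. of_real (?P n) powr w t) \<in> borel_measurable lborel" if "n \<in> N" for n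
    unfolding of_real_powr_eq_exp[OF P[OF that]] w_def by measurable
  note meas = borel_measurable_times[OF borel_measurable_const
      borel_measurable_times[OF borel_measurable_integrable[OF F] this]]
  let ?S = "infsum (\<lambda>n. norm (b n) * ?P n powr \<sigma>) N"
  have fin: "(\<integral>\<^sup>+t. (\<integral>\<^sup>+n. ennreal (norm (b n * (?F t * of_real (?P n) powr w t))) \<partial>count_space N) \<partial>lborel) < \<infinity>"
  proof -
    have "(\<integral>\<^sup>+n. ennreal (norm (b n * (?F t * of_real (?P n) powr w t))) \<partial>count_space N) = ennreal ?S * ennreal (norm (?F t))" for t
    proof -
      have "(\<integral>\<^sup>+n. ennreal (norm (b n * (?F t * of_real (?P n) powr w t))) \<partial>count_space N) =
         (\<integral>\<^sup>+n. ennreal (norm (?F t)) * ennreal (norm (norm (b n) * ?P n powr \<sigma>)) \<partial>count_space N)"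
      proof (rule nn_integral_cong)
        fix n assume "n \<in> space (count_space N)"
        then have n: "n \<in> N" by simp
        have "norm (b n * (?F t * of_real (?P n) powr w t)) = norm (?F t) * norm (norm (b n) * ?P n powr \<sigma>)"
          unfolding norm_mult[of _ "_ powr _"] norm_mult[of "b n"] norm_powr[OF n] by simp
        then show "ennreal (norm (b n * (?F t * of_real (?P n) powr w t))) =
            ennreal (norm (?F t)) * ennreal (norm (norm (b n) * ?P n powr \<sigma>))"
          by (simp only: ennreal_mult norm_ge_zero)
      qed
      also have "\<dots> = ennreal (norm (?F t)) * ennreal (infsum (\<lambda>n. norm (norm (b n) * ?P n powr \<sigma>)) N)"
      proof -
        have "(\<lambda>n. norm (norm (b n) * ?P n powr \<sigma>)) summable_on N" using summ by (simp add: abs_mult)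
        from nn_integral_count_space_norm[OF this] show ?thesis
          by (subst nn_integral_cmult) simp_all
      qed
      also have "\<dots> = ennreal ?S * ennreal (norm (?F t))"
        by (simp add: abs_mult mult.commute)
      finally show ?thesis .
    qed
    then have "(\<integral>\<^sup>+t. (\<integral>\<^sup>+n. ennreal (norm (b n * (?F t * of_real (?P n) powr w t))) \<partial>count_space N) \<partial>lborel) =
       ennreal ?S * (\<integral>\<^sup>+t. ennreal (norm (?F t)) \<partial>lborel)"
      by (simp only:) (rule nn_integral_cmult, measurable)
    also have "\<dots> < \<infinity>"
      using F unfolding integrable_iff_bounded by (simp add: ennreal_mult_less_top)
    finally show ?thesis .
  qed
  have "vertical_integral \<sigma> (\<lambda>w. barnes_kernel h s w * calF r a (- 2 * w) *
       (\<Sum>\<^sub>\<infinity>n\<in>N. b n * of_int \<bar>n * (n + h)\<bar> powr w)) =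
    (LINT t|lborel. (\<Sum>\<^sub>\<infinity>n\<in>N. b n * (?F t * of_real (?P n) powr w t)) * \<i>)"
  proof -
    have "Complex \<sigma> t = w t" for t by (simp add: w_def Complex_eq)
    moreover have "?F t * (\<Sum>\<^sub>\<infinity>n\<in>N. b n * of_real (?P n) powr w t) = (\<Sum>\<^sub>\<infinity>n\<in>N. b n * (?F t * of_real (?P n) powr w t))" for t
      unfolding infsum_cmult_right'[symmetric] by (simp only: mult_ac)
    ultimately show ?thesis unfolding vertical_integral_def by (simp only: powr)
  qed
  also have "\<dots> = (\<Sum>\<^sub>\<infinity>n\<in>N. LINT t|lborel. b n * (?F t * of_real (?P n) powr w t)) * \<i>"
  proof -
    have "(LINT t|lborel. (\<Sum>\<^sub>\<infinity>n\<in>N. b n * (?F t * of_real (?P n) powr w t))) =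
        (\<Sum>\<^sub>\<infinity>n\<in>N. LINT t|lborel. b n * (?F t * of_real (?P n) powr w t))"
      by (rule integral_infsum(4)[OF _ sigma_finite_lborel meas fin]) auto
    then show ?thesis by simp
  qed
  finally have V: "vertical_integral \<sigma> (\<lambda>w. barnes_kernel h s w * calF r a (- 2 * w) *
       (\<Sum>\<^sub>\<infinity>n\<in>N. b n * of_int \<bar>n * (n + h)\<bar> powr w)) =
       (\<Sum>\<^sub>\<infinity>n\<in>N. LINT t|lborel. b n * (?F t * of_real (?P n) powr w t)) * \<i>" .
  have "(\<Sum>\<^sub>\<infinity>n\<in>N. b n * (LINT l|lborel. kern l * (K n l * K (n + h) l))) =
      (\<Sum>\<^sub>\<infinity>n\<in>N. ?C / (2 * pi) * (LINT t|lborel. b n * (?F t * of_real (?P n) powr w t)))"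
  proof (rule infsum_cong)
    fix n assume n: "n \<in> N"
    then have "n \<noteq> 0" "n + h \<noteq> 0" using N by auto
    then have pos: "\<bar>real_of_int n\<bar> > 0" "\<bar>real_of_int (n + h)\<bar> > 0" by (auto simp del: of_int_add)
    have "(LINT l|lborel. kern l * (K n l * K (n + h) l)) = ?C * ((LINT t|lborel. ?F t * of_real (?P n) powr w t) / (2 * pi))"
      by (rule bessel_product_mellin_barnes[OF \<sigma> a int h s0 sw w_def refl pos rel[OF n]])
    then show "b n * (LINT l|lborel. kern l * (K n l * K (n + h) l)) =
        ?C / (2 * pi) * (LINT t|lborel. b n * (?F t * of_real (?P n) powr w t))"
      by (simp only: integral_mult_right_zero) simp
  qed
  also have "\<dots> = ?C / (2 * pi) * (\<Sum>\<^sub>\<infinity>n\<in>N. LINT t|lborel. b n * (?F t * of_real (?P n) powr w t))"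
    by (rule infsum_cmult_right')
  \<comment> \<open>The factor i in \<open>vertical_integral\<close> cancels the i of 1 / (2 pi
    i).\<close>
  finally show ?thesis unfolding V by (simp add: field_simps)
qed

text \<open>As (n + h) - n = h, the sum n^2 + (n+h)^2 equals h^2 + 2 n (n+h). Hence a = 2 outside
  the interval from -h to 0 and a = 0 inside it; the endpoints are absent since a cusp form has no
  zeroth coefficient.\<close>

lemma petersson_poincare_mellin_barnes:
  assumes \<epsilon>: "0 < \<epsilon>" "\<epsilon> < 1 / 2" and s\<epsilon>: "Re s > 1 + 2 * \<epsilon>"
  shows "petersson (\<lambda>z. poincare h z s) (\<lambda>z. of_real ((norm (\<phi> z))\<^sup>2)) =
           Gamma s / (2 * of_real (2 * pi * of_int h) powr s) *
             (calG \<epsilon> r h (\<lambda>n. c n * cnj (c (n + h))) s + calT \<epsilon> r h (\<lambda>n. c n * cnj (c (n + h))) s)"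
proof -
  let ?I = "\<lambda>n. b n * (LINT l|lborel. kern l * (K n l * K (n + h) l))"
  let ?G = "{n. n < - h \<or> n > 0}" and ?T = "{n. - h < n \<and> n < 0}"
  let ?C = "Gamma s / (2 * of_real (2 * pi * of_int h) powr s)"
  have X: "X = ?G \<union> ?T" and sub: "?G \<subseteq> X" "?T \<subseteq> X" using h by auto
  have finT: "finite ?T" by (rule finite_subset[of _ "{- h..0}"]) auto
  have G: "infsum ?I ?G = ?C * calG \<epsilon> r h b s"
    unfolding calG_def
  proof (rule sum_mellin_barnes[OF _ _ _ _ sub(1)])
    show "integrable lborel (\<lambda>\<tau>. exp ((- 1 / 2 - \<epsilon>) * ln (coshk 2 \<tau>)))"
      using \<epsilon> by (intro integrable_coshk_2) auto
    fix n assume "n \<in> ?G"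
    then have "n * (n + h) > 0" using h by (auto simp: zero_less_mult_iff)
    then have "real_of_int (n * (n + h)) > 0" by (simp only: of_int_0_less_iff)
    then have "\<bar>real_of_int n\<bar> * \<bar>real_of_int (n + h)\<bar> = of_int n * of_int (n + h)"
      unfolding abs_mult[symmetric] by simp
    then show "\<bar>of_int n\<bar>\<^sup>2 + \<bar>of_int (n + h)\<bar>\<^sup>2 = (of_int h)\<^sup>2 + (2 * 2 - 2) * (\<bar>of_int n\<bar> * \<bar>real_of_int (n + h)\<bar>)"
      by (simp add: power2_eq_square algebra_simps)
  next
    let ?x = "\<lambda>n. norm (c n) * \<bar>real_of_int n\<bar> powr (- 1 / 2 - \<epsilon>)"
    \<comment> \<open>Splitting the power of |n (n+h)| evenly leaves exponent -1/2 - \<epsilon> for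
      each factor; squared, this is the mean-square bound with \<delta> = 2\<epsilon>.\<close>
    have sq: "(\<lambda>n. (?x n)\<^sup>2) summable_on (- {0})"
    proof -
      have "(?x n)\<^sup>2 = (norm (c n))\<^sup>2 * \<bar>real_of_int n\<bar> powr (- 1 - 2 * \<epsilon>)" for n
        by (simp add: power_mult_distrib power2_eq_square flip: powr_add)
      then show ?thesis using coeff_square_summable[OF m f B, of "2 * \<epsilon>"] \<epsilon> by simp
    qed
    have "(\<lambda>n. ?x n * ?x (n + h)) summable_on X"
      by (rule infsum_product_shift_le(1)[OF sq]) simp
    then have "(\<lambda>n. ?x n * ?x (n + h)) summable_on ?G" by (rule summable_on_subset[OF _ sub(1)])
    then show "(\<lambda>n. norm (b n) * (\<bar>of_int n\<bar> * \<bar>of_int (n + h)\<bar>) powr (- 1 / 2 - \<epsilon>)) summable_on ?G"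
      by (simp add: norm_mult powr_mult mult_ac)
  qed (use \<epsilon> s\<epsilon> in auto)
  have T: "infsum ?I ?T = ?C * calT \<epsilon> r h b s"
    unfolding calT_def infsum_finite[OF finT, symmetric]
  proof (rule sum_mellin_barnes[OF _ _ _ _ sub(2)])
    show "integrable lborel (\<lambda>\<tau>. exp ((- 1 / 2 + \<epsilon>) * ln (coshk 0 \<tau>)))"
      using \<epsilon> by (intro integrable_coshk_0) auto
    fix n assume "n \<in> ?T"
    then have "n * (n + h) < 0" by (auto simp: mult_less_0_iff)
    then have "real_of_int (n * (n + h)) < 0" by (simp only: of_int_less_0_iff)
    then have "\<bar>real_of_int n\<bar> * \<bar>real_of_int (n + h)\<bar> = - (of_int n * of_int (n + h))"
      unfolding abs_mult[symmetric] by simp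
    then show "\<bar>of_int n\<bar>\<^sup>2 + \<bar>of_int (n + h)\<bar>\<^sup>2 = (of_int h)\<^sup>2 + (2 * 0 - 2) * (\<bar>of_int n\<bar> * \<bar>real_of_int (n + h)\<bar>)"
      by (simp add: power2_eq_square algebra_simps)
  qed (use \<epsilon> s\<epsilon> finT in auto)
  have "petersson (\<lambda>z. poincare h z s) (\<lambda>z. of_real ((norm (\<phi> z))\<^sup>2)) = infsum ?I (?G \<union> ?T)"
    unfolding petersson_poincare X ..
  also have "\<dots> = infsum ?I ?G + infsum ?I ?T"
    by (rule infsum_Un_disjoint[OF summable_on_subset[OF exchange_sum(1) sub(1)]
        summable_on_subset[OF exchange_sum(1) sub(2)]]) auto
  also have "\<dots> = ?C * (calG \<epsilon> r h b s + calT \<epsilon> r h b s)"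
    unfolding G T by (rule distrib_left[symmetric])
  finally show ?thesis .
qed

end

lemma calG_cong:
  assumes "\<And>n. n \<noteq> 0 \<Longrightarrow> n + h \<noteq> 0 \<Longrightarrow> a n = a' n" and "h > 0"
  shows "calG \<epsilon> r h a s = calG \<epsilon> r h a' s"
proof -
  have "(\<Sum>\<^sub>\<infinity>n\<in>{n. n < - h \<or> n > 0}. a n * of_int \<bar>n * (n + h)\<bar> powr w) =
      (\<Sum>\<^sub>\<infinity>n\<in>{n. n < - h \<or> n > 0}. a' n * of_int \<bar>n * (n + h)\<bar> powr w)" for w
    by (rule infsum_cong) (use assms in auto)
  then show ?thesis unfolding calG_def by simp
qed

lemma calT_cong:
  assumes "\<And>n. n \<noteq> 0 \<Longrightarrow> n + h \<noteq> 0 \<Longrightarrow> a n = a' n"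
  shows "calT \<epsilon> r h a s = calT \<epsilon> r h a' s"
proof -
  have "(\<Sum>n\<in>{n. - h < n \<and> n < 0}. a n * of_int \<bar>n * (n + h)\<bar> powr w) =
      (\<Sum>n\<in>{n. - h < n \<and> n < 0}. a' n * of_int \<bar>n * (n + h)\<bar> powr w)" for w
    by (rule sum.cong) (use assms in auto)
  then show ?thesis unfolding calT_def by simp
qed

theorem theorem8p1:
  fixes \<phi> :: "complex \<Rightarrow> complex" and r \<epsilon> :: real and c :: "int \<Rightarrow> complex"
    and h :: int and s :: complex
  assumes "maass_cusp_form (of_real (1 / 4 + r\<^sup>2)) \<phi>"
    and "has_fourier_expansion \<phi> r c"
    and "h > 0"
    and "0 < \<epsilon>" and "\<epsilon> < 1 / 2"
    and "Re s > 1 + 2 * \<epsilon>"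
  shows "petersson (\<lambda>z. poincare h z s) (\<lambda>z. of_real ((norm (\<phi> z))\<^sup>2)) =
           Gamma s / (2 * of_real (2 * pi * of_int h) powr s) *
             (calG \<epsilon> r h (\<lambda>n. c n * cnj (c (n + h))) s + calT \<epsilon> r h (\<lambda>n. c n * cnj (c (n + h))) s)
       \<and> ((\<forall>n. n \<noteq> 0 \<longrightarrow> c n \<in> \<real>) \<longrightarrow>
         petersson (\<lambda>z. poincare h z s) (\<lambda>z. of_real ((norm (\<phi> z))\<^sup>2)) =
           Gamma s / (2 * of_real (2 * pi * of_int h) powr s) *
             (calG \<epsilon> r h (\<lambda>n. c n * c (n + h)) s + calT \<epsilon> r h (\<lambda>n. c n * c (n + h)) s))"
proof (intro conjI impI)
  obtain B where B: "\<And>z. Im z > 0 \<Longrightarrow> norm (\<phi> z) \<le> B"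
    using maass_bounded[OF assms(1,2)] by blast
  have s: "Re s > 1" using assms by simp
  show *: "petersson (\<lambda>z. poincare h z s) (\<lambda>z. of_real ((norm (\<phi> z))\<^sup>2)) =
           Gamma s / (2 * of_real (2 * pi * of_int h) powr s) *
             (calG \<epsilon> r h (\<lambda>n. c n * cnj (c (n + h))) s + calT \<epsilon> r h (\<lambda>n. c n * cnj (c (n + h))) s)"
    using petersson_poincare_mellin_barnes[OF assms(1,2) B assms(3) s assms(4-6)] .
  assume real: "\<forall>n. n \<noteq> 0 \<longrightarrow> c n \<in> \<real>"
  \<comment> \<open>The value \<open>c 0\<close> does not enter the expansion and may be any complex
    number, so n = -h is excluded.\<close>
  have "c n * cnj (c (n + h)) = c n * c (n + h)" if "n + h \<noteq> 0" for n
    using real that by (simp add: Reals_cnj_iff)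
  then show "petersson (\<lambda>z. poincare h z s) (\<lambda>z. of_real ((norm (\<phi> z))\<^sup>2)) =
           Gamma s / (2 * of_real (2 * pi * of_int h) powr s) *
             (calG \<epsilon> r h (\<lambda>n. c n * c (n + h)) s + calT \<epsilon> r h (\<lambda>n. c n * c (n + h)) s)"
    unfolding * using assms(3)
      calG_cong[of h "\<lambda>n. c n * cnj (c (n + h))" "\<lambda>n. c n * c (n + h)"]
      calT_cong[of h "\<lambda>n. c n * cnj (c (n + h))" "\<lambda>n. c n * c (n + h)"]
    by simp
qed

end
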